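(* There is an absolute constant $C>0$ such that for every integer $n\ge1$ and every (finite) Blaschke product $B$ of degree $n$, the composition operator $C_B:\mathscr M\to\mathscr M$, $C_Bf=f\circ B$, satisfies \[C^{-1}\,n\le\|C_B\|_e\le C\,n\qquad\text{and}\qquad C^{-1}\,n\le\|C_B\|\le C\,n .\]
   Context: $\mathbb D\subset\mathbb C$ is the open unit disk. For $\alpha\in\overline{\mathbb D}$, $\varphi_\alpha(z)=\dfrac{\alpha-z}{1-\overline\alpha z}$, $z\in\mathbb D$. A Blaschke product of degree $n$ is a function $B=c\prod_{j=1}^n\varphi_{\alpha_j}$ with $|c|=1$ and $\alpha_1,\dots,\alpha_n\in\mathbb D$ (not necessarily distinct). The minimal M\"obius invariant space $\mathscr M$ is the set of all analytic functions $f$ on $\mathbb D$ for which there exist points $\alpha_k\in\overline{\mathbb D}$ and $\lambda=(\lambda(k))_{k\ge1}\in\ell^1$ (complex) with $f(z)=\sum_{k=1}^\infty\lambda(k)\varphi_{\alpha_k}(z)$; it is normed by $\|f\|_{\mathscr M}=\inf\|\lambda\|_{\ell^1}$, the infimum being over all such representations of $f$. $\|C_B\|$ is the operator norm on $(\mathscr M,\|\cdot\|_{\mathscr M})$ and $\|C_B\|_e=\inf\{\|C_B-K\|: K:\mathscr M\to\mathscr M \text{ compact linear operator}\}$ is the essential norm. "Absolute constant" means a numerical constant independent of $n$ and $B$. *)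

theory Defs
  imports "HOL-Analysis.Analysis"
begin

section \<open>The minimal Moebius invariant space\<close>

abbreviation unit_disc :: "complex set" where
  "unit_disc \<equiv> ball 0 1"

definition phi :: "complex \<Rightarrow> complex \<Rightarrow> complex" where
  "phi \<alpha> z = (\<alpha> - z) / (1 - cnj \<alpha> * z)"

definition represents ::
    "(complex \<Rightarrow> complex) \<Rightarrow> (nat \<Rightarrow> complex) \<Rightarrow> (nat \<Rightarrow> complex) \<Rightarrow> bool" where
  "represents f \<alpha> l \<longleftrightarrow>
     (\<forall>k. \<alpha> k \<in> cball 0 1) \<and> summable (\<lambda>k. norm (l k)) \<and>
     (\<forall>z\<in>unit_disc. (\<lambda>k. l k * phi (\<alpha> k) z) sums f z)"

text \<open>A function on the disc is encoded by its extension by 0 to the whole plane, so that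
  equality of encodings is equality of functions on the disc.\<close>

definition on_disc :: "(complex \<Rightarrow> complex) \<Rightarrow> complex \<Rightarrow> complex" where
  "on_disc f z = (if z \<in> unit_disc then f z else 0)"

definition minimal_space :: "(complex \<Rightarrow> complex) set" where
  "minimal_space =
     {f. on_disc f = f \<and> f analytic_on unit_disc \<and> (\<exists>\<alpha> l. represents f \<alpha> l)}"

definition minimal_norm :: "(complex \<Rightarrow> complex) \<Rightarrow> real" where
  "minimal_norm f = Inf {\<Sum>k. norm (l k) | \<alpha> l. represents f \<alpha> l}"

lemma on_disc_eq_iff: "on_disc f = f \<longleftrightarrow> (\<forall>z. z \<notin> unit_disc \<longrightarrow> f z = 0)"
  by (auto simp: on_disc_def fun_eq_iff)

lemma norm_phi_le_1:
  assumes "\<alpha> \<in> cball 0 1" "z \<in> unit_disc"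
  shows "norm (phi \<alpha> z) \<le> 1"
proof -
  have a: "norm \<alpha> \<le> 1" and z: "norm z < 1"
    using assms by auto
  have "(norm \<alpha>)\<^sup>2 \<le> 1" "(norm z)\<^sup>2 \<le> 1"
    using power_mono[of "norm \<alpha>" 1 2] power_mono[of "norm z" 1 2] a z by simp_all
  then have "0 \<le> (1 - (norm \<alpha>)\<^sup>2) * (1 - (norm z)\<^sup>2)"
    by simp
  also have "\<dots> = (norm (1 - cnj \<alpha> * z))\<^sup>2 - (norm (\<alpha> - z))\<^sup>2"
  proof -
    have "(1 - (a\<^sup>2 + b\<^sup>2)) * (1 - (x\<^sup>2 + y\<^sup>2)) =
        ((1 - (a * x + b * y))\<^sup>2 + (b * x - a * y)\<^sup>2) - ((a - x)\<^sup>2 + (b - y)\<^sup>2)"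
      for a b x y :: real
      by (simp add: power2_eq_square algebra_simps)
    from this[of "Re \<alpha>" "Im \<alpha>" "Re z" "Im z"] show ?thesis
      by (simp add: cmod_power2)
  qed
  finally have "norm (\<alpha> - z) \<le> norm (1 - cnj \<alpha> * z)"
    by (intro power2_le_imp_le[OF _ norm_ge_zero]) linarith
  then show ?thesis
    by (simp add: phi_def norm_divide divide_le_eq_1)
qed

lemma represents_zero: "represents (\<lambda>z. 0) (\<lambda>k. 0) (\<lambda>k. 0)"
  by (simp add: represents_def)

lemma represents_scale:
  assumes "represents f \<alpha> l"
  shows "represents (\<lambda>z. c * f z) \<alpha> (\<lambda>k. c * l k)"
  unfolding represents_def mult.assoc norm_mult
proof (intro conjI ballI)
  show "summable (\<lambda>k. norm c * norm (l k))"
    using assms unfolding represents_def by (intro summable_mult) blast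
  show "(\<lambda>k. c * (l k * phi (\<alpha> k) z)) sums (c * f z)" if "z \<in> unit_disc" for z
    using assms that unfolding represents_def by (intro sums_mult) blast
qed (use assms in \<open>simp add: represents_def\<close>)

lemma sums_interleave:
  fixes f g :: "nat \<Rightarrow> 'a::real_normed_vector"
  assumes "f sums x" "g sums y"
  shows "(\<lambda>k. if even k then f (k div 2) else g (k div 2)) sums (x + y)"
proof -
  have "(\<lambda>k. if even k then f (k div 2) else 0) sums x"
    using assms(1)
    by (subst sums_mono_reindex[of "\<lambda>k. 2 * k", symmetric]) (auto simp: strict_mono_def elim!: evenE)
  moreover have "(\<lambda>k. if even k then 0 else g (k div 2)) sums y"
    using assms(2)
    by (subst sums_mono_reindex[of "\<lambda>k. 2 * k + 1", symmetric]) (auto simp: strict_mono_def elim!: oddE)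
  ultimately have "(\<lambda>k. (if even k then f (k div 2) else 0) + (if even k then 0 else g (k div 2))) sums (x + y)"
    by (rule sums_add)
  then show ?thesis
    by (rule back_subst[of "\<lambda>h. h sums (x + y)"]) auto
qed

lemma represents_add:
  assumes f: "represents f \<alpha> l" and g: "represents g \<beta> m"
  obtains \<gamma> n where "represents (\<lambda>z. f z + g z) \<gamma> n"
    "(\<Sum>k. norm (n k)) = (\<Sum>k. norm (l k)) + (\<Sum>k. norm (m k))"
proof -
  define \<gamma> where "\<gamma> k = (if even k then \<alpha> (k div 2) else \<beta> (k div 2))" for k
  define n where "n k = (if even k then l (k div 2) else m (k div 2))" for k
  have norm_n: "(\<lambda>k. norm (n k)) = (\<lambda>k. if even k then norm (l (k div 2)) else norm (m (k div 2)))"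
    by (auto simp: n_def)
  have s: "(\<lambda>k. norm (n k)) sums ((\<Sum>k. norm (l k)) + (\<Sum>k. norm (m k)))"
    unfolding norm_n using f g by (intro sums_interleave) (auto simp: represents_def summable_sums)
  have "(\<lambda>k. n k * phi (\<gamma> k) z) sums (f z + g z)" if "z \<in> unit_disc" for z
  proof -
    have "(\<lambda>k. n k * phi (\<gamma> k) z) = (\<lambda>k. if even k then l (k div 2) * phi (\<alpha> (k div 2)) z
        else m (k div 2) * phi (\<beta> (k div 2)) z)"
      by (auto simp: n_def \<gamma>_def)
    also have "\<dots> sums (f z + g z)"
      using f g that by (intro sums_interleave[of "\<lambda>k. l k * phi (\<alpha> k) z" _ "\<lambda>k. m k * phi (\<beta> k) z"])
        (auto simp: represents_def)
    finally show ?thesis .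
  qed
  moreover have "\<gamma> k \<in> cball 0 1" for k
    using f g by (auto simp: represents_def \<gamma>_def)
  ultimately have "represents (\<lambda>z. f z + g z) \<gamma> n"
    using s by (auto simp: represents_def sums_iff)
  moreover have "(\<Sum>k. norm (n k)) = (\<Sum>k. norm (l k)) + (\<Sum>k. norm (m k))"
    using s by (simp add: sums_iff)
  ultimately show ?thesis
    by (rule that)
qed

lemma norm_le_represents:
  assumes "represents f \<alpha> l" "z \<in> unit_disc"
  shows "norm (f z) \<le> (\<Sum>k. norm (l k))"
proof -
  have s: "summable (\<lambda>k. norm (l k))" and f: "f z = (\<Sum>k. l k * phi (\<alpha> k) z)"
    using assms by (auto simp: represents_def sums_iff)
  have le: "norm (l k * phi (\<alpha> k) z) \<le> norm (l k)" for k
    using norm_phi_le_1[of "\<alpha> k" z] assms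
    by (auto simp: represents_def norm_mult intro: mult_left_le)
  have s': "summable (\<lambda>k. norm (l k * phi (\<alpha> k) z))"
    using le by (intro summable_comparison_test[OF _ s]) auto
  show ?thesis
    unfolding f using summable_norm[OF s'] suminf_le[OF le s' s] by linarith
qed

lemma minimal_norm_le:
  assumes "represents f \<alpha> l"
  shows "minimal_norm f \<le> (\<Sum>k. norm (l k))"
  unfolding minimal_norm_def
proof (rule cInf_lower)
  show "bdd_below {\<Sum>k. norm (l k) | \<alpha> l. represents f \<alpha> l}"
    by (rule bdd_belowI[of _ 0]) (auto simp: represents_def intro: suminf_nonneg)
qed (use assms in auto)

lemma minimal_norm_ge:
  assumes "f \<in> minimal_space" "\<And>\<alpha> l. represents f \<alpha> l \<Longrightarrow> b \<le> (\<Sum>k. norm (l k))"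
  shows "b \<le> minimal_norm f"
  unfolding minimal_norm_def
  by (rule cInf_greatest) (use assms in \<open>auto simp: minimal_space_def\<close>)

lemma norm_le_minimal_norm:
  assumes "f \<in> minimal_space" "z \<in> unit_disc"
  shows "norm (f z) \<le> minimal_norm f"
  using assms by (intro minimal_norm_ge norm_le_represents)

lemma minimal_space_zero: "(\<lambda>z. 0) \<in> minimal_space"
  using represents_zero by (auto simp: minimal_space_def on_disc_eq_iff)

lemma minimal_space_add:
  "f \<in> minimal_space \<Longrightarrow> g \<in> minimal_space \<Longrightarrow> (\<lambda>z. f z + g z) \<in> minimal_space"
  unfolding minimal_space_def on_disc_eq_iff
  by (auto intro!: analytic_intros) (metis represents_add)

lemma minimal_space_scale: "f \<in> minimal_space \<Longrightarrow> (\<lambda>z. c * f z) \<in> minimal_space"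
  unfolding minimal_space_def on_disc_eq_iff
  by (auto intro!: analytic_intros) (metis represents_scale)

lemma minimal_norm_add:
  assumes f: "f \<in> minimal_space" and g: "g \<in> minimal_space"
  shows "minimal_norm (\<lambda>z. f z + g z) \<le> minimal_norm f + minimal_norm g"
proof -
  have 1: "minimal_norm (\<lambda>z. f z + g z) \<le> (\<Sum>k. norm (l k)) + (\<Sum>k. norm (m k))"
    if "represents f \<alpha> l" "represents g \<beta> m" for \<alpha> l \<beta> m
    using represents_add[OF that] minimal_norm_le by metis
  have 2: "minimal_norm (\<lambda>z. f z + g z) - (\<Sum>k. norm (l k)) \<le> minimal_norm g"
    if "represents f \<alpha> l" for \<alpha> l
    using 1[OF that] by (intro minimal_norm_ge[OF g]) (simp add: algebra_simps)
  have "minimal_norm (\<lambda>z. f z + g z) - minimal_norm g \<le> minimal_norm f"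
    using 2 by (intro minimal_norm_ge[OF f]) (simp add: algebra_simps)
  then show ?thesis by simp
qed

lemma minimal_norm_scale_le:
  assumes "f \<in> minimal_space"
  shows "minimal_norm (\<lambda>z. c * f z) \<le> norm c * minimal_norm f"
proof (cases "c = 0")
  case True
  then show ?thesis
    using minimal_norm_le[OF represents_zero] by simp
next
  case False
  have "minimal_norm (\<lambda>z. c * f z) / norm c \<le> (\<Sum>k. norm (l k))" if "represents f \<alpha> l" for \<alpha> l
  proof -
    have "(\<Sum>k. norm (c * l k)) = norm c * (\<Sum>k. norm (l k))"
      using that by (simp add: norm_mult represents_def suminf_mult)
    then show ?thesis
      using minimal_norm_le[OF represents_scale[OF that, of c]] False
      by (simp add: field_simps)
  qed
  then have "minimal_norm (\<lambda>z. c * f z) / norm c \<le> minimal_norm f"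
    by (rule minimal_norm_ge[OF assms])
  then show ?thesis
    using False by (simp add: field_simps)
qed

lemma minimal_norm_scale:
  assumes "f \<in> minimal_space"
  shows "minimal_norm (\<lambda>z. c * f z) = norm c * minimal_norm f"
proof (cases "c = 0")
  case True
  then show ?thesis
    using minimal_norm_le[OF represents_zero] norm_le_minimal_norm[OF minimal_space_zero, of 0]
    by simp
next
  case False
  have "minimal_norm (\<lambda>z. inverse c * (c * f z)) \<le> norm (inverse c) * minimal_norm (\<lambda>z. c * f z)"
    by (intro minimal_norm_scale_le minimal_space_scale assms)
  then have "norm c * minimal_norm f \<le> minimal_norm (\<lambda>z. c * f z)"
    using False by (simp add: norm_divide field_simps)
  then show ?thesis
    using minimal_norm_scale_le[OF assms] by (intro antisym)
qed

typedef minimal = minimal_space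
  morphisms fun_of Minimal
  using minimal_space_zero by blast

setup_lifting type_definition_minimal

instantiation minimal :: real_normed_vector
begin

lift_definition zero_minimal :: minimal is "\<lambda>z. 0"
  by (rule minimal_space_zero)

lift_definition plus_minimal :: "minimal \<Rightarrow> minimal \<Rightarrow> minimal" is "\<lambda>f g z. f z + g z"
  by (rule minimal_space_add)

lift_definition uminus_minimal :: "minimal \<Rightarrow> minimal" is "\<lambda>f z. - f z"
  using minimal_space_scale[of _ "-1"] by simp

lift_definition minus_minimal :: "minimal \<Rightarrow> minimal \<Rightarrow> minimal" is "\<lambda>f g z. f z - g z"
  using minimal_space_add minimal_space_scale[of _ "-1"] by fastforce

lift_definition scaleR_minimal :: "real \<Rightarrow> minimal \<Rightarrow> minimal" is "\<lambda>r f z. of_real r * f z"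
  by (rule minimal_space_scale)

lift_definition norm_minimal :: "minimal \<Rightarrow> real" is minimal_norm .

definition sgn_minimal :: "minimal \<Rightarrow> minimal" where
  "sgn_minimal f = inverse (norm f) *\<^sub>R f"

definition dist_minimal :: "minimal \<Rightarrow> minimal \<Rightarrow> real" where
  "dist_minimal f g = norm (f - g)"

definition uniformity_minimal :: "(minimal \<times> minimal) filter" where
  "uniformity_minimal = (INF e\<in>{0 <..}. principal {(x, y). dist x y < e})"

definition open_minimal :: "minimal set \<Rightarrow> bool" where
  "open_minimal U = (\<forall>x\<in>U. eventually (\<lambda>(x', y). x' = x \<longrightarrow> y \<in> U) uniformity)"

instance
proof
  fix f g h :: minimal and r s :: real
  show "f + g + h = f + (g + h)" "f + g = g + f" "0 + f = f" "- f + f = 0" "f - g = f + - g"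
    by (transfer; simp add: fun_eq_iff)+
  show "r *\<^sub>R (f + g) = r *\<^sub>R f + r *\<^sub>R g" "(r + s) *\<^sub>R f = r *\<^sub>R f + s *\<^sub>R f"
    "r *\<^sub>R s *\<^sub>R f = (r * s) *\<^sub>R f" "1 *\<^sub>R f = f"
    by (transfer; simp add: fun_eq_iff algebra_simps)+
  show "dist f g = norm (f - g)"
    by (rule dist_minimal_def)
  show "sgn f = inverse (norm f) *\<^sub>R f"
    by (rule sgn_minimal_def)
  show "(uniformity :: (minimal \<times> minimal) filter) = (INF e\<in>{0 <..}. principal {(x, y). dist x y < e})"
    by (rule uniformity_minimal_def)
  show "open U = (\<forall>x\<in>U. eventually (\<lambda>(x', y). x' = x \<longrightarrow> y \<in> U) uniformity)" for U :: "minimal set"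
    by (rule open_minimal_def)
  show "norm (f + g) \<le> norm f + norm g"
    by transfer (rule minimal_norm_add)
  show "norm (r *\<^sub>R f) = \<bar>r\<bar> * norm f"
    by transfer (simp add: minimal_norm_scale)
  show "norm f = 0 \<longleftrightarrow> f = 0"
  proof
    assume "norm f = 0"
    then show "f = 0"
    proof (transfer, intro ext)
      fix f and z :: complex
      assume f: "f \<in> minimal_space" "minimal_norm f = 0"
      show "f z = 0"
        using norm_le_minimal_norm[OF f(1), of z] f
        by (cases "z \<in> unit_disc") (auto simp: minimal_space_def on_disc_eq_iff)
    qed
  next
    assume "f = 0"
    moreover have "norm (0::minimal) = 0"
      using minimal_norm_scale[OF minimal_space_zero, of 0] by transfer simp
    ultimately show "norm f = 0" by simp
  qed
qed

end

lift_definition scaleC :: "complex \<Rightarrow> minimal \<Rightarrow> minimal" is "\<lambda>c f z. c * f z"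
  by (rule minimal_space_scale)

lemma vector_space_scaleC: "vector_space scaleC"
  by unfold_locales (transfer; simp add: fun_eq_iff algebra_simps)+

lemma scaleC_of_real: "scaleC (of_real r) f = r *\<^sub>R f"
  by transfer simp

lemma norm_scaleC: "norm (scaleC c f) = norm c * norm f"
  by transfer (rule minimal_norm_scale)


section \<open>Operators\<close>

text \<open>Operators are linear over the complex numbers. The compactness condition entails
  boundedness.\<close>

definition compact_operator :: "(minimal \<Rightarrow> minimal) \<Rightarrow> bool" where
  "compact_operator K \<longleftrightarrow>
     Vector_Spaces.linear scaleC scaleC K \<and> compact (closure (K ` cball 0 1))"

text \<open>Meaningful for bounded \<open>T\<close> only, since \<^const>\<open>onorm\<close> is a real supremum.\<close>

definition essential_norm :: "(minimal \<Rightarrow> minimal) \<Rightarrow> real" where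
  "essential_norm T = Inf {onorm (\<lambda>f. T f - K f) | K. compact_operator K}"

definition blaschke_product :: "nat \<Rightarrow> (complex \<Rightarrow> complex) \<Rightarrow> bool" where
  "blaschke_product n B \<longleftrightarrow>
     (\<exists>c \<alpha>. norm c = 1 \<and> (\<forall>j\<in>{1..n}. \<alpha> j \<in> unit_disc) \<and>
        (\<forall>z\<in>unit_disc. B z = c * (\<Prod>j=1..n. phi (\<alpha> j) z)))"

text \<open>This is composition with \<open>B\<close> only if \<^term>\<open>on_disc (f \<circ> B) \<in> minimal_space\<close> whenever
  \<^term>\<open>f \<in> minimal_space\<close>; otherwise \<^const>\<open>Minimal\<close> yields an unspecified value.\<close>

definition composition_operator :: "(complex \<Rightarrow> complex) \<Rightarrow> minimal \<Rightarrow> minimal" where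
  "composition_operator B f = Minimal (on_disc (fun_of f \<circ> B))"

end

theory Submission
  imports Defs "HOL-Complex_Analysis.Complex_Analysis" "HOL-Computational_Algebra.Fundamental_Theorem_Algebra"
begin

text \<open>
  Upper bound. Since \<open>phi \<beta> \<circ> B\<close> is again a Blaschke product of degree \<open>n\<close>, it suffices to bound the
  norm of a Blaschke product \<open>B\<close> by a multiple of \<open>n\<close>. The Taylor formula of order two and Cauchy's
  formula represent \<open>B\<close> as an integral of Szego kernels with density \<open>B''\<close>, so the norm is controlled
  by the area integral of \<open>|B''|\<close>. The product rule gives
  \<open>|B''| \<le> (\<Sum>j. |phi_j''|) + S^2\<close> with \<open>S = \<Sum>j. |phi_j'|\<close>, while \<open>|B''| \<le> C / (1 - r)^2\<close> at radius \<open>r\<close>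
  because \<open>|B| \<le> 1\<close>. Integrating the smaller of \<open>S^2\<close> and \<open>C / (1 - r)^2\<close> along a radius gives a
  multiple of the sum of the \<open>n\<close> Poisson kernels at the boundary point, whose circle integral is \<open>2 pi n\<close>.

  Lower bound. Let \<open>z_1, \<dots>, z_n\<close> be the solutions of \<open>B = 1\<close> on the circle and let \<open>p_j\<close> approach \<open>z_j\<close>
  radially at speed inversely proportional to \<open>|B' z_j|\<close>. The functionals
  \<open>L f = \<Sum>j. z_j * (1 - |p_j|^2) * f' p_j\<close> have norm at most 2 eventually, tend to 0 pointwise, hence
  uniformly on compact sets, and satisfy \<open>L (phi a \<circ> B) \<rightarrow> - n\<close> for suitable \<open>a \<rightarrow> 1\<close>. Therefore no
  compact perturbation brings the norm of the composition operator below \<open>n / 2\<close>.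
\<close>

section \<open>Absolutely convergent combinations of atoms\<close>

text \<open>An integral of Szego kernels is not yet a series of atoms. It is read as the integral of
  a continuous function with values in the minimal space, so the space has to be complete and the
  kernel has to depend on its pole continuously in the norm. Pointwise continuity does not give
  this. The power series of \<open>szego w\<close> in \<open>cnj w\<close> does, once the norms of
  the monomials are known to grow slower than geometrically; this is the purpose of the averages
  over roots of unity and of the successive approximation.

  Neither bound for the second derivative suffices alone. For \<open>n\<close> zeros at the origin
  \<open>S\<close> is constantly \<open>n\<close>, so \<open>S^2\<close> integrates to the order
  \<open>n^2\<close>, while \<open>1 / (1 - r)^2\<close> is not integrable up to the circle.

  In the lower bound a single boundary point would only give a constant. An atom
  \<open>phi a\<close> is felt by at most one of the separated points at a time, whereas
  \<open>phi a \<circ> B\<close> contributes about \<open>-1\<close> at each of the \<open>n\<close>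
  points; this discrepancy is the factor \<open>n\<close>.\<close>

definition atomic :: "(complex \<Rightarrow> complex) set \<Rightarrow> real \<Rightarrow> (complex \<Rightarrow> complex) \<Rightarrow> bool" where
  "atomic A s f \<longleftrightarrow> (\<exists>u l. (\<forall>k. u k \<in> A) \<and> summable (\<lambda>k. norm (l k)) \<and> (\<Sum>k. norm (l k)) \<le> s \<and>
     (\<forall>z\<in>unit_disc. (\<lambda>k. l k * u k z) sums f z))"

definition disc_bounded :: "(complex \<Rightarrow> complex) set \<Rightarrow> bool" where
  "disc_bounded A \<longleftrightarrow> (\<forall>u\<in>A. \<forall>z\<in>unit_disc. norm (u z) \<le> 1)"

lemma atomic_nonneg: "atomic A s f \<Longrightarrow> 0 \<le> s"
  unfolding atomic_def by (auto intro: order_trans[OF suminf_nonneg])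

lemma atomic_mono: "atomic A s f \<Longrightarrow> s \<le> t \<Longrightarrow> atomic A t f"
  unfolding atomic_def by (meson order_trans)

lemma atomic_cong: "atomic A s f \<Longrightarrow> (\<And>z. z \<in> unit_disc \<Longrightarrow> f z = g z) \<Longrightarrow> atomic A s g"
  unfolding atomic_def by auto

lemma atomic_norm_le:
  assumes "disc_bounded A" "atomic A s f" "z \<in> unit_disc"
  shows "norm (f z) \<le> s"
proof -
  obtain u l where u: "\<And>k. u k \<in> A" and s: "summable (\<lambda>k. norm (l k))" "(\<Sum>k. norm (l k)) \<le> s"
    and f: "(\<lambda>k. l k * u k z) sums f z"
    using assms unfolding atomic_def by blast
  have le: "norm (l k * u k z) \<le> norm (l k)" for k
    using assms u by (auto simp: disc_bounded_def norm_mult intro: mult_left_le)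
  have s': "summable (\<lambda>k. norm (l k * u k z))"
    using le by (intro summable_comparison_test[OF _ s(1)]) auto
  have "norm (f z) \<le> (\<Sum>k. norm (l k * u k z))"
    using f summable_norm[OF s'] by (simp add: sums_iff)
  also have "\<dots> \<le> s"
    using suminf_le[OF le s' s(1)] s(2) by linarith
  finally show ?thesis .
qed

lemma atomic_scale:
  assumes "atomic A s f"
  shows "atomic A (norm c * s) (\<lambda>z. c * f z)"
proof -
  obtain u l where u: "\<And>k. u k \<in> A" and s: "summable (\<lambda>k. norm (l k))" "(\<Sum>k. norm (l k)) \<le> s"
    and f: "\<And>z. z \<in> unit_disc \<Longrightarrow> (\<lambda>k. l k * u k z) sums f z"
    using assms unfolding atomic_def by blast
  show ?thesis
    unfolding atomic_def
  proof (intro exI conjI ballI allI)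
    show "u k \<in> A" for k by fact
    show "summable (\<lambda>k. norm (c * l k))"
      using s(1) by (simp add: norm_mult)
    show "(\<Sum>k. norm (c * l k)) \<le> norm c * s"
      using s by (simp add: norm_mult suminf_mult mult_left_mono)
    show "(\<lambda>k. c * l k * u k z) sums (c * f z)" if "z \<in> unit_disc" for z
      unfolding mult.assoc by (intro sums_mult f that)
  qed
qed

lemma atomic_atom:
  assumes "u \<in> A"
  shows "atomic A 1 u"
  unfolding atomic_def
proof (intro exI conjI ballI allI)
  let ?l = "\<lambda>k. if k = 0 then 1 else 0 :: complex"
  have *: "(\<lambda>k. norm (?l k)) sums 1"
    using sums_single[of 0 "\<lambda>_. 1::real"] by (rule back_subst[of "\<lambda>h. h sums 1"]) auto
  then show "summable (\<lambda>k. norm (?l k))" "(\<Sum>k. norm (?l k)) \<le> 1"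
    by (auto simp: sums_iff)
  show "(\<lambda>k. ?l k * u z) sums u z" for z
    using sums_single[of 0 "\<lambda>_. u z"] by (rule back_subst[of "\<lambda>h. h sums u z"]) auto
qed (use assms in auto)

text \<open>The double series of coefficients converges absolutely, so \<open>prod_decode\<close>
  enumerates it as a single series, and the bound 1 on the atoms carries this over to the values at
  every point. The lemma is also what makes the minimal space complete.\<close>

lemma atomic_sums:
  assumes bd: "disc_bounded A" and f: "\<And>i. atomic A (s i) (f i)" and s: "summable s"
    and F: "\<And>z. z \<in> unit_disc \<Longrightarrow> (\<lambda>i. f i z) sums F z"
  shows "atomic A (suminf s) F"
proof -
  have "\<forall>i. \<exists>u l. (\<forall>k. u k \<in> A) \<and> summable (\<lambda>k. norm (l k)) \<and> (\<Sum>k. norm (l k)) \<le> s i \<and>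
     (\<forall>z\<in>unit_disc. (\<lambda>k. l k * u k z) sums f i z)"
    using f unfolding atomic_def by blast
  then obtain u l where u: "\<And>i k. u i k \<in> A" and l: "\<And>i. summable (\<lambda>k. norm (l i k))"
    and ls: "\<And>i. (\<Sum>k. norm (l i k)) \<le> s i"
    and uf: "\<And>i z. z \<in> unit_disc \<Longrightarrow> (\<lambda>k. l i k * u i k z) sums f i z"
    by metis
  define S where "S i = (\<Sum>k. norm (l i k))" for i
  have S0: "0 \<le> S i" for i
    unfolding S_def by (intro suminf_nonneg l) auto
  have Ssum: "summable S"
    by (rule summable_comparison_test[OF _ s]) (use S0 ls in \<open>auto simp: S_def\<close>)
  have inner: "((\<lambda>k. norm (l i k)) has_sum S i) UNIV" for i
    unfolding S_def by (intro sums_nonneg_imp_has_sum summable_sums l) auto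
  have outer: "(S has_sum suminf S) UNIV"
    by (intro sums_nonneg_imp_has_sum summable_sums Ssum S0)
  have so: "(\<lambda>(i, k). norm (l i k)) summable_on (UNIV \<times> UNIV)"
    by (rule summable_on_SigmaI[where g = S]) (use inner outer in \<open>auto simp: summable_on_def\<close>)
  have hs: "((\<lambda>(i, k). norm (l i k)) has_sum suminf S) (UNIV \<times> UNIV)"
    by (rule has_sum_SigmaI[where g = S]) (use inner outer so in auto)
  have bij: "bij_betw prod_decode UNIV (UNIV \<times> UNIV)"
    using bij_prod_decode by simp
  define U where "U n = (case prod_decode n of (i, k) \<Rightarrow> u i k)" for n
  define L where "L n = (case prod_decode n of (i, k) \<Rightarrow> l i k)" for n
  have "((\<lambda>n. (\<lambda>(i, k). norm (l i k)) (prod_decode n)) has_sum suminf S) UNIV"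
    using hs by (subst has_sum_reindex_bij_betw[OF bij])
  then have "(\<lambda>n. (\<lambda>(i, k). norm (l i k)) (prod_decode n)) sums suminf S"
    by (rule has_sum_imp_sums)
  then have L: "(\<lambda>n. norm (L n)) sums suminf S"
    by (simp add: L_def case_prod_beta)
  have "suminf S \<le> suminf s"
    by (intro suminf_le Ssum s) (use ls in \<open>auto simp: S_def\<close>)
  moreover have "(\<lambda>n. L n * U n z) sums F z" if z: "z \<in> unit_disc" for z
  proof -
    have le: "norm (l i k * u i k z) \<le> norm (l i k)" for i k
      using bd u z by (auto simp: disc_bounded_def norm_mult intro: mult_left_le)
    have 1: "((\<lambda>k. l i k * u i k z) has_sum f i z) UNIV" for i
      using le by (intro norm_summable_imp_has_sum uf z summable_comparison_test[OF _ l[of i]]) auto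
    have 2: "((\<lambda>i. f i z) has_sum F z) UNIV"
      using atomic_norm_le[OF bd f z]
      by (intro norm_summable_imp_has_sum F z summable_comparison_test[OF _ s]) auto
    have "(\<lambda>p. norm (case p of (i, k) \<Rightarrow> l i k * u i k z)) summable_on (UNIV \<times> UNIV)"
      by (rule summable_on_comparison_test[OF so]) (use le in auto)
    then have "(\<lambda>(i, k). l i k * u i k z) summable_on (UNIV \<times> UNIV)"
      by (rule abs_summable_summable)
    then have "((\<lambda>(i, k). l i k * u i k z) has_sum F z) (UNIV \<times> UNIV)"
      by (intro has_sum_SigmaI[where g = "\<lambda>i. f i z"]) (use 1 2 in auto)
    then have "((\<lambda>n. (\<lambda>(i, k). l i k * u i k z) (prod_decode n)) has_sum F z) UNIV"
      by (subst has_sum_reindex_bij_betw[OF bij])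
    then have "(\<lambda>n. (\<lambda>(i, k). l i k * u i k z) (prod_decode n)) sums F z"
      by (rule has_sum_imp_sums)
    then show ?thesis
      by (simp add: L_def U_def case_prod_beta)
  qed
  moreover have "U n \<in> A" for n
    by (auto simp: U_def u split: prod.split)
  ultimately show ?thesis
    unfolding atomic_def using L by (auto simp: sums_iff intro!: exI[of _ U] exI[of _ L])
qed

lemma atomic_add:
  assumes bd: "disc_bounded A" and f: "atomic A s f" "atomic A t g"
  shows "atomic A (s + t) (\<lambda>z. f z + g z)"
proof -
  \<comment> \<open>The tail is written \<open>0 * f z\<close> so that \<open>atomic_scale\<close>
    gives it the bound 0.\<close>
  define h where "h i = (if i = 0 then f else if i = 1 then g else (\<lambda>z. 0 * f z))" for i :: nat
  define r where "r i = (if i = 0 then s else if i = 1 then t else 0)" for i :: nat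
  have a: "atomic A (r i) (h i)" for i
    using f atomic_scale[OF f(1), of 0] by (auto simp: h_def r_def)
  have sm: "r sums (s + t)"
    using sums_finite[of "{0,1}" r] by (auto simp: r_def)
  have "(\<lambda>i. h i z) sums (f z + g z)" for z
    using sums_finite[of "{0,1}" "\<lambda>i. h i z"] by (auto simp: h_def)
  from atomic_sums[OF bd a sums_summable[OF sm] this] show ?thesis
    using sm by (simp add: sums_iff)
qed

lemma atomic_sum:
  assumes bd: "disc_bounded A" and "finite I" "I \<noteq> {}" and f: "\<And>i. i \<in> I \<Longrightarrow> atomic A (s i) (f i)"
  shows "atomic A (\<Sum>i\<in>I. s i) (\<lambda>z. \<Sum>i\<in>I. f i z)"
  using assms(2,3,4)
proof (induction rule: finite_ne_induct)
  case (insert i I)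
  then show ?case using atomic_add[OF bd, of "s i" "f i"] by simp
qed simp

lemma atomic_trans:
  assumes bd: "disc_bounded A" and f: "atomic B s f"
    and BA: "\<And>u. u \<in> B \<Longrightarrow> atomic A K u"
  shows "atomic A (K * s) f"
proof -
  obtain u l where u: "\<And>k. u k \<in> B" and s: "summable (\<lambda>k. norm (l k))" "(\<Sum>k. norm (l k)) \<le> s"
    and f: "\<And>z. z \<in> unit_disc \<Longrightarrow> (\<lambda>k. l k * u k z) sums f z"
    using f unfolding atomic_def by blast
  have K: "K \<ge> 0" using BA[OF u] by (rule atomic_nonneg)
  have "atomic A (\<Sum>k. norm (l k) * K) f"
    by (rule atomic_sums[OF bd atomic_scale[OF BA[OF u]] summable_mult2[OF s(1)] f])
  moreover have "(\<Sum>k. norm (l k) * K) \<le> K * s"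
    using mult_left_mono[OF s(2) K] by (simp add: suminf_mult[OF s(1)] mult.commute[of _ K])
  ultimately show ?thesis by (rule atomic_mono)
qed

text \<open>Successive approximation, as in the proof of the open mapping theorem.\<close>
lemma atomic_approx:
  assumes A: "disc_bounded A" and B: "disc_bounded B"
    and split: "\<And>u. u \<in> B \<Longrightarrow> \<exists>v w. atomic A K v \<and> atomic B (1/2) w \<and> (\<forall>z\<in>unit_disc. u z = v z + w z)"
    and f: "atomic B s f"
  shows "atomic A (2 * K * s) f"
proof -
  have step: "\<exists>g h. atomic A (K * t) g \<and> atomic B (t / 2) h \<and> (\<forall>z\<in>unit_disc. f z = g z + h z)"
    if f: "atomic B t f" for f t
  proof -
    obtain u l where u: "\<And>k. u k \<in> B" and s: "summable (\<lambda>k. norm (l k))" "(\<Sum>k. norm (l k)) \<le> t"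
      and f: "\<And>z. z \<in> unit_disc \<Longrightarrow> (\<lambda>k. l k * u k z) sums f z"
      using f unfolding atomic_def by blast
    have "\<forall>k. \<exists>v w. atomic A K v \<and> atomic B (1/2) w \<and> (\<forall>z\<in>unit_disc. u k z = v z + w z)"
      using split u by blast
    then obtain v w where v: "\<And>k. atomic A K (v k)" and w: "\<And>k. atomic B (1/2) (w k)"
      and uvw: "\<And>k z. z \<in> unit_disc \<Longrightarrow> u k z = v k z + w k z"
      by metis
    have K: "K \<ge> 0" using v by (rule atomic_nonneg)
    have sv: "summable (\<lambda>k. l k * v k z)" if "z \<in> unit_disc" for z
      by (rule summable_comparison_test[OF _ summable_mult2[OF s(1), of K]])
         (use atomic_norm_le[OF A v that] in \<open>auto simp: norm_mult intro!: mult_left_mono\<close>)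
    have sw: "summable (\<lambda>k. l k * w k z)" if "z \<in> unit_disc" for z
      by (rule summable_comparison_test[OF _ summable_mult2[OF s(1), of "1/2"]])
         (use atomic_norm_le[OF B w that] in \<open>auto simp: norm_mult intro!: mult_left_mono exI[of _ 0]
            simp del: times_divide_eq_right\<close>)
    have "atomic A (\<Sum>k. norm (l k) * K) (\<lambda>z. \<Sum>k. l k * v k z)"
      by (rule atomic_sums[OF A atomic_scale[OF v] summable_mult2[OF s(1)] summable_sums[OF sv]])
    moreover have "(\<Sum>k. norm (l k) * K) \<le> K * t"
      using mult_left_mono[OF s(2) K] by (simp add: suminf_mult[OF s(1)] mult.commute[of _ K])
    moreover have "atomic B (\<Sum>k. norm (l k) * (1/2)) (\<lambda>z. \<Sum>k. l k * w k z)"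
      by (rule atomic_sums[OF B atomic_scale[OF w] summable_mult2[OF s(1)] summable_sums[OF sw]])
    moreover have "(\<Sum>k. norm (l k) * (1/2)) \<le> t / 2"
      using suminf_mult2[OF s(1), of "1/2"] s(2) by simp
    moreover have "f z = (\<Sum>k. l k * v k z) + (\<Sum>k. l k * w k z)" if z: "z \<in> unit_disc" for z
      using f[OF z] suminf_add[OF sv[OF z] sw[OF z]] by (simp add: uvw[OF z] distrib_left sums_iff)
    ultimately show ?thesis
      by (intro exI conjI) (erule atomic_mono | blast)+
  qed
  \<comment> \<open>\<open>dependent_nat_choice\<close> returns some element satisfying
    \<open>P 0\<close>; the clause for \<open>n = 0\<close> forces it to be \<open>f\<close>
    itself.\<close>
  define P where "P n h \<longleftrightarrow> atomic B (s / 2 ^ n) h \<and> (n = 0 \<longrightarrow> h = f)" for n :: nat and h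
  define Q where "Q n h h' \<longleftrightarrow> atomic A (K * (s / 2 ^ n)) (\<lambda>z. h z - h' z)" for n :: nat and h h'
  have "\<exists>h'. P (Suc n) h' \<and> Q n h h'" if "P n h" for n h
  proof -
    have "atomic B (s / 2 ^ n) h"
      using that by (simp add: P_def)
    from step[OF this] obtain g h' where g: "atomic A (K * (s / 2 ^ n)) g" "atomic B (s / 2 ^ n / 2) h'"
      "\<And>z. z \<in> unit_disc \<Longrightarrow> h z = g z + h' z"
      by blast
    have "atomic A (K * (s / 2 ^ n)) (\<lambda>z. h z - h' z)"
      by (rule atomic_cong[OF g(1)]) (simp add: g(3))
    moreover have "s / 2 ^ n / 2 = s / 2 ^ Suc n"
      by simp
    ultimately show ?thesis
      using g(2) unfolding P_def Q_def by (intro exI[of _ h']) (simp add: mult.commute)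
  qed
  moreover have "P 0 f"
    using f by (simp add: P_def)
  ultimately obtain p where p: "\<And>n. P n (p n)" "\<And>n. Q n (p n) (p (Suc n))"
    using dependent_nat_choice[of P Q] by blast
  have p0: "p 0 = f" and pB: "\<And>n. atomic B (s / 2 ^ n) (p n)"
    and pA: "\<And>n. atomic A (K * (s / 2 ^ n)) (\<lambda>z. p n z - p (Suc n) z)"
    using p by (simp_all add: P_def Q_def)
  have geo: "(\<lambda>n. K * (s / 2 ^ n)) sums (K * (s * 2))"
    using sums_mult[OF sums_mult[OF geometric_sums[of "1/2::real"]], of K s] by (simp add: power_divide)
  have lim: "(\<lambda>n. s / 2 ^ n) \<longlonglongrightarrow> 0"
    by real_asymp
  have "(\<lambda>n. p n z - p (Suc n) z) sums f z" if z: "z \<in> unit_disc" for z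
  proof -
    have "(\<lambda>n. p n z) \<longlonglongrightarrow> 0"
      by (rule Lim_null_comparison[OF _ lim]) (use atomic_norm_le[OF B pB z] in auto)
    from telescope_sums'[OF this] show ?thesis
      by (simp add: p0)
  qed
  from atomic_sums[OF A pA sums_summable[OF geo] this] show ?thesis
    using geo by (simp add: sums_iff mult_ac)
qed

section \<open>The minimal space as a Banach space\<close>

definition phi_atoms :: "(complex \<Rightarrow> complex) set" where
  "phi_atoms = phi ` cball 0 1"

lemma phi_in_phi_atoms: "norm \<alpha> \<le> 1 \<Longrightarrow> phi \<alpha> \<in> phi_atoms"
  by (simp add: phi_atoms_def)

lemma disc_bounded_phi_atoms: "disc_bounded phi_atoms"
  using norm_phi_le_1 by (auto simp: disc_bounded_def phi_atoms_def)

lemma atomic_phi_atoms_iff: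
  "atomic phi_atoms s f \<longleftrightarrow> (\<exists>\<alpha> l. represents f \<alpha> l \<and> (\<Sum>k. norm (l k)) \<le> s)"
proof
  assume "atomic phi_atoms s f"
  then obtain u l where u: "\<And>k. u k \<in> phi_atoms" and l: "summable (\<lambda>k. norm (l k))" "(\<Sum>k. norm (l k)) \<le> s"
    and f: "\<And>z. z \<in> unit_disc \<Longrightarrow> (\<lambda>k. l k * u k z) sums f z"
    unfolding atomic_def by blast
  have "\<forall>k. \<exists>a. a \<in> cball 0 1 \<and> u k = phi a"
    using u unfolding phi_atoms_def by blast
  then obtain \<alpha> where "\<And>k. \<alpha> k \<in> cball 0 1" "\<And>k. u k = phi (\<alpha> k)"
    by metis
  then show "\<exists>\<alpha> l. represents f \<alpha> l \<and> (\<Sum>k. norm (l k)) \<le> s"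
    using l f unfolding represents_def by (intro exI[of _ \<alpha>] exI[of _ l]) auto
next
  assume "\<exists>\<alpha> l. represents f \<alpha> l \<and> (\<Sum>k. norm (l k)) \<le> s"
  then obtain \<alpha> l where "represents f \<alpha> l" "(\<Sum>k. norm (l k)) \<le> s"
    by blast
  then show "atomic phi_atoms s f"
    unfolding atomic_def represents_def phi_atoms_def
    by (intro exI[of _ "\<lambda>k. phi (\<alpha> k)"] exI[of _ l]) auto
qed

section \<open>Analyticity of combinations of atoms\<close>

lemma one_minus_cnj_mult_nz:
  assumes "norm a \<le> 1" "norm z < 1"
  shows "1 - cnj a * z \<noteq> 0"
proof
  assume "1 - cnj a * z = 0"
  then have "norm (cnj a * z) = 1"
    by simp
  moreover have "norm a * norm z \<le> 1 * norm z"
    using assms by (intro mult_right_mono) auto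
  ultimately show False
    using assms by (simp add: norm_mult)
qed

lemma holomorphic_phi: "norm a \<le> 1 \<Longrightarrow> phi a holomorphic_on unit_disc"
  unfolding phi_def by (intro holomorphic_intros) (use one_minus_cnj_mult_nz in auto)

lemma atomic_uniform_limit:
  assumes bd: "disc_bounded A" and u: "\<And>k. u k \<in> A" and l: "summable (\<lambda>k. norm (l k))"
    and f: "\<And>z. z \<in> unit_disc \<Longrightarrow> (\<lambda>k. l k * u k z) sums f z"
  shows "uniform_limit unit_disc (\<lambda>n z. \<Sum>k<n. l k * u k z) f sequentially"
proof -
  have "uniform_limit unit_disc (\<lambda>n z. \<Sum>k<n. l k * u k z) (\<lambda>z. \<Sum>k. l k * u k z) sequentially"
    using bd u by (intro Weierstrass_m_test[OF _ l]) (auto simp: disc_bounded_def norm_mult intro!: mult_left_le)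
  then show ?thesis
    by (rule uniform_limit_cong'[THEN iffD1, rotated -1]) (use f in \<open>auto simp: sums_iff\<close>)
qed

lemma atomic_holomorphic:
  assumes bd: "disc_bounded A" and hol: "\<And>u. u \<in> A \<Longrightarrow> u holomorphic_on unit_disc" and f: "atomic A s f"
  shows "f holomorphic_on unit_disc"
proof -
  obtain u l where u: "\<And>k. u k \<in> A" and l: "summable (\<lambda>k. norm (l k))"
    and f: "\<And>z. z \<in> unit_disc \<Longrightarrow> (\<lambda>k. l k * u k z) sums f z"
    using f unfolding atomic_def by blast
  have ul: "uniform_limit unit_disc (\<lambda>n z. \<Sum>k<n. l k * u k z) f sequentially"
    by (rule atomic_uniform_limit[OF bd u l f])
  show ?thesis
  proof (rule holomorphic_uniform_sequence[where f = "\<lambda>n z. \<Sum>k<n. l k * u k z"])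
    show "(\<lambda>z. \<Sum>k<n. l k * u k z) holomorphic_on unit_disc" for n
      by (intro holomorphic_intros hol u)
    fix z :: complex assume "z \<in> unit_disc"
    then obtain d where "d > 0" "cball z d \<subseteq> unit_disc"
      using open_contains_cball[of unit_disc] open_ball by blast
    then show "\<exists>d>0. cball z d \<subseteq> unit_disc \<and> uniform_limit (cball z d) (\<lambda>n z. \<Sum>k<n. l k * u k z) f sequentially"
      using uniform_limit_on_subset[OF ul] by blast
  qed auto
qed

section \<open>Functions on the disc as elements of the minimal space\<close>

definition minimal_of :: "(complex \<Rightarrow> complex) \<Rightarrow> minimal" where
  "minimal_of f = Minimal (on_disc f)"

lemma represents_on_disc [simp]: "represents (on_disc f) \<alpha> l \<longleftrightarrow> represents f \<alpha> l"
  by (simp add: represents_def on_disc_def)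

lemma atomic_on_disc:
  assumes "atomic phi_atoms s f"
  shows "on_disc f \<in> minimal_space" "minimal_norm (on_disc f) \<le> s"
proof -
  obtain \<alpha> l where r: "represents f \<alpha> l" "(\<Sum>k. norm (l k)) \<le> s"
    using assms atomic_phi_atoms_iff by blast
  have "f holomorphic_on unit_disc"
    by (rule atomic_holomorphic[OF disc_bounded_phi_atoms _ assms])
       (auto simp: phi_atoms_def intro: holomorphic_phi)
  then have "on_disc f holomorphic_on unit_disc"
    by (rule holomorphic_transform) (simp add: on_disc_def)
  then show "on_disc f \<in> minimal_space"
    using represents_on_disc[THEN iffD2, OF r(1)] analytic_on_open[OF open_ball, of "on_disc f"]
    unfolding minimal_space_def on_disc_eq_iff by (blast intro: on_disc_def[THEN trans] if_not_P)
  show "minimal_norm (on_disc f) \<le> s"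
    using minimal_norm_le[of "on_disc f" \<alpha> l] r by simp
qed

lemma fun_of_minimal_of:
  assumes "atomic phi_atoms s f"
  shows "fun_of (minimal_of f) = on_disc f"
  unfolding minimal_of_def using atomic_on_disc[OF assms] by (simp add: Minimal_inverse)

lemma norm_minimal_of:
  assumes "atomic phi_atoms s f"
  shows "norm (minimal_of f) \<le> s"
  using atomic_on_disc[OF assms] fun_of_minimal_of[OF assms] by (simp add: norm_minimal.rep_eq)

text \<open>The norm is an infimum, and a representation whose total weight equals it is not
  guaranteed; hence the strict inequality.\<close>

lemma minimal_space_atomic:
  assumes "f \<in> minimal_space" "minimal_norm f < s"
  shows "atomic phi_atoms s f"
proof (rule ccontr)
  assume "\<not> atomic phi_atoms s f"
  then have "s \<le> minimal_norm f"
    using assms(1) by (intro minimal_norm_ge) (auto simp: atomic_phi_atoms_iff not_le intro: less_imp_le)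
  then show False using assms by simp
qed

lemma atomic_fun_of: "norm F < s \<Longrightarrow> atomic phi_atoms s (fun_of F)"
  using minimal_space_atomic fun_of by (simp add: norm_minimal.rep_eq)

lemma minimal_of_fun_of [simp]: "minimal_of (fun_of F) = F"
proof -
  have "on_disc (fun_of F) = fun_of F"
    using fun_of[of F] by (simp add: minimal_space_def)
  then show ?thesis
    by (simp add: minimal_of_def fun_of_inverse)
qed

lemma minimal_eqI:
  assumes "\<And>z. z \<in> unit_disc \<Longrightarrow> fun_of F z = fun_of G z"
  shows "F = G"
proof -
  have "on_disc (fun_of F) = on_disc (fun_of G)"
    using assms by (simp add: on_disc_def fun_eq_iff)
  then show ?thesis
    by (metis minimal_of_def minimal_of_fun_of)
qed

lemma norm_fun_of_le: "norm (fun_of F z) \<le> norm F"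
proof (cases "z \<in> unit_disc")
  case True
  then show ?thesis
    using norm_le_minimal_norm[OF fun_of] by (simp add: norm_minimal.rep_eq)
next
  case False
  then have "fun_of F z = 0"
    using fun_of[of F] by (simp add: minimal_space_def on_disc_eq_iff)
  then show ?thesis by simp
qed

lemma bounded_linear_fun_of: "bounded_linear (\<lambda>F. fun_of F z)"
proof (rule bounded_linear_intro[where K = 1])
  show "fun_of (r *\<^sub>R F) z = r *\<^sub>R fun_of F z" for r F
    by (simp add: scaleR_minimal.rep_eq scaleR_conv_of_real)
qed (simp_all add: plus_minimal.rep_eq norm_fun_of_le)

lemma fun_of_diff: "fun_of (F - G) z = fun_of F z - fun_of G z"
  by (simp add: minus_minimal.rep_eq)

text \<open>A subsequence with geometrically decreasing steps converges at every point because
  evaluations have norm at most 1. By \<open>atomic_sums\<close> every tail of its telescoping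
  series is a combination of atoms of small weight, so the pointwise limit belongs to the space and
  is the limit in norm.\<close>

instance minimal :: banach
proof
  fix X :: "nat \<Rightarrow> minimal"
  assume X: "Cauchy X"
  have "\<forall>k. \<exists>N. \<forall>m\<ge>N. \<forall>n\<ge>N. dist (X m) (X n) < (1/2) ^ k"
    using X by (auto simp: Cauchy_def)
  then obtain N where N: "\<And>k m n. m \<ge> N k \<Longrightarrow> n \<ge> N k \<Longrightarrow> dist (X m) (X n) < (1/2) ^ k"
    by metis
  \<comment> \<open>Summing makes the indices monotone while keeping them at least
    \<open>N k\<close>.\<close>
  define M where "M k = (\<Sum>i\<le>k. N i)" for k
  define Y where "Y k = X (M k)" for k
  have M: "N k \<le> M k" "M k \<le> M (Suc k)" for k
    by (auto simp: M_def intro: member_le_sum)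
  have Y: "norm (Y (Suc k) - Y k) < (1/2) ^ k" for k
    unfolding Y_def dist_norm[symmetric] using M[of k] by (intro N) auto
  define L where "L z = lim (\<lambda>k. fun_of (Y k) z)" for z
  have L: "(\<lambda>k. fun_of (Y k) z) \<longlonglongrightarrow> L z" for z
  proof -
    have "summable (\<lambda>k. fun_of (Y (Suc k)) z - fun_of (Y k) z)"
      by (rule summable_comparison_test'[of "\<lambda>k. (1/2)^k" 0])
         (use order_trans[OF norm_fun_of_le less_imp_le[OF Y]] in \<open>auto simp flip: fun_of_diff\<close>)
    then obtain c where "(\<lambda>n. \<Sum>k<n. fun_of (Y (Suc k)) z - fun_of (Y k) z) \<longlonglongrightarrow> c"
      by (auto simp: summable_def sums_def)
    then have "(\<lambda>n. fun_of (Y n) z - fun_of (Y 0) z) \<longlonglongrightarrow> c"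
      using sum_lessThan_telescope[of "\<lambda>k. fun_of (Y k) z"] by simp
    from tendsto_add[OF this tendsto_const[of "fun_of (Y 0) z"]]
    have "convergent (\<lambda>n. fun_of (Y n) z)"
      by (auto simp: convergent_def)
    then show ?thesis
      by (simp add: L_def convergent_LIMSEQ_iff)
  qed
  have tail: "atomic phi_atoms ((1/2)^m * 2) (\<lambda>z. L z - fun_of (Y m) z)" for m
  proof -
    have a: "atomic phi_atoms ((1/2)^(m + k)) (fun_of (Y (Suc (m + k)) - Y (m + k)))" for k
      by (intro atomic_fun_of Y)
    have g: "(\<lambda>k. (1/2)^(m + k)) sums ((1/2)^m * 2 :: real)"
      using sums_mult[OF geometric_sums[of "1/2::real"], of "(1/2)^m"] by (simp add: power_add)
    have "(\<lambda>k. fun_of (Y (Suc (m + k)) - Y (m + k)) z) sums (L z - fun_of (Y m) z)" for z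
      using telescope_sums[OF LIMSEQ_ignore_initial_segment[OF L, of m z]]
      by (simp add: fun_of_diff add.commute)
    from atomic_sums[OF disc_bounded_phi_atoms a sums_summable[OF g] this]
    show ?thesis
      using g by (simp add: sums_iff)
  qed
  have "atomic phi_atoms (2 + (norm (Y 0) + 1)) (\<lambda>z. (L z - fun_of (Y 0) z) + fun_of (Y 0) z)"
    by (rule atomic_add[OF disc_bounded_phi_atoms]) (use tail[of 0] in \<open>auto intro: atomic_fun_of\<close>)
  then have aL: "atomic phi_atoms (2 + (norm (Y 0) + 1)) L"
    by simp
  have YL: "norm (minimal_of L - Y m) \<le> (1/2)^m * 2" for m
  proof -
    have "minimal_of L - Y m = minimal_of (\<lambda>z. L z - fun_of (Y m) z)"
      by (rule minimal_eqI)
         (simp add: fun_of_diff fun_of_minimal_of[OF aL] fun_of_minimal_of[OF tail] on_disc_def)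
    then show ?thesis
      using norm_minimal_of[OF tail] by simp
  qed
  have "X \<longlonglongrightarrow> minimal_of L"
    unfolding lim_sequentially
  proof (intro allI impI)
    fix e :: real assume "e > 0"
    then obtain m where m: "(1/2)^m < e / 3"
      using real_arch_pow_inv[of "e/3" "1/2"] by auto
    have "dist (X n) (minimal_of L) < e" if "n \<ge> N m" for n
    proof -
      have "dist (X n) (minimal_of L) \<le> dist (X n) (Y m) + dist (minimal_of L) (Y m)"
        by (metis dist_commute dist_triangle)
      also have "\<dots> < (1/2)^m + (1/2)^m * 2"
        using N[OF that M(1)] YL[of m] by (simp add: Y_def dist_norm)
      also have "\<dots> < e"
        using m by simp
      finally show ?thesis .
    qed
    then show "\<exists>no. \<forall>n\<ge>no. dist (X n) (minimal_of L) < e"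
      by blast
  qed
  then show "convergent X"
    by (auto simp: convergent_def)
qed

lemma bounded_bilinear_scaleC: "bounded_bilinear scaleC"
proof (rule bounded_bilinear.intro)
  show "scaleC (a + b) F = scaleC a F + scaleC b F" for a b F
    by transfer (simp add: algebra_simps)
  show "scaleC a (F + G) = scaleC a F + scaleC a G" for a F G
    by transfer (simp add: algebra_simps)
  show "scaleC (r *\<^sub>R a) F = r *\<^sub>R scaleC a F" "scaleC a (r *\<^sub>R F) = r *\<^sub>R scaleC a F" for r a F
    by (transfer, simp add: scaleR_conv_of_real mult_ac)+
  show "\<exists>K. \<forall>a F. norm (scaleC a F) \<le> norm a * norm F * K"
    by (rule exI[of _ 1]) (simp add: norm_scaleC)
qed

lemmas continuous_on_scaleC = bounded_bilinear.continuous_on[OF bounded_bilinear_scaleC]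

section \<open>Szego kernels and monomials\<close>

definition szego :: "complex \<Rightarrow> complex \<Rightarrow> complex" where
  "szego w z = 1 / (1 - cnj w * z)"

lemma atomic_const: "atomic phi_atoms (norm c) (\<lambda>_. c)"
proof -
  have "phi 1 z = 1" if "z \<in> unit_disc" for z
    using one_minus_cnj_mult_nz[of 1 z] that by (simp add: phi_def)
  moreover have "atomic phi_atoms (norm c * 1) (\<lambda>z. c * phi 1 z)"
    by (intro atomic_scale atomic_atom phi_in_phi_atoms) simp
  ultimately show ?thesis
    by (auto elim!: atomic_cong)
qed

text \<open>Solving the definition of \<open>phi w\<close> for the kernel gives
  \<open>szego w = (1 - cnj w * phi w) / (1 - |w|^2)\<close>. The constant 1 is an atom too, so the
  weights add up to \<open>(1 + |w|) / (1 - |w|^2) = 1 / (1 - |w|)\<close>.\<close>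

lemma atomic_szego:
  assumes "norm w < 1"
  shows "atomic phi_atoms (1 / (1 - norm w)) (szego w)"
proof -
  have p: "1 - (norm w)\<^sup>2 > 0"
    using assms by (simp add: abs_square_less_1)
  have "norm (complex_of_real (1 / (1 - (norm w)\<^sup>2))) * (norm (1::complex) + norm (- cnj w) * 1) = 1 / (1 - norm w)"
    unfolding norm_of_real using p assms by (simp add: field_simps power2_eq_square)
  moreover have "atomic phi_atoms (norm (complex_of_real (1 / (1 - (norm w)\<^sup>2))) * (norm (1::complex) + norm (- cnj w) * 1))
    (\<lambda>z. complex_of_real (1 / (1 - (norm w)\<^sup>2)) * (1 + - cnj w * phi w z))"
    by (intro atomic_scale atomic_add disc_bounded_phi_atoms atomic_const atomic_atom phi_in_phi_atoms)
       (use assms in auto)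
  moreover have "complex_of_real (1 / (1 - (norm w)\<^sup>2)) * (1 + - cnj w * phi w z) = szego w z"
    if "z \<in> unit_disc" for z
  proof -
    have "1 - cnj w * z \<noteq> 0"
      using assms that by (intro one_minus_cnj_mult_nz) auto
    moreover have "1 - complex_of_real (norm w) ^ 2 \<noteq> 0"
      using p by (metis less_irrefl of_real_1 of_real_diff of_real_eq_0_iff of_real_power)
    moreover have "cnj w * w = complex_of_real (norm w) ^ 2"
      using complex_norm_square[of w] by (simp add: mult.commute)
    ultimately show ?thesis
      by (simp add: szego_def phi_def field_simps)
  qed
  ultimately show ?thesis
    using atomic_cong[of phi_atoms _ _ "szego w"] by metis
qed

section \<open>Norms of monomials through averages of kernels\<close>

lemma szego_sums:
  assumes "norm w < 1" "norm z < 1"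
  shows "(\<lambda>m. cnj w ^ m * z ^ m) sums szego w z"
proof -
  have "norm w * norm z < 1"
    using mult_strict_mono'[of "norm w" 1 "norm z" 1] assms by simp
  then show ?thesis
    unfolding szego_def power_mult_distrib[symmetric] by (intro geometric_sums) (simp add: norm_mult)
qed

text \<open>Orthogonality of the characters of a cyclic group: the sum is geometric with ratio
  \<open>\<omega> ^ k * cnj \<omega> ^ m\<close>, a root of unity of order dividing \<open>N\<close>
  that equals 1 exactly when the two exponents agree modulo \<open>N\<close>.\<close>

lemma sum_root_of_unity_powers:
  fixes k m N :: nat
  assumes "N > 0"
  defines "\<omega> \<equiv> exp (2 * of_real pi * \<i> / of_nat N)"
  shows "(\<Sum>j<N. \<omega> ^ (j * k) * cnj (\<omega> ^ j) ^ m) = (if m mod N = k mod N then of_nat N else 0)"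
proof -
  define x where "x = \<omega> ^ k * cnj \<omega> ^ m"
  have om: "\<omega> ^ j = exp (2 * of_real pi * \<i> * of_nat j / of_nat N)" for j
    unfolding \<omega>_def exp_of_nat_mult[symmetric] by (simp add: field_simps)
  have [simp]: "norm \<omega> = 1"
    by (simp add: \<omega>_def norm_exp)
  have [simp]: "\<omega> \<noteq> 0"
    by (simp add: \<omega>_def)
  have "\<omega> * cnj \<omega> = 1"
    using complex_norm_square[of \<omega>] by simp
  then have inv: "cnj \<omega> = 1 / \<omega>"
    by (simp add: field_simps)
  have "\<omega> ^ N = 1"
    unfolding om using assms(1) by simp
  then have xN: "x ^ N = 1"
    unfolding x_def inv by (simp add: power_mult_distrib power_divide flip: power_mult) (simp add: mult.commute[of _ N] power_mult)
  have "x = 1 \<longleftrightarrow> \<omega> ^ k = \<omega> ^ m"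
    by (simp add: x_def inv field_simps)
  also have "\<dots> \<longleftrightarrow> k mod N = m mod N"
    unfolding om using complex_root_unity_eq[of N k m] assms by (simp add: cong_def)
  finally have x1: "x = 1 \<longleftrightarrow> k mod N = m mod N" .
  have "(\<Sum>j<N. \<omega> ^ (j * k) * cnj (\<omega> ^ j) ^ m) = (\<Sum>j<N. x ^ j)"
    by (simp add: x_def power_mult_distrib mult.commute flip: power_mult)
  also have "\<dots> = (if x = 1 then of_nat N else 0)"
    using xN by (simp add: sum_gp_strict)
  finally show ?thesis
    using x1 by auto
qed

text \<open>The weights \<open>\<omega> ^ (j * k) / N\<close> form a discrete Fourier transform of
  the power series of the kernel. It keeps the exponents congruent to \<open>k\<close> modulo
  \<open>N\<close>, which are the \<open>k + i * N\<close> because \<open>k < N\<close>.\<close>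

lemma szego_average_sums:
  fixes k N :: nat and r :: real
  assumes r: "0 < r" "r < 1" and N: "k < N" and z: "norm z < 1"
  defines "\<omega> \<equiv> exp (2 * of_real pi * \<i> / of_nat N)"
  shows "(\<lambda>i. of_real (r ^ (k + i * N)) * z ^ (k + i * N)) sums
    (\<Sum>j<N. (\<omega> ^ (j * k) / of_nat N) * szego (of_real r * \<omega> ^ j) z)"
proof -
  have [simp]: "norm \<omega> = 1"
    by (simp add: \<omega>_def norm_exp)
  have N0: "N > 0" using N by simp
  let ?c = "\<lambda>m. if m mod N = k mod N then of_real (r ^ m) * z ^ m else 0"
  have "(\<lambda>m. \<Sum>j<N. (\<omega> ^ (j * k) / of_nat N) * (cnj (of_real r * \<omega> ^ j) ^ m * z ^ m)) sums
    (\<Sum>j<N. (\<omega> ^ (j * k) / of_nat N) * szego (of_real r * \<omega> ^ j) z)"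
    using r z by (intro sums_sum sums_mult szego_sums) (auto simp: norm_mult norm_power)
  also have "(\<lambda>m. \<Sum>j<N. (\<omega> ^ (j * k) / of_nat N) * (cnj (of_real r * \<omega> ^ j) ^ m * z ^ m)) = ?c"
  proof
    fix m
    have "(\<Sum>j<N. (\<omega> ^ (j * k) / of_nat N) * (cnj (of_real r * \<omega> ^ j) ^ m * z ^ m)) =
      (\<Sum>j<N. (of_real r ^ m * z ^ m / of_nat N) * (\<omega> ^ (j * k) * cnj (\<omega> ^ j) ^ m))"
      by (intro sum.cong refl) (simp add: power_mult_distrib)
    also have "\<dots> = (of_real r ^ m * z ^ m / of_nat N) * (\<Sum>j<N. \<omega> ^ (j * k) * cnj (\<omega> ^ j) ^ m)"
      by (simp only: sum_distrib_left)
    also have "\<dots> = ?c m"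
      using N0 by (simp only: \<omega>_def sum_root_of_unity_powers[OF N0]) simp
    finally show "(\<Sum>j<N. (\<omega> ^ (j * k) / of_nat N) * (cnj (of_real r * \<omega> ^ j) ^ m * z ^ m)) = ?c m" .
  qed
  finally have s: "?c sums (\<Sum>j<N. (\<omega> ^ (j * k) / of_nat N) * szego (of_real r * \<omega> ^ j) z)" .
  have "(\<lambda>i. ?c (k + i * N)) sums (\<Sum>j<N. (\<omega> ^ (j * k) / of_nat N) * szego (of_real r * \<omega> ^ j) z)"
  proof (subst sums_mono_reindex[of "\<lambda>i. k + i * N"])
    show "strict_mono (\<lambda>i. k + i * N)"
      using N0 by (auto simp: strict_mono_def)
    show "?c m = 0" if "m \<notin> range (\<lambda>i. k + i * N)" for m
    proof -
      have "m \<noteq> k + (m div N) * N"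
        using that by blast
      then have "m mod N \<noteq> k"
        by (metis add.commute div_mult_mod_eq)
      then show ?thesis using N by simp
    qed
  qed (rule s)
  then show ?thesis by simp
qed

text \<open>The normalising factor is \<open>1 / (1 - r)\<close> for the radius
  \<open>r = (k + 1) / (k + 2)\<close> of the kernels used below; this radius is positive even for
  \<open>k = 0\<close>.\<close>

definition monomial_atoms :: "(complex \<Rightarrow> complex) set" where
  "monomial_atoms = range (\<lambda>k z. z ^ k / of_nat (k + 2))"

lemma disc_bounded_monomial_atoms: "disc_bounded monomial_atoms"
  unfolding disc_bounded_def monomial_atoms_def
proof safe
  fix k :: nat and z :: complex
  assume "z \<in> unit_disc"
  then have "norm z ^ k \<le> 1"
    by (intro power_le_one) auto
  moreover have "norm (of_nat (k + 2) :: complex) = real k + 2"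
    by (subst norm_of_nat) simp
  ultimately show "norm (z ^ k / of_nat (k + 2)) \<le> 1"
    by (simp add: norm_divide norm_power divide_le_eq del: of_nat_add)
qed

text \<open>Averaging Szego kernels of radius \<open>r = (k + 1) / (k + 2)\<close> over the roots of unity of order
  \<open>5 (k + 2)\<close> leaves \<open>z ^ k\<close> plus monomials of much higher degree with geometrically small weights.\<close>
lemma monomial_atoms_split:
  assumes "u \<in> monomial_atoms"
  shows "\<exists>v w. atomic phi_atoms 3 v \<and> atomic monomial_atoms (1/2) w \<and> (\<forall>z\<in>unit_disc. u z = v z + w z)"
proof -
  obtain k where u: "u = (\<lambda>z. z ^ k / of_nat (k + 2))"
    using assms by (auto simp: monomial_atoms_def)
  define N where "N = 5 * (k + 2)"
  define r where "r = (real k + 1) / (real k + 2)"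
  define \<omega> where "\<omega> = exp (2 * of_real pi * \<i> / of_nat N)"
  have [simp]: "norm \<omega> = 1"
    by (simp add: \<omega>_def norm_exp)
  have r: "0 < r" "r < 1" "1 / (1 - r) = real k + 2" and rinv: "1 / r = 1 + 1 / (real k + 1)"
    by (auto simp: r_def field_simps)
  have N: "k < N" "N > 0"
    by (auto simp: N_def)
  \<comment> \<open>By Bernoulli \<open>(1 / r) ^ (k + 2)\<close> is at least 2, and the exponent
    \<open>N\<close> consists of five such blocks.\<close>
  have q: "r ^ N \<le> 1 / 32"
  proof -
    have "2 \<le> 1 + real (k + 2) * (1 / (real k + 1))"
      by (simp add: field_simps)
    also have "\<dots> \<le> (1 / r) ^ (k + 2)"
      unfolding rinv by (rule Bernoulli_inequality) (rule order_trans[of _ 0], auto)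
    finally have "r ^ (k + 2) \<le> 1 / 2"
      using r by (simp add: power_divide field_simps)
    then have "(r ^ (k + 2)) ^ 5 \<le> (1 / 2) ^ 5"
      using r by (intro power_mono) auto
    moreover have "r ^ N = (r ^ (k + 2)) ^ 5"
      by (simp only: N_def mult.commute[of 5] power_mult)
    ultimately show ?thesis
      by (simp add: power_divide)
  qed
  have rk: "1 / r ^ k \<le> 3"
  proof -
    have "1 / r ^ k = (1 / r) ^ k"
      by (simp add: power_divide)
    also have "\<dots> \<le> exp (1 / (real k + 1)) ^ k"
      unfolding rinv by (intro power_mono exp_ge_add_one_self) simp
    also have "\<dots> = exp (real k * (1 / (real k + 1)))"
      by (simp only: exp_of_nat_mult)
    also have "\<dots> \<le> exp 1"
      by simp
    also have "\<dots> \<le> 3"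
      by (rule exp_le)
    finally show ?thesis .
  qed
  define c where "c = complex_of_real (1 / ((real k + 2) * r ^ k))"
  define v where "v z = c * (\<Sum>j<N. (\<omega> ^ (j * k) / of_nat N) * szego (of_real r * \<omega> ^ j) z)" for z
  \<comment> \<open>The error term of exponent \<open>k + (i + 1) * N\<close> has the normalising
    factor \<open>(k + 2) * (1 + 5 * (i + 1))\<close>, which is the source of the linear factor. The
    shift to \<open>Suc i\<close> leaves out the term of exponent \<open>k\<close>, which is
    \<open>u\<close> itself.\<close>
  define l where "l i = - ((r ^ N) ^ (Suc i) * (1 + real (Suc i) * 5))" for i
  define w where "w z = (\<Sum>i. of_real (l i) * (z ^ (k + Suc i * N) / of_nat (k + Suc i * N + 2)))" for z :: complex
  have "atomic phi_atoms (norm c * (\<Sum>j<N. norm (\<omega> ^ (j * k) / of_nat N) * (1 / (1 - norm (of_real r * \<omega> ^ j))))) v"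
    unfolding v_def using r N
    by (intro atomic_scale atomic_sum disc_bounded_phi_atoms atomic_szego) (auto simp: norm_mult norm_power)
  also have "norm c * (\<Sum>j<N. norm (\<omega> ^ (j * k) / of_nat N) * (1 / (1 - norm (of_real r * \<omega> ^ j)))) = 1 / r ^ k"
    using r N unfolding c_def norm_of_real by (simp add: norm_mult norm_power norm_divide)
  finally have v: "atomic phi_atoms 3 v"
    using rk by (rule atomic_mono)
  \<comment> \<open>Bernoulli trades the linear factor for \<open>6 ^ (i + 1)\<close>. The resulting
    ratio \<open>6/32\<close> sums to \<open>6/26\<close>, safely below the \<open>1/2\<close> that
    \<open>atomic_approx\<close> asks for; this is why five blocks were taken.\<close>
  have l_le: "norm (complex_of_real (l i)) \<le> (6/32) * (6/32) ^ i" for i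
  proof -
    have "1 + real (Suc i) * 5 \<le> (1 + 5) ^ Suc i"
      by (rule Bernoulli_inequality) simp
    moreover have "(r ^ N) ^ Suc i \<le> (1/32) ^ Suc i"
      using q r by (intro power_mono) auto
    moreover have "norm (complex_of_real (l i)) = (r ^ N) ^ Suc i * (1 + real (Suc i) * 5)"
      using r by (simp only: l_def norm_of_real) (simp add: abs_mult)
    ultimately have "norm (complex_of_real (l i)) \<le> (1/32) ^ Suc i * (1 + 5) ^ Suc i"
      using r mult_mono[of "(r ^ N) ^ Suc i" "(1/32) ^ Suc i" "1 + real (Suc i) * 5" "(1 + 5) ^ Suc i"] by simp
    also have "\<dots> = (6/32) * (6/32) ^ i"
      unfolding power_mult_distrib[symmetric] by simp
    finally show ?thesis .
  qed
  have geo: "(\<lambda>i. (6/32) * (6/32 :: real) ^ i) sums (6/26)"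
    using sums_mult[OF geometric_sums[of "6/32::real"], of "6/32"] by simp
  have lsum: "summable (\<lambda>i. norm (complex_of_real (l i)))"
    by (rule summable_comparison_test[OF _ sums_summable[OF geo]]) (use l_le in auto)
  have wz: "(\<lambda>i. of_real (l i) * (z ^ (k + Suc i * N) / of_nat (k + Suc i * N + 2))) sums (u z - v z)"
    if z: "z \<in> unit_disc" for z
  proof -
    have "(\<lambda>i. c * (of_real (r ^ (k + i * N)) * z ^ (k + i * N))) sums v z"
      unfolding v_def \<omega>_def using z r N by (intro sums_mult szego_average_sums) auto
    then have "(\<lambda>i. - (c * (of_real (r ^ (k + Suc i * N)) * z ^ (k + Suc i * N)))) sums
       - (v z - c * (of_real (r ^ (k + 0 * N)) * z ^ (k + 0 * N)))"
      by (intro sums_minus) (subst sums_Suc_iff, simp)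
    moreover have "c * (of_real (r ^ (k + 0 * N)) * z ^ (k + 0 * N)) = u z"
      using r by (simp add: c_def u add.commute)
    moreover have "- (c * (of_real (r ^ (k + Suc i * N)) * z ^ (k + Suc i * N))) =
        of_real (l i) * (z ^ (k + Suc i * N) / of_nat (k + Suc i * N + 2))" for i
    proof -
      have "real (k + Suc i * N + 2) = (1 + real (Suc i) * 5) * (real k + 2)"
        by (simp add: N_def algebra_simps)
      then have 1: "(of_nat (k + Suc i * N + 2) :: complex) = of_real ((1 + real (Suc i) * 5) * (real k + 2))"
        by (metis of_real_of_nat_eq)
      have "1 / ((real k + 2) * r ^ k) * r ^ (k + Suc i * N) = (r ^ N) ^ Suc i / (real k + 2)"
        unfolding power_add mult.commute[of "Suc i" N] power_mult using r by simp
      also have "\<dots> = - l i / ((1 + real (Suc i) * 5) * (real k + 2))"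
        unfolding l_def by (auto simp: divide_simps)
      finally have "c * of_real (r ^ (k + Suc i * N)) = - of_real (l i) / of_nat (k + Suc i * N + 2)"
        unfolding 1 c_def of_real_mult[symmetric] of_real_divide[symmetric] of_real_minus[symmetric] by simp
      then show ?thesis
        by (metis (no_types, lifting) minus_mult_minus mult.assoc mult_minus_left times_divide_eq_left times_divide_eq_right)
    qed
    ultimately show ?thesis
      by simp
  qed
  have "atomic monomial_atoms (6/26) w"
    unfolding atomic_def
  proof (intro exI conjI allI ballI)
    show "(\<lambda>z. z ^ (k + Suc i * N) / of_nat (k + Suc i * N + 2)) \<in> monomial_atoms" for i
      unfolding monomial_atoms_def by blast
    show "(\<Sum>i. norm (complex_of_real (l i))) \<le> 6/26"
      using suminf_le[OF l_le lsum sums_summable[OF geo]] geo by (simp add: sums_iff)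
    show "(\<lambda>i. of_real (l i) * (z ^ (k + Suc i * N) / of_nat (k + Suc i * N + 2))) sums w z" if "z \<in> unit_disc" for z
      unfolding w_def using wz[OF that] sums_summable summable_sums by blast
  qed (rule lsum)
  then have "atomic monomial_atoms (1/2) w"
    by (rule atomic_mono) simp
  moreover have "u z = v z + w z" if "z \<in> unit_disc" for z
    using wz[OF that] by (simp add: w_def sums_iff)
  ultimately show ?thesis
    using v by blast
qed

text \<open>The factor 6 is the \<open>2 * K\<close> of \<open>atomic_approx\<close> with
  \<open>K = 3\<close> from the split. Linear growth in \<open>k\<close> is all that matters: power
  series with ratio below 1 then converge in the norm of the minimal space.\<close>

lemma atomic_power: "atomic phi_atoms (6 * (real k + 2)) (\<lambda>z. z ^ k)"
proof -
  have *: "atomic phi_atoms (2 * 3 * 1) (\<lambda>z. z ^ k / of_nat (k + 2))"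
    by (rule atomic_approx[OF disc_bounded_phi_atoms disc_bounded_monomial_atoms monomial_atoms_split atomic_atom])
       (auto simp: monomial_atoms_def)
  have nz: "of_nat (k + 2) \<noteq> (0 :: complex)"
    by (simp only: of_nat_eq_0_iff)
  from atomic_scale[OF *, of "of_nat (k + 2)"]
  have "atomic phi_atoms (norm (of_nat (k + 2) :: complex) * (2 * 3 * 1)) (\<lambda>z. z ^ k)"
    by (rule atomic_cong) (metis nonzero_mult_div_cancel_left times_divide_eq_right nz)
  then show ?thesis
    unfolding norm_of_nat by (simp add: algebra_simps)
qed

lemma summable_of_nat_geometric:
  assumes "0 \<le> (\<rho>::real)" "\<rho> < 1"
  shows "summable (\<lambda>k. of_nat k * \<rho> ^ k)"
proof -
  have "summable (\<lambda>k. of_nat (Suc k) * \<rho> ^ k)"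
    using geometric_deriv_sums[of \<rho>] assms by (simp add: sums_iff)
  then have "summable (\<lambda>k. of_nat (Suc k) * \<rho> ^ k - \<rho> ^ k)"
    using assms by (intro summable_diff) (auto intro: summable_geometric)
  then show ?thesis
    by (simp add: algebra_simps)
qed

text \<open>The kernel is a power series in \<open>cnj w\<close> whose coefficients are the
  monomials. Their norms grow linearly, so the Weierstrass test gives uniform convergence in norm on
  each closed disc of radius below 1; evaluation at points identifies the sum.\<close>

lemma continuous_on_minimal_of_szego: "continuous_on unit_disc (\<lambda>w. minimal_of (szego w))"
proof -
  define p :: "nat \<Rightarrow> minimal" where "p k = minimal_of (\<lambda>z. z ^ k)" for k
  have p: "norm (p k) \<le> 6 * (real k + 2)" "fun_of (p k) z = on_disc (\<lambda>z. z ^ k) z" for k z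
    unfolding p_def using norm_minimal_of[OF atomic_power] fun_of_minimal_of[OF atomic_power] by auto
  have *: "continuous_on (cball 0 \<rho>) (\<lambda>w. minimal_of (szego w))" if \<rho>: "0 \<le> \<rho>" "\<rho> < 1" for \<rho>
  proof -
    have sm: "summable (\<lambda>k. \<rho> ^ k * (6 * (real k + 2)))"
    proof -
      have "summable (\<lambda>k. 6 * (of_nat k * \<rho> ^ k) + 12 * \<rho> ^ k)"
        using \<rho> by (intro summable_add summable_mult summable_geometric) (auto intro: summable_of_nat_geometric)
      then show ?thesis by (simp add: algebra_simps)
    qed
    have le: "norm (scaleC (cnj w ^ k) (p k)) \<le> \<rho> ^ k * (6 * (real k + 2))" if "w \<in> cball 0 \<rho>" for w k
      using that \<rho> unfolding norm_scaleC norm_power by (intro mult_mono power_mono p) auto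
    have ul: "uniform_limit (cball 0 \<rho>) (\<lambda>n w. \<Sum>k<n. scaleC (cnj w ^ k) (p k))
        (\<lambda>w. \<Sum>k. scaleC (cnj w ^ k) (p k)) sequentially"
      by (rule Weierstrass_m_test[OF le sm])
    have "continuous_on (cball 0 \<rho>) (\<lambda>w. \<Sum>k. scaleC (cnj w ^ k) (p k))"
    proof (rule uniform_limit_theorem[OF _ ul])
      show "\<forall>\<^sub>F n in sequentially. continuous_on (cball 0 \<rho>) (\<lambda>w. \<Sum>k<n. scaleC (cnj w ^ k) (p k))"
        by (intro always_eventually allI continuous_intros bounded_linear.continuous_on[OF bounded_bilinear.bounded_linear_left[OF bounded_bilinear_scaleC]])
    qed auto
    moreover have "(\<Sum>k. scaleC (cnj w ^ k) (p k)) = minimal_of (szego w)" if w: "w \<in> cball 0 \<rho>" for w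
    proof (rule minimal_eqI)
      fix z :: complex assume z: "z \<in> unit_disc"
      have "summable (\<lambda>k. scaleC (cnj w ^ k) (p k))"
        by (rule summable_comparison_test'[OF sm, of 0]) (use le w in auto)
      then have "(\<lambda>k. fun_of (scaleC (cnj w ^ k) (p k)) z) sums fun_of (\<Sum>k. scaleC (cnj w ^ k) (p k)) z"
        by (rule bounded_linear.sums[OF bounded_linear_fun_of summable_sums])
      moreover have "(\<lambda>k. fun_of (scaleC (cnj w ^ k) (p k)) z) sums szego w z"
        using szego_sums[of w z] z w \<rho> by (simp add: scaleC.rep_eq p on_disc_def)
      moreover have "fun_of (minimal_of (szego w)) z = szego w z"
        using z w \<rho> by (subst fun_of_minimal_of[OF atomic_szego]) (auto simp: on_disc_def)
      ultimately show "fun_of (\<Sum>k. scaleC (cnj w ^ k) (p k)) z = fun_of (minimal_of (szego w)) z"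
        using sums_unique2 by metis
    qed
    ultimately show ?thesis
      by (metis (no_types, lifting) continuous_on_cong)
  qed
  show ?thesis
  proof (rule continuous_at_imp_continuous_on, rule ballI)
    fix w :: complex assume "w \<in> unit_disc"
    then obtain \<rho> where "norm w < \<rho>" "\<rho> < 1"
      using dense[of "norm w" 1] by auto
    moreover from this have "w \<in> interior (cball 0 \<rho>)"
      by simp
    moreover have "0 \<le> \<rho>"
      using \<open>norm w < \<rho>\<close> norm_ge_zero[of w] by linarith
    ultimately show "isCont (\<lambda>w. minimal_of (szego w)) w"
      using * by (intro continuous_on_interior[where S = "cball 0 \<rho>"]) auto
  qed
qed

section \<open>Integral representation by Szego kernels\<close>

text \<open>Cauchy's formula, with the kernel written so that for \<open>x = s * a * z\<close> the
  denominator is exactly that of \<open>szego (a * cis \<theta>) z\<close>.\<close>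

lemma circle_average:
  assumes h: "h holomorphic_on ball 0 R" and s: "0 < s" "s < R" and x: "norm x < s"
  shows "((\<lambda>\<theta>. h (of_real s * cis \<theta>) / (1 - x * cis (- \<theta>) / of_real s)) has_integral 2 * of_real pi * h x) {0..2 * pi}"
proof -
  have "((\<lambda>u. h u / (u - x)) has_contour_integral (2 * of_real pi * \<i> * h x)) (circlepath 0 s)"
    using x s by (intro Cauchy_integral_circlepath_simple holomorphic_on_subset[OF h]) auto
  then have "((\<lambda>t. h (of_real s * cis t) / (of_real s * cis t - x) * s * \<i> * cis t) has_integral
      2 * of_real pi * \<i> * h x) {0..2 * pi}"
    unfolding circlepath_def by (subst (asm) has_contour_integral_part_circlepath_iff) auto
  from has_integral_mult_right[OF this, of "- \<i>"]
  have "((\<lambda>t. - \<i> * (h (of_real s * cis t) / (of_real s * cis t - x) * s * \<i> * cis t)) has_integral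
      2 * of_real pi * h x) {0..2 * pi}"
    by (simp add: algebra_simps)
  moreover have "- \<i> * (h (of_real s * cis t) / (of_real s * cis t - x) * s * \<i> * cis t) =
      h (of_real s * cis t) / (1 - x * cis (- t) / of_real s)" for t
  proof -
    have "of_real s * cis t - x \<noteq> 0"
    proof
      assume "of_real s * cis t - x = 0"
      then have "norm x = norm (of_real s * cis t)" by simp
      then show False using x s by (simp add: norm_mult)
    qed
    moreover have "cis (- t) = 1 / cis t"
      by (simp add: divide_inverse)
    then have "1 - x * cis (- t) / of_real s = (of_real s * cis t - x) / (of_real s * cis t)"
      using s by (simp add: diff_divide_distrib mult.commute)
    ultimately show ?thesis
      using s by (simp add: mult_ac)
  qed
  ultimately show ?thesis
    by simp
qed

lemma taylor_two_has_integral: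
  assumes f: "f holomorphic_on ball 0 R" and z: "norm z < R" and t0: "0 \<le> t0" "t0 \<le> 1"
  shows "((\<lambda>t. of_real (1 - t) * (z\<^sup>2 * deriv (deriv f) (of_real t * z))) has_integral
    (f z - f (of_real t0 * z) - of_real (1 - t0) * (z * deriv f (of_real t0 * z)))) {t0..1}"
proof -
  \<comment> \<open>Differentiating \<open>G\<close> makes the two terms \<open>z * f' (t z)\<close>
    cancel and leaves the integrand.\<close>
  define G where "G t = (1 - t) * (z * deriv f (t * z)) + f (t * z)" for t
  have d1: "(deriv f) holomorphic_on ball 0 R"
    by (intro holomorphic_deriv f) auto
  have "((\<lambda>t. of_real (1 - t) * (z\<^sup>2 * deriv (deriv f) (of_real t * z))) has_integral (G (of_real 1) - G (of_real t0))) {t0..1}"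
  proof (rule fundamental_theorem_of_calculus[OF t0(2)])
    fix t assume t: "t \<in> {t0..1}"
    have "norm (of_real t * z) \<le> 1 * norm z"
      unfolding norm_mult using t t0 by (intro mult_right_mono) auto
    then have b: "of_real t * z \<in> ball 0 R"
      using z by simp
    have lin: "((\<lambda>t. t * z) has_field_derivative z) (at (of_real t))"
      by (auto intro!: derivative_eq_intros)
    have "((\<lambda>t. deriv f (t * z)) has_field_derivative deriv (deriv f) (of_real t * z) * z) (at (of_real t))"
      "((\<lambda>t. f (t * z)) has_field_derivative deriv f (of_real t * z) * z) (at (of_real t))"
      by (rule DERIV_chain2[OF holomorphic_derivI lin], rule d1 f, rule open_ball, rule b)+
    then have "(G has_field_derivative of_real (1 - t) * (z\<^sup>2 * deriv (deriv f) (of_real t * z))) (at (of_real t))"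
      unfolding G_def by (auto intro!: derivative_eq_intros simp: algebra_simps power2_eq_square)
    from has_vector_derivative_real_field[OF this]
    show "((\<lambda>t. G (of_real t)) has_vector_derivative of_real (1 - t) * (z\<^sup>2 * deriv (deriv f) (of_real t * z))) (at t within {t0..1})"
      by (rule has_vector_derivative_at_within)
  qed
  then show ?thesis
    by (simp add: G_def algebra_simps)
qed

lemma fun_of_integral:
  fixes F :: "real \<Rightarrow> minimal"
  assumes "F integrable_on S"
  shows "fun_of (integral S F) z = integral S (\<lambda>x. fun_of (F x) z)"
  using integral_linear[OF assms bounded_linear_fun_of, of z] by (simp add: o_def)

text \<open>The identity \<open>cnj w * z * szego w z = szego w z - 1\<close> turns multiplication
  of the kernel by \<open>z\<close> into linear operations, which stay inside the space and preserve
  continuity in \<open>w\<close>. The price is a division by \<open>cnj w\<close>, so poles have to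
  be kept away from 0. Two such steps produce the factor \<open>z^2\<close> of the Taylor
  remainder.\<close>

definition szego1 :: "complex \<Rightarrow> minimal" where
  "szego1 w = scaleC (1 / cnj w) (minimal_of (szego w) - minimal_of (\<lambda>_. 1))"

definition szego2 :: "complex \<Rightarrow> minimal" where
  "szego2 w = scaleC (1 / cnj w) (szego1 w - minimal_of (\<lambda>z. z))"

lemma fun_of_szego:
  assumes "norm w < 1" "z \<in> unit_disc"
  shows "fun_of (minimal_of (szego w)) z = szego w z"
    and "w \<noteq> 0 \<Longrightarrow> fun_of (szego1 w) z = z * szego w z"
    and "w \<noteq> 0 \<Longrightarrow> fun_of (szego2 w) z = z\<^sup>2 * szego w z"
proof -
  have nz: "1 - cnj w * z \<noteq> 0"
    using assms by (intro one_minus_cnj_mult_nz) auto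
  show 0: "fun_of (minimal_of (szego w)) z = szego w z"
    using assms by (subst fun_of_minimal_of[OF atomic_szego]) (auto simp: on_disc_def)
  show 1: "fun_of (szego1 w) z = z * szego w z" if "w \<noteq> 0"
    using assms that nz 0 fun_of_minimal_of[OF atomic_const[of 1]]
    by (simp add: szego1_def scaleC.rep_eq fun_of_diff on_disc_def szego_def field_simps)
  show "fun_of (szego2 w) z = z\<^sup>2 * szego w z" if "w \<noteq> 0"
    using assms that nz 1 fun_of_minimal_of[OF atomic_power[of 1]]
    by (simp add: szego2_def scaleC.rep_eq fun_of_diff on_disc_def szego_def field_simps power2_eq_square)
qed

lemma norm_szego:
  assumes "norm w < 1"
  shows "norm (minimal_of (szego w)) \<le> 1 / (1 - norm w)"
    and "norm (szego1 w) \<le> (1 / (1 - norm w) + 1) / norm w"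
    and "norm (szego2 w) \<le> ((1 / (1 - norm w) + 1) / norm w + 1) / norm w"
proof -
  show 0: "norm (minimal_of (szego w)) \<le> 1 / (1 - norm w)"
    by (rule norm_minimal_of[OF atomic_szego[OF assms]])
  have c: "norm (minimal_of (\<lambda>_. 1)) \<le> 1"
    using norm_minimal_of[OF atomic_const[of 1]] by simp
  have "atomic phi_atoms (norm (-1::complex) * 1) (\<lambda>z. -1 * phi 0 z)"
    by (intro atomic_scale atomic_atom phi_in_phi_atoms) simp
  then have "atomic phi_atoms 1 (\<lambda>z. z)"
    by (simp add: phi_def)
  then have i: "norm (minimal_of (\<lambda>z. z)) \<le> 1"
    by (rule norm_minimal_of)
  show 1: "norm (szego1 w) \<le> (1 / (1 - norm w) + 1) / norm w"
    using norm_triangle_ineq4[of "minimal_of (szego w)" "minimal_of (\<lambda>_. 1)"] 0 c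
    by (auto simp: szego1_def norm_scaleC norm_divide intro!: divide_right_mono)
  show "norm (szego2 w) \<le> ((1 / (1 - norm w) + 1) / norm w + 1) / norm w"
    using norm_triangle_ineq4[of "szego1 w" "minimal_of (\<lambda>z. z)"] 1 i
    by (auto simp: szego2_def norm_scaleC norm_divide intro!: divide_right_mono)
qed

lemma continuous_on_szego [continuous_intros]:
  assumes "continuous_on S g" "\<And>x. x \<in> S \<Longrightarrow> norm (g x) < 1" "\<And>x. x \<in> S \<Longrightarrow> g x \<noteq> 0"
  shows "continuous_on S (\<lambda>x. minimal_of (szego (g x)))" "continuous_on S (\<lambda>x. szego1 (g x))"
    "continuous_on S (\<lambda>x. szego2 (g x))"
proof -
  show 0: "continuous_on S (\<lambda>x. minimal_of (szego (g x)))"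
    by (rule continuous_on_compose2[OF continuous_on_minimal_of_szego assms(1)]) (use assms in auto)
  show 1: "continuous_on S (\<lambda>x. szego1 (g x))"
    unfolding szego1_def by (intro continuous_on_scaleC continuous_intros 0 assms) (use assms in auto)
  show "continuous_on S (\<lambda>x. szego2 (g x))"
    unfolding szego2_def by (intro continuous_on_scaleC continuous_intros 1 assms) (use assms in auto)
qed

text \<open>The radii multiply: values of \<open>h\<close> at radius \<open>s\<close> paired with
  poles at radius \<open>a\<close> reproduce \<open>h\<close> at \<open>s * a * z\<close>. This
  allows the poles to lie strictly inside the disc.\<close>

lemma szego_circle_average:
  assumes h: "h holomorphic_on ball 0 R" and s: "0 < s" "s < R" and a: "0 < a" "a < 1" and z: "z \<in> unit_disc" "s \<ge> a"
  shows "((\<lambda>\<theta>. h (of_real s * cis \<theta>) * szego (of_real a * cis \<theta>) z) has_integral 2 * of_real pi * h (of_real (s * a) * z)) {0..2 * pi}"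
proof -
  have "a * norm z < 1 * 1"
    using a z by (intro mult_strict_mono) auto
  then have "norm (of_real (s * a) * z) < s"
    using s a by (simp add: norm_mult)
  from circle_average[OF h s this] show ?thesis
    using s by (simp add: szego_def mult_ac flip: cis_cnj)
qed

text \<open>The formula \<open>f z = f (z/4) + 3/4 * z * f' (z/4) + integral over [1/4, 1] of (1 - t) * z^2 * f'' (t z)\<close>
  together with Cauchy's formula writes \<open>f\<close> as an integral of Szego kernels. Splitting \<open>t\<close> as
  \<open>(\<rho> sqrt t) (sqrt t / \<rho>)\<close> with \<open>\<rho> > 1\<close> keeps the kernels in a compact part of the disc, where they
  depend continuously on their pole in the norm of the minimal space.\<close>
proposition atomic_if_integral_second_deriv_le:
  assumes R: "R > 1" and f: "f holomorphic_on ball 0 R" and f1: "\<And>z. z \<in> unit_disc \<Longrightarrow> norm (f z) \<le> 1"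
    and I: "integral {1/4..1} (\<lambda>t. integral {0..2*pi} (\<lambda>\<theta>. norm (deriv (deriv f) (of_real (sqrt t) * cis \<theta>)))) \<le> I"
  shows "atomic phi_atoms (70 + 11 * I) f"
proof -
  define f' where "f' = deriv f"
  define f'' where "f'' = deriv f'"
  have hol': "f' holomorphic_on ball 0 R" and hol'': "f'' holomorphic_on ball 0 R"
    unfolding f'_def f''_def by (intro holomorphic_deriv f open_ball)+
  \<comment> \<open>Uniform continuity of \<open>f''\<close> on a closed disc slightly larger than
    the unit disc permits the return from radius \<open>\<rho> * sqrt t\<close> to
    \<open>sqrt t\<close> at the cost of an additive 1. The final constants are therefore
    independent of \<open>\<rho>\<close> and \<open>R\<close>.\<close>
  obtain \<rho> where \<rho>: "1 < \<rho>" "\<rho> \<le> 2" "\<rho> < R"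
    and uc: "\<And>t \<theta>. 0 \<le> t \<Longrightarrow> t \<le> 1 \<Longrightarrow>
       norm (f'' (of_real (\<rho> * sqrt t) * cis \<theta>)) \<le> norm (f'' (of_real (sqrt t) * cis \<theta>)) + 1"
  proof -
    have "uniformly_continuous_on (cball 0 ((1 + R) / 2)) f''"
      using R by (intro compact_uniformly_continuous holomorphic_on_imp_continuous_on holomorphic_on_subset[OF hol'']) auto
    then obtain \<delta> where \<delta>: "\<delta> > 0" "\<And>u v. u \<in> cball 0 ((1 + R) / 2) \<Longrightarrow> v \<in> cball 0 ((1 + R) / 2) \<Longrightarrow>
        dist u v < \<delta> \<Longrightarrow> dist (f'' u) (f'' v) < 1"
      unfolding uniformly_continuous_on_def by (metis zero_less_one)
    define \<eta> where "\<eta> = min 1 (min (\<delta> / 2) ((R - 1) / 4))"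
    have \<eta>: "\<eta> > 0" "\<eta> \<le> 1" "\<eta> < \<delta>" "\<eta> \<le> (R - 1) / 4"
      using \<delta>(1) R by (simp_all add: \<eta>_def min_def)
    define q where "q = 1 + \<eta>"
    have q: "q > 1" "q \<le> 2" "q < R" "q \<le> (1 + R) / 2" "q - 1 < \<delta>"
      using \<eta> R by (auto simp: q_def)
    show ?thesis
    proof (rule that[of q])
      fix t \<theta> :: real assume t: "0 \<le> t" "t \<le> 1"
      have sq: "0 \<le> sqrt t" "sqrt t \<le> 1" using t by auto
      have "q * sqrt t \<le> q * 1"
        using sq q by (intro mult_left_mono) auto
      with q(4) have "q * sqrt t \<le> (1 + R) / 2"
        by linarith
      then have 1: "of_real (q * sqrt t) * cis \<theta> \<in> cball 0 ((1 + R) / 2)"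
        using q sq by (simp add: norm_mult)
      have "sqrt t \<le> (1 + R) / 2"
        by (rule order_trans[OF sq(2)]) (use R in simp)
      then have 2: "of_real (sqrt t) * cis \<theta> \<in> cball 0 ((1 + R) / 2)"
        using sq by (simp add: norm_mult)
      have "dist (of_real (q * sqrt t) * cis \<theta>) (of_real (sqrt t) * cis \<theta>) = norm (of_real ((q - 1) * sqrt t) * cis \<theta>)"
        unfolding dist_norm by (simp add: algebra_simps)
      also have "\<dots> = (q - 1) * sqrt t"
        using q sq unfolding norm_mult norm_of_real norm_cis by simp
      also have "\<dots> \<le> (q - 1) * 1"
        using q sq by (intro mult_left_mono) auto
      also have "\<dots> < \<delta>" using q by simp
      finally have "dist (f'' (of_real (q * sqrt t) * cis \<theta>)) (f'' (of_real (sqrt t) * cis \<theta>)) < 1"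
        by (rule \<delta>(2)[OF 1 2])
      then show "norm (f'' (of_real (q * sqrt t) * cis \<theta>)) \<le> norm (f'' (of_real (sqrt t) * cis \<theta>)) + 1"
        unfolding dist_norm by (smt (verit) norm_triangle_ineq2)
    qed (use q in auto)
  qed
  \<comment> \<open>Since \<open>1/2 * 1/2 = 1/4\<close> and
    \<open>(\<rho> * sqrt t) * (sqrt t / \<rho>) = t\<close>, the three integrals over the circle
    reproduce, up to \<open>2 * pi\<close>, the value \<open>f (z/4)\<close>, the term
    \<open>z * f' (z/4)\<close> and the integrand of the Taylor remainder.\<close>
  define F0 where "F0 \<theta> = scaleC (f (of_real (1/2) * cis \<theta>)) (minimal_of (szego (of_real (1/2) * cis \<theta>)))" for \<theta>
  define F1 where "F1 \<theta> = scaleC (f' (of_real (1/2) * cis \<theta>)) (szego1 (of_real (1/2) * cis \<theta>))" for \<theta>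
  define F2 where "F2 t \<theta> = scaleC (of_real (1 - t)) (scaleC (f'' (of_real (\<rho> * sqrt t) * cis \<theta>)) (szego2 (of_real (sqrt t / \<rho>) * cis \<theta>)))" for t \<theta>
  have inR: "of_real (\<rho> * sqrt t) * cis \<theta> \<in> ball 0 R" "norm (of_real (sqrt t / \<rho>) * cis \<theta>) < 1"
    "of_real (sqrt t / \<rho>) * cis \<theta> \<noteq> 0" if "t \<in> {1/4..1}" for t \<theta>
  proof -
    have sq: "0 < s" "s \<le> 1" if "s = sqrt t" for s using that \<open>t \<in> _\<close> by auto
    have "norm (of_real (\<rho> * s) * cis \<theta>) < R" if "s = sqrt t" for s
    proof -
      have "\<rho> * s \<le> \<rho> * 1" using sq[OF that] \<rho> by (intro mult_left_mono) auto
      then have "\<rho> * s < R" by (rule le_less_trans) (use \<rho> in simp)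
      then show ?thesis using sq(1)[OF that] \<rho> by (simp add: norm_mult)
    qed
    then show "of_real (\<rho> * sqrt t) * cis \<theta> \<in> ball 0 R"
      by simp
    have "norm (of_real (s / \<rho>) * cis \<theta>) < 1" if "s = sqrt t" for s
      using sq[OF that] \<rho> by (simp add: norm_mult norm_divide)
    then show "norm (of_real (sqrt t / \<rho>) * cis \<theta>) < 1"
      by blast
    show "of_real (sqrt t / \<rho>) * cis \<theta> \<noteq> 0"
      using sq[OF refl] \<rho> by auto
  qed
  have cont0: "continuous_on S F0" and cont1: "continuous_on S F1" for S
    unfolding F0_def F1_def using R
    by (intro continuous_on_scaleC continuous_intros continuous_on_compose2[OF holomorphic_on_imp_continuous_on[OF f]]
        continuous_on_compose2[OF holomorphic_on_imp_continuous_on[OF hol']]; auto simp: norm_mult)+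
  have cont2: "continuous_on ({1/4..1} \<times> UNIV) (\<lambda>(t, \<theta>). F2 t \<theta>)"
    unfolding F2_def case_prod_beta
    by (intro continuous_on_scaleC continuous_intros continuous_on_compose2[OF holomorphic_on_imp_continuous_on[OF hol'']])
       (use inR \<rho> in auto)
  have cont2': "continuous_on {0..2*pi} (F2 t)" if "t \<in> {1/4..1}" for t
    using continuous_on_compose2[OF cont2, of "{0..2*pi}" "\<lambda>\<theta>. (t, \<theta>)"] that
      continuous_on_Pair[OF continuous_on_const continuous_on_id, of "{0..2*pi}" t]
    by (auto simp: image_subset_iff)
  have sub: "{1/4..1::real} \<times> {0..2*pi} \<subseteq> {1/4..1} \<times> UNIV"
    by auto
  have cont2'': "continuous_on {1/4..1} (\<lambda>t. integral {0..2*pi} (F2 t))"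
    using integral_continuous_on_param[of "{1/4..1::real}" 0 "2*pi" F2] continuous_on_subset[OF cont2 sub]
    by (simp add: cbox_interval)
  define G where "G = scaleC (1 / (2 * of_real pi)) (integral {0..2*pi} F0 + scaleC (3/4) (integral {0..2*pi} F1) +
     integral {1/4..1} (\<lambda>t. integral {0..2*pi} (F2 t)))"
  have Gf: "fun_of G z = f z" if z: "z \<in> unit_disc" for z
  proof -
    have w: "norm (of_real (1/2) * cis \<theta>) < 1" "of_real (1/2) * cis \<theta> \<noteq> 0" for \<theta>
      by (auto simp: norm_mult)
    have "fun_of (integral {0..2*pi} F0) z = integral {0..2*pi} (\<lambda>\<theta>. f (of_real (1/2) * cis \<theta>) * szego (of_real (1/2) * cis \<theta>) z)"
      unfolding fun_of_integral[OF integrable_continuous_real[OF cont0]] F0_def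
      using z by (intro integral_cong) (simp only: scaleC.rep_eq fun_of_szego(1)[OF w(1) z])
    also have "\<dots> = 2 * of_real pi * f (of_real (1/2 * (1/2)) * z)"
      using z R by (intro integral_unique szego_circle_average[OF f]) auto
    finally have 0: "fun_of (integral {0..2*pi} F0) z = 2 * of_real pi * f (of_real (1/4) * z)"
      by simp
    have "fun_of (integral {0..2*pi} F1) z = integral {0..2*pi} (\<lambda>\<theta>. z * (f' (of_real (1/2) * cis \<theta>) * szego (of_real (1/2) * cis \<theta>) z))"
      unfolding fun_of_integral[OF integrable_continuous_real[OF cont1]] F1_def
      using z by (intro integral_cong) (simp only: scaleC.rep_eq fun_of_szego(2)[OF w(1) z w(2)] mult.left_commute)
    also have "\<dots> = z * (2 * of_real pi * f' (of_real (1/2 * (1/2)) * z))"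
      using z R by (intro integral_unique has_integral_mult_right szego_circle_average[OF hol']) auto
    finally have 1: "fun_of (integral {0..2*pi} F1) z = 2 * of_real pi * (z * f' (of_real (1/4) * z))"
      by simp
    have inner: "fun_of (integral {0..2*pi} (F2 t)) z = 2 * of_real pi * (of_real (1 - t) * (z\<^sup>2 * f'' (of_real t * z)))"
      if t: "t \<in> {1/4..1}" for t
    proof -
      have sq: "0 < sqrt t" using t by auto
      have "sqrt t / \<rho> \<le> \<rho> * sqrt t"
      proof -
        have "sqrt t / \<rho> \<le> sqrt t / 1" using sq \<rho> by (intro divide_left_mono) auto
        also have "\<dots> \<le> \<rho> * sqrt t" using sq \<rho> by simp
        finally show ?thesis .
      qed
      moreover have "\<rho> * sqrt t < R" using inR(1)[OF t, of 0] \<rho> sq by (simp add: norm_mult)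
      moreover have "sqrt t / \<rho> < 1" using inR(2)[OF t, of 0] \<rho> sq by (simp add: norm_mult norm_divide)
      ultimately have A: "((\<lambda>\<theta>. (of_real (1 - t) * z\<^sup>2) * (f'' (of_real (\<rho> * sqrt t) * cis \<theta>) * szego (of_real (sqrt t / \<rho>) * cis \<theta>) z)) has_integral
         (of_real (1 - t) * z\<^sup>2) * (2 * of_real pi * f'' (of_real (\<rho> * sqrt t * (sqrt t / \<rho>)) * z))) {0..2*pi}"
        using z sq \<rho> by (intro has_integral_mult_right szego_circle_average[OF hol'']) (auto simp: mult.commute)
      have B: "\<rho> * sqrt t * (sqrt t / \<rho>) = t"
        using \<rho> t by simp
      have C: "fun_of (F2 t \<theta>) z = (of_real (1 - t) * z\<^sup>2) * (f'' (of_real (\<rho> * sqrt t) * cis \<theta>) * szego (of_real (sqrt t / \<rho>) * cis \<theta>) z)" for \<theta>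
        unfolding F2_def scaleC.rep_eq fun_of_szego(3)[OF inR(2)[OF t] z inR(3)[OF t]] by (simp only: mult_ac)
      show ?thesis
        using integral_unique[OF A[unfolded B C[symmetric]]]
        unfolding fun_of_integral[OF integrable_continuous_real[OF cont2'[OF t]]]
        by (simp add: mult_ac)
    qed
    have "fun_of (integral {1/4..1} (\<lambda>t. integral {0..2*pi} (F2 t))) z =
        integral {1/4..1} (\<lambda>t. 2 * of_real pi * (of_real (1 - t) * (z\<^sup>2 * f'' (of_real t * z))))"
      unfolding fun_of_integral[OF integrable_continuous_real[OF cont2'']]
      by (intro integral_cong inner)
    also have "\<dots> = 2 * of_real pi * (f z - f (of_real (1/4) * z) - of_real (1 - 1/4) * (z * f' (of_real (1/4) * z)))"
      unfolding f'_def f''_def using z R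
      by (intro integral_unique has_integral_mult_right taylor_two_has_integral[OF f]) auto
    finally have 2: "fun_of (integral {1/4..1} (\<lambda>t. integral {0..2*pi} (F2 t))) z =
       2 * of_real pi * (f z - f (of_real (1/4) * z) - of_real (1 - 1/4) * (z * f' (of_real (1/4) * z)))" .
    show ?thesis
      unfolding G_def scaleC.rep_eq plus_minimal.rep_eq 0 1 2 by (simp add: field_simps)
  qed
  have n0: "norm (integral {0..2*pi} F0) \<le> integral {0..2*pi} (\<lambda>_. 2)"
  proof (rule integral_norm_bound_integral[OF integrable_continuous_real[OF cont0]])
    fix \<theta> :: real
    have "norm (minimal_of (szego (of_real (1/2) * cis \<theta>))) \<le> 2"
      using norm_szego(1)[of "of_real (1/2) * cis \<theta>"] by (simp add: norm_mult)
    moreover have "norm (f (of_real (1/2) * cis \<theta>)) \<le> 1"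
      by (intro f1) (simp add: norm_mult)
    ultimately show "norm (F0 \<theta>) \<le> 2"
      unfolding F0_def norm_scaleC
      using mult_mono[of "norm (f (of_real (1/2) * cis \<theta>))" 1 "norm (minimal_of (szego (of_real (1/2) * cis \<theta>)))" 2]
      by simp
  qed auto
  have n1: "norm (integral {0..2*pi} F1) \<le> integral {0..2*pi} (\<lambda>_. 24)"
  proof (rule integral_norm_bound_integral[OF integrable_continuous_real[OF cont1]])
    fix \<theta> :: real
    let ?u = "of_real (1/2) * cis \<theta>"
    have "norm (szego1 ?u) \<le> 6"
      using norm_szego(2)[of ?u] by (simp add: norm_mult)
    moreover have "norm (f' ?u) \<le> 4"
    proof -
      have sub: "cball ?u (1/4) \<subseteq> unit_disc"
      proof
        fix v assume "v \<in> cball ?u (1/4)"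
        then have "norm (v - ?u) \<le> 1/4" by (simp add: dist_norm norm_minus_commute)
        moreover have "norm v \<le> norm ?u + norm (v - ?u)"
          using norm_triangle_ineq[of ?u "v - ?u"] by simp
        ultimately show "v \<in> unit_disc"
          by (simp add: norm_mult)
      qed
      have "cball ?u (1/4) \<subseteq> ball 0 R"
        using sub R by (auto simp: subset_iff)
      then have "f holomorphic_on cball ?u (1/4)"
        using f holomorphic_on_subset by blast
      then have "norm ((deriv ^^ 1) f ?u) \<le> fact 1 * 1 / (1/4) ^ 1"
        using sub by (intro Cauchy_inequality)
          (auto intro!: f1 holomorphic_on_imp_continuous_on elim!: holomorphic_on_subset simp: subset_iff dist_norm norm_minus_commute)
      then show ?thesis
        by (simp add: f'_def)
    qed
    ultimately show "norm (F1 \<theta>) \<le> 24"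
      unfolding F1_def norm_scaleC
      using mult_mono[of "norm (f' ?u)" 4 "norm (szego1 ?u)" 6]
      by simp
  qed auto
  have inR': "norm (of_real (sqrt t) * cis \<theta>) < R" if "t \<in> {1/4..1}" for t \<theta>
  proof -
    have "sqrt t \<le> 1" using that by simp
    then have "sqrt t < R" by (rule le_less_trans) (rule R)
    then show ?thesis using that by (simp add: norm_mult)
  qed
  have contN: "continuous_on ({1/4..1} \<times> UNIV) (\<lambda>(t, \<theta>). norm (f'' (of_real (sqrt t) * cis \<theta>)))"
    unfolding case_prod_beta
    by (intro continuous_intros continuous_on_compose2[OF holomorphic_on_imp_continuous_on[OF hol'']])
       (use inR' in auto)
  have contN': "continuous_on {0..2*pi} (\<lambda>\<theta>. norm (f'' (of_real (sqrt t) * cis \<theta>)))" if "t \<in> {1/4..1}" for t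
    using continuous_on_compose2[OF contN, of "{0..2*pi}" "\<lambda>\<theta>. (t, \<theta>)"] that
      continuous_on_Pair[OF continuous_on_const continuous_on_id, of "{0..2*pi}" t]
    by (auto simp: image_subset_iff)
  have contN'': "continuous_on {1/4..1} (\<lambda>t. integral {0..2*pi} (\<lambda>\<theta>. norm (f'' (of_real (sqrt t) * cis \<theta>))))"
    using integral_continuous_on_param[of "{1/4..1::real}" 0 "2*pi" "\<lambda>t \<theta>. norm (f'' (of_real (sqrt t) * cis \<theta>))"]
      continuous_on_subset[OF contN sub]
    by (simp add: cbox_interval)
  \<comment> \<open>The weight \<open>1 - t\<close> compensates the norm of the kernel, which is of
    order \<open>1 / (1 - a)\<close> for the pole radius \<open>a = sqrt t / \<rho>\<close>, because
    \<open>1 - t \<le> 2 * (1 - a)\<close>. Starting at \<open>t = 1/4\<close> keeps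
    \<open>a\<close> above \<open>1/4\<close>, where the two divisions by \<open>cnj w\<close> cost
    only a constant.\<close>
  have n2i: "norm (integral {0..2*pi} (F2 t)) \<le> 64 * (integral {0..2*pi} (\<lambda>\<theta>. norm (f'' (of_real (sqrt t) * cis \<theta>))) + 2 * pi)"
    if t: "t \<in> {1/4..1}" for t
  proof -
    define s where "s = sqrt t"
    have s: "1/2 \<le> s" "s \<le> 1" "s * s = t"
      using t real_le_rsqrt[of "1/2" t] by (auto simp: power2_eq_square s_def)
    define a where "a = sqrt t / \<rho>"
    have "1/2 / 2 \<le> s / \<rho>"
      using s \<rho> by (intro frac_le) auto
    moreover have "s / \<rho> < s / 1"
      using s \<rho> by (intro divide_strict_left_mono) auto
    ultimately have a: "a \<ge> 1/4" "a < s" "a < 1"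
      using s by (auto simp: a_def s_def[symmetric])
    have "(1 - s) * (1 + s) \<le> (1 - a) * 2"
      using a s by (intro mult_mono) auto
    then have a': "1 - t \<le> 2 * (1 - a)"
      using s(3) by (simp add: algebra_simps)
    have "norm (integral {0..2*pi} (F2 t)) \<le> integral {0..2*pi} (\<lambda>\<theta>. 64 * (norm (f'' (of_real (sqrt t) * cis \<theta>)) + 1))"
    proof (rule integral_norm_bound_integral[OF integrable_continuous_real[OF cont2'[OF t]]])
      show "(\<lambda>\<theta>. 64 * (norm (f'' (of_real (sqrt t) * cis \<theta>)) + 1)) integrable_on {0..2 * pi}"
        by (intro integrable_continuous_real continuous_intros contN' t)
      fix \<theta> :: real
      let ?w = "of_real a * cis \<theta>"
      have na: "norm ?w = a" using a by (simp add: norm_mult)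
      have "norm (szego2 ?w) \<le> ((1 / (1 - a) + 1) / a + 1) / a"
        using norm_szego(3)[of ?w] a unfolding na by simp
      also have "\<dots> \<le> ((1 / (1 - a) + 1) / (1/4) + 1) / (1/4)"
        using a by (intro frac_le divide_left_mono add_right_mono) auto
      also have "\<dots> = 16 / (1 - a) + 20"
        by simp
      finally have "(1 - t) * norm (szego2 ?w) \<le> (1 - t) * (16 / (1 - a) + 20)"
        using t by (intro mult_left_mono) auto
      also have "\<dots> = 16 * (1 - t) / (1 - a) + 20 * (1 - t)"
        by (simp add: algebra_simps)
      also have "\<dots> \<le> 32 + 20"
        using a a' t by (intro add_mono) (auto simp: field_simps)
      finally have 64: "(1 - t) * norm (szego2 ?w) \<le> 64" by simp
      have "norm (F2 t \<theta>) = norm (f'' (of_real (\<rho> * sqrt t) * cis \<theta>)) * ((1 - t) * norm (szego2 ?w))"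
        unfolding F2_def norm_scaleC a_def[symmetric] norm_of_real using t by simp
      also have "\<dots> \<le> (norm (f'' (of_real (sqrt t) * cis \<theta>)) + 1) * 64"
        by (rule mult_mono[OF uc 64]) (use t in auto)
      finally show "norm (F2 t \<theta>) \<le> 64 * (norm (f'' (of_real (sqrt t) * cis \<theta>)) + 1)"
        by simp
    qed
    also have "\<dots> = 64 * (integral {0..2*pi} (\<lambda>\<theta>. norm (f'' (of_real (sqrt t) * cis \<theta>))) + 2 * pi)"
      unfolding integral_mult_right
      by (subst Henstock_Kurzweil_Integration.integral_add) (auto intro!: integrable_continuous_real contN' t)
    finally show ?thesis .
  qed
  have n2: "norm (integral {1/4..1} (\<lambda>t. integral {0..2*pi} (F2 t))) \<le> 64 * (I + 2 * pi * (3/4))"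
  proof -
    have "norm (integral {1/4..1} (\<lambda>t. integral {0..2*pi} (F2 t))) \<le>
       integral {1/4..1} (\<lambda>t. 64 * (integral {0..2*pi} (\<lambda>\<theta>. norm (f'' (of_real (sqrt t) * cis \<theta>))) + 2 * pi))"
      by (rule integral_norm_bound_integral[OF integrable_continuous_real[OF cont2'']])
         (intro integrable_continuous_real continuous_intros contN'', rule n2i)
    also have "\<dots> = 64 * (integral {1/4..1} (\<lambda>t. integral {0..2*pi} (\<lambda>\<theta>. norm (f'' (of_real (sqrt t) * cis \<theta>)))) + 2 * pi * (3/4))"
      unfolding integral_mult_right
      by (subst Henstock_Kurzweil_Integration.integral_add) (auto intro!: integrable_continuous_real contN'')
    also have "\<dots> \<le> 64 * (I + 2 * pi * (3/4))"
      using I by (simp add: f''_def f'_def)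
    finally show ?thesis .
  qed
  have I0: "I \<ge> 0"
  proof -
    have "0 \<le> integral {1/4..1} (\<lambda>t. integral {0..2*pi} (\<lambda>\<theta>. norm (f'' (of_real (sqrt t) * cis \<theta>))))"
      by (intro integral_nonneg integrable_continuous_real contN'' ballI contN') auto
    then show ?thesis using I by (simp add: f''_def f'_def)
  qed
  \<comment> \<open>The constant parts are \<open>4 * pi + 36 * pi + 96 * pi\<close>, and
    \<open>136 * pi / (2 * pi) = 68\<close>; moreover \<open>64 / (2 * pi) \<le> 11\<close> since
    \<open>pi > 3\<close>. Taking 70 leaves room for the strict inequality in
    \<open>atomic_fun_of\<close>.\<close>
  have "norm G = 1 / (2 * pi) * norm (integral {0..2*pi} F0 + scaleC (3/4) (integral {0..2*pi} F1) +
     integral {1/4..1} (\<lambda>t. integral {0..2*pi} (F2 t)))"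
    unfolding G_def norm_scaleC by (simp add: norm_divide norm_mult)
  also have "\<dots> \<le> 1 / (2 * pi) * (4 * pi + 3/4 * (48 * pi) + 64 * (I + 2 * pi * (3/4)))"
  proof (intro mult_left_mono order_trans[OF norm_triangle_ineq] add_mono)
    show "norm (integral {0..2*pi} F0) \<le> 4 * pi"
      using n0 by simp
    show "norm (scaleC (3/4) (integral {0..2*pi} F1)) \<le> 3/4 * (48 * pi)"
      using n1 unfolding norm_scaleC by simp
  qed (use n2 in auto)
  also have "\<dots> = 68 + 32 / pi * I"
    by (simp add: field_simps)
  also have "\<dots> \<le> 68 + 11 * I"
    using pi_gt3 I0 by (intro add_left_mono mult_right_mono) (auto simp: field_simps)
  finally have "atomic phi_atoms (70 + 11 * I) (fun_of G)"
    by (intro atomic_fun_of) simp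
  then show ?thesis
    by (rule atomic_cong) (rule Gf)
qed

section \<open>Second derivatives of Blaschke products\<close>

definition phi_deriv :: "complex \<Rightarrow> complex \<Rightarrow> complex" where
  "phi_deriv a z = - of_real (1 - (norm a)\<^sup>2) / (1 - cnj a * z)\<^sup>2"

definition phi_deriv2 :: "complex \<Rightarrow> complex \<Rightarrow> complex" where
  "phi_deriv2 a z = - 2 * cnj a * of_real (1 - (norm a)\<^sup>2) / (1 - cnj a * z) ^ 3"

text \<open>For \<open>|a| \<le> 1\<close> this is the modulus of the derivative of
  \<open>phi a\<close>, also inside the disc; for \<open>|z| = 1\<close> it is the Poisson kernel at
  \<open>a\<close>.\<close>

definition poisson :: "complex \<Rightarrow> complex \<Rightarrow> real" where
  "poisson a z = (1 - (norm a)\<^sup>2) / (norm (1 - cnj a * z))\<^sup>2"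

lemma phi_has_field_derivative:
  assumes "1 - cnj a * z \<noteq> 0"
  shows "(phi a has_field_derivative phi_deriv a z) (at z)"
proof -
  have eq: "of_real (1 - (norm a)\<^sup>2) = 1 - cnj a * a"
    using complex_norm_square[of a] by (simp add: mult.commute)
  show ?thesis
    unfolding phi_def[abs_def] phi_deriv_def eq
    by (rule derivative_eq_intros refl assms | use assms in \<open>simp add: field_simps power2_eq_square\<close>)+
qed

lemma phi_deriv_has_field_derivative:
  assumes "1 - cnj a * z \<noteq> 0"
  shows "(phi_deriv a has_field_derivative phi_deriv2 a z) (at z)"
proof -
  define k where "k = complex_of_real (1 - (norm a)\<^sup>2)"
  have "((\<lambda>w. - k / w\<^sup>2) has_field_derivative 2 * k / w ^ 3) (at w)" if "w \<noteq> 0" for w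
    using that by (auto intro!: derivative_eq_intros simp: power2_eq_square power3_eq_cube field_simps)
  moreover have "((\<lambda>z. 1 - cnj a * z) has_field_derivative - cnj a) (at z)"
    by (auto intro!: derivative_eq_intros)
  ultimately have "((\<lambda>z. - k / (1 - cnj a * z)\<^sup>2) has_field_derivative 2 * k / (1 - cnj a * z) ^ 3 * (- cnj a)) (at z)"
    using assms DERIV_chain2[of "\<lambda>w. - k / w\<^sup>2" _ "\<lambda>z. 1 - cnj a * z" z] by blast
  then show ?thesis
    unfolding phi_deriv_def[abs_def] phi_deriv2_def k_def by (simp add: mult_ac)
qed

lemma norm_phi_deriv: "norm a \<le> 1 \<Longrightarrow> norm (phi_deriv a z) = poisson a z"
  unfolding phi_deriv_def poisson_def norm_divide norm_power norm_minus_cancel norm_of_real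
  by (simp add: abs_square_le_1)

lemma poisson_nonneg: "norm a \<le> 1 \<Longrightarrow> 0 \<le> poisson a z"
  by (simp add: poisson_def abs_square_le_1)

lemma poisson_pos: "norm a < 1 \<Longrightarrow> norm z \<le> 1 \<Longrightarrow> 0 < poisson a z"
  using one_minus_cnj_mult_nz[of "cnj z" "cnj a"]
  by (auto simp: poisson_def abs_square_less_1 mult.commute intro!: divide_pos_pos)

lemma exists_radius_gt_1:
  fixes \<alpha> :: "nat \<Rightarrow> complex"
  assumes "\<And>j. j \<in> {1..n} \<Longrightarrow> norm (\<alpha> j) < 1"
  obtains R where "R > 1" "\<And>j z. j \<in> {1..n} \<Longrightarrow> norm z < R \<Longrightarrow> 1 - cnj (\<alpha> j) * z \<noteq> 0"
proof -
  define m where "m = Max (insert 0 ((\<lambda>j. norm (\<alpha> j)) ` {1..n}))"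
  have mj: "norm (\<alpha> j) \<le> m" if "j \<in> {1..n}" for j
    unfolding m_def by (intro Max_ge) (use that in auto)
  have m0: "0 \<le> m" "m < 1"
    using assms by (auto simp: m_def)
  \<comment> \<open>A radius strictly between 1 and \<open>1 / m\<close>, in a form that still makes
    sense for \<open>m = 0\<close>.\<close>
  define R where "R = 2 / (1 + m)"
  show ?thesis
  proof (rule that[of R])
    show "R > 1" using m0 by (simp add: R_def)
    fix j :: nat and z :: complex assume j: "j \<in> {1..n}" "norm z < R"
    have "norm (cnj (\<alpha> j) * z) \<le> m * R"
      unfolding norm_mult using j mj[OF j(1)] m0 by (intro mult_mono) auto
    also have "m * R < 1"
      using m0 by (simp add: R_def field_simps)
    finally show "1 - cnj (\<alpha> j) * z \<noteq> 0" by auto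
  qed
qed

section \<open>Product rule for products of Moebius factors\<close>

fun bprod_deriv :: "(nat \<Rightarrow> complex) \<Rightarrow> nat \<Rightarrow> complex \<Rightarrow> complex" where
  "bprod_deriv \<alpha> 0 z = 0"
| "bprod_deriv \<alpha> (Suc n) z = bprod_deriv \<alpha> n z * phi (\<alpha> (Suc n)) z + (\<Prod>j=1..n. phi (\<alpha> j) z) * phi_deriv (\<alpha> (Suc n)) z"

fun bprod_deriv2 :: "(nat \<Rightarrow> complex) \<Rightarrow> nat \<Rightarrow> complex \<Rightarrow> complex" where
  "bprod_deriv2 \<alpha> 0 z = 0"
| "bprod_deriv2 \<alpha> (Suc n) z = bprod_deriv2 \<alpha> n z * phi (\<alpha> (Suc n)) z +
     2 * (bprod_deriv \<alpha> n z * phi_deriv (\<alpha> (Suc n)) z) + (\<Prod>j=1..n. phi (\<alpha> j) z) * phi_deriv2 (\<alpha> (Suc n)) z"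

lemma bprod_has_field_derivative:
  assumes "\<And>j. j \<in> {1..n} \<Longrightarrow> 1 - cnj (\<alpha> j) * z \<noteq> 0"
  shows "((\<lambda>z. \<Prod>j=1..n. phi (\<alpha> j) z) has_field_derivative bprod_deriv \<alpha> n z) (at z)"
    and "(bprod_deriv \<alpha> n has_field_derivative bprod_deriv2 \<alpha> n z) (at z)"
  using assms
proof (induction n)
  case 0
  { case 1 then show ?case by simp }
  { case 2 then show ?case by (simp add: bprod_deriv.simps(1)[abs_def]) }
next
  case (Suc n)
  { case 1
    have nz: "1 - cnj (\<alpha> (Suc n)) * z \<noteq> 0" using 1 by simp
    have "((\<lambda>z. \<Prod>j=1..n. phi (\<alpha> j) z) has_field_derivative bprod_deriv \<alpha> n z) (at z)"
      using Suc 1 by simp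
    from DERIV_mult[OF this phi_has_field_derivative[OF nz]]
    show ?case by (simp add: algebra_simps) }
  { case 2
    have nz: "1 - cnj (\<alpha> (Suc n)) * z \<noteq> 0" using 2 by simp
    have 1: "((\<lambda>z. \<Prod>j=1..n. phi (\<alpha> j) z) has_field_derivative bprod_deriv \<alpha> n z) (at z)"
      and 2: "(bprod_deriv \<alpha> n has_field_derivative bprod_deriv2 \<alpha> n z) (at z)"
      using Suc 2 by simp_all
    from DERIV_add[OF DERIV_mult[OF 2 phi_has_field_derivative[OF nz]] DERIV_mult[OF 1 phi_deriv_has_field_derivative[OF nz]]]
    show ?case by (simp add: algebra_simps bprod_deriv.simps(2)[abs_def]) }
qed

lemma norm_phi_le_1_closed:
  assumes "norm a < 1" "norm z \<le> 1"
  shows "norm (phi a z) \<le> 1"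
proof -
  have "norm (1 - cnj a * z) = norm (1 - cnj z * a)"
    by (subst complex_mod_cnj[symmetric]) (simp add: mult.commute)
  then have "norm (phi a z) = norm (phi z a)"
    by (simp add: phi_def norm_divide norm_minus_commute)
  then show ?thesis
    using norm_phi_le_1[of z a] assms by simp
qed

lemma norm_bprod_le_1:
  assumes "\<And>j. j \<in> {1..n} \<Longrightarrow> norm (\<alpha> j) < 1" "norm z \<le> 1"
  shows "norm (\<Prod>j=1..n. phi (\<alpha> j) z) \<le> 1"
  unfolding prod_norm[symmetric] using assms
  by (intro prod_le_1) (auto intro: norm_phi_le_1_closed)

text \<open>Induction over the factors, all bounded by 1. The cross term \<open>2 * S * p\<close> of
  the product rule is absorbed by \<open>(S + p)^2 = S^2 + 2 * S * p + p^2\<close>, so only sums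
  over single factors and one square remain.\<close>

lemma norm_bprod_deriv_le:
  assumes "\<And>j. j \<in> {1..n} \<Longrightarrow> norm (\<alpha> j) < 1" "norm z \<le> 1"
  shows "norm (bprod_deriv \<alpha> n z) \<le> (\<Sum>j=1..n. poisson (\<alpha> j) z)"
    and "norm (bprod_deriv2 \<alpha> n z) \<le> (\<Sum>j=1..n. norm (phi_deriv2 (\<alpha> j) z)) + (\<Sum>j=1..n. poisson (\<alpha> j) z)\<^sup>2"
  using assms
proof (induction n)
  case (Suc n)
  let ?a = "\<alpha> (Suc n)" and ?S = "\<Sum>j=1..n. poisson (\<alpha> j) z" and ?A = "\<Sum>j=1..n. norm (phi_deriv2 (\<alpha> j) z)"
  let ?P = "\<Prod>j=1..n. phi (\<alpha> j) z"
  { assume a: "\<And>j. j \<in> {1..Suc n} \<Longrightarrow> norm (\<alpha> j) < 1" and z: "norm z \<le> 1"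
    have 1: "norm (bprod_deriv \<alpha> n z) \<le> ?S" and 2: "norm (bprod_deriv2 \<alpha> n z) \<le> ?A + ?S\<^sup>2"
      using Suc a z by simp_all
    have P: "norm ?P \<le> 1"
      using a z by (intro norm_bprod_le_1) auto
    have p: "norm (phi ?a z) \<le> 1" "norm (phi_deriv ?a z) = poisson ?a z" "0 \<le> poisson ?a z"
      using a[of "Suc n"] z norm_phi_le_1_closed[of ?a z] by (auto intro!: norm_phi_deriv poisson_nonneg)
    have S0: "0 \<le> ?S"
      using a by (intro sum_nonneg poisson_nonneg) (auto intro: less_imp_le)
    have A0: "0 \<le> ?A + ?S\<^sup>2"
      by (intro add_nonneg_nonneg sum_nonneg) auto
    have 3: "norm (bprod_deriv \<alpha> n z * phi ?a z) \<le> ?S * 1" "norm (?P * phi_deriv ?a z) \<le> 1 * poisson ?a z"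
      "norm (bprod_deriv2 \<alpha> n z * phi ?a z) \<le> (?A + ?S\<^sup>2) * 1"
      "norm (2 * (bprod_deriv \<alpha> n z * phi_deriv ?a z)) \<le> 2 * (?S * poisson ?a z)"
      "norm (?P * phi_deriv2 ?a z) \<le> 1 * norm (phi_deriv2 ?a z)"
      unfolding norm_mult norm_numeral p(2)
      by (rule mult_mono[OF 1 p(1) S0] mult_right_mono[OF P] mult_mono[OF 2 p(1) A0]
          mult_left_mono[OF mult_right_mono[OF 1]], (rule p(3) norm_ge_zero zero_le_numeral)+)+
    have "norm (bprod_deriv \<alpha> (Suc n) z) \<le> ?S * 1 + 1 * poisson ?a z"
      unfolding bprod_deriv.simps by (intro order_trans[OF norm_triangle_ineq] add_mono 3)
    then have d1: "norm (bprod_deriv \<alpha> (Suc n) z) \<le> (\<Sum>j=1..Suc n. poisson (\<alpha> j) z)"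
      by simp
    have "norm (bprod_deriv2 \<alpha> (Suc n) z) \<le> (?A + ?S\<^sup>2) * 1 + 2 * (?S * poisson ?a z) + 1 * norm (phi_deriv2 ?a z)"
      unfolding bprod_deriv2.simps by (intro order_trans[OF norm_triangle_ineq] add_mono 3)
    also have "\<dots> \<le> (\<Sum>j=1..Suc n. norm (phi_deriv2 (\<alpha> j) z)) + (\<Sum>j=1..Suc n. poisson (\<alpha> j) z)\<^sup>2"
      using zero_le_power2[of "poisson ?a z"] by (simp add: power2_eq_square algebra_simps)
    finally have "norm (bprod_deriv2 \<alpha> (Suc n) z) \<le>
      (\<Sum>j=1..Suc n. norm (phi_deriv2 (\<alpha> j) z)) + (\<Sum>j=1..Suc n. poisson (\<alpha> j) z)\<^sup>2" .
    with d1 have "norm (bprod_deriv \<alpha> (Suc n) z) \<le> (\<Sum>j=1..Suc n. poisson (\<alpha> j) z)"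
      "norm (bprod_deriv2 \<alpha> (Suc n) z) \<le> (\<Sum>j=1..Suc n. norm (phi_deriv2 (\<alpha> j) z)) + (\<Sum>j=1..Suc n. poisson (\<alpha> j) z)\<^sup>2"
      by blast+ }
  note * = this
  { case 1 then show ?case using *(1) by blast }
  { case 2 then show ?case using *(2) by blast }
qed auto

section \<open>Radial integration of the second derivative\<close>

lemma integral_inverse_square_le:
  fixes d :: real
  assumes "d > 0"
  shows "(\<lambda>t. 1 / (d + (1 - t))\<^sup>2) integrable_on {1/4..1}"
    and "integral {1/4..1} (\<lambda>t. 1 / (d + (1 - t))\<^sup>2) \<le> 1 / d"
proof -
  have "((\<lambda>t. 1 / (d + (1 - t))\<^sup>2) has_integral (1 / (d + (1 - 1)) - 1 / (d + (1 - 1/4)))) {1/4..1}"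
    by (rule fundamental_theorem_of_calculus)
       (use assms in \<open>auto intro!: derivative_eq_intros simp flip: has_real_derivative_iff_has_vector_derivative
         simp: power2_eq_square\<close>)
  then show "(\<lambda>t. 1 / (d + (1 - t))\<^sup>2) integrable_on {1/4..1}"
    "integral {1/4..1} (\<lambda>t. 1 / (d + (1 - t))\<^sup>2) \<le> 1 / d"
    using assms by (auto simp: integral_unique has_integral_integrable)
qed

text \<open>With \<open>s = sqrt t\<close>, the denominator is at least \<open>1 - s\<close>, and
  moving from \<open>cis \<theta>\<close> to \<open>s * cis \<theta>\<close> changes it by at most
  \<open>1 - s\<close>. Hence it is at least \<open>d / 2\<close> and at least
  \<open>(1 - t) / 2\<close>; averaging both gives the last bound.\<close>

lemma radial_denominator:
  fixes a :: complex and \<theta> :: real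
  assumes a: "norm a < 1" and t: "0 \<le> t" "t \<le> 1"
  defines "d \<equiv> norm (1 - cnj a * cis \<theta>)" and "r \<equiv> norm (1 - cnj a * (of_real (sqrt t) * cis \<theta>))"
  shows "d > 0" "d / 2 \<le> r" "(d + (1 - t)) / 4 \<le> r"
proof -
  define s where "s = sqrt t"
  have s: "0 \<le> s" "s \<le> 1" "s * s = t"
    using t by (auto simp: s_def)
  show d0: "d > 0"
    using one_minus_cnj_mult_nz[of "cnj (cis \<theta>)" "cnj a"] a by (simp add: d_def mult.commute)
  have 1: "1 - s \<le> r"
  proof -
    have "norm (cnj a * (of_real s * cis \<theta>)) \<le> 1 * s"
      unfolding norm_mult using a s by (intro mult_mono) auto
    then show ?thesis
      unfolding r_def s_def[symmetric] using norm_triangle_ineq2[of 1 "cnj a * (of_real s * cis \<theta>)"] by simp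
  qed
  have "1 - cnj a * cis \<theta> = (1 - cnj a * (of_real s * cis \<theta>)) + (- cnj a * (of_real (1 - s) * cis \<theta>))"
    by (simp add: algebra_simps)
  then have "d \<le> r + norm (- cnj a * (of_real (1 - s) * cis \<theta>))"
    unfolding d_def r_def s_def[symmetric] by (metis norm_triangle_ineq)
  also have "norm (- cnj a * (of_real (1 - s) * cis \<theta>)) \<le> 1 * (1 - s)"
    unfolding norm_mult norm_of_real using a s by (intro mult_mono) auto
  finally show dr: "d / 2 \<le> r"
    using 1 by simp
  have "(1 - s) * (1 + s) \<le> (1 - s) * 2"
    using s by (intro mult_left_mono) auto
  then have "1 - t \<le> 2 * (1 - s)"
    using s(3) by (simp add: algebra_simps)
  then show "(d + (1 - t)) / 4 \<le> r"
    using 1 dr by simp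
qed

lemma poisson_radial:
  assumes "norm a < 1" "0 \<le> t" "t \<le> 1"
  shows "poisson a (of_real (sqrt t) * cis \<theta>) \<le> 4 * poisson a (cis \<theta>)"
proof -
  let ?d = "norm (1 - cnj a * cis \<theta>)" and ?r = "norm (1 - cnj a * (of_real (sqrt t) * cis \<theta>))"
  have d: "0 < ?d" "?d / 2 \<le> ?r"
    using radial_denominator[OF assms, of \<theta>] by auto
  have "(?d / 2)\<^sup>2 \<le> ?r\<^sup>2"
    using d by (intro power_mono) auto
  moreover have "0 < ?r"
    using d by linarith
  ultimately have "1 / ?r\<^sup>2 \<le> 4 / ?d\<^sup>2"
    using d(1) by (simp add: field_simps power2_eq_square)
  then have "(1 - (norm a)\<^sup>2) * (1 / ?r\<^sup>2) \<le> (1 - (norm a)\<^sup>2) * (4 / ?d\<^sup>2)"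
    using assms by (intro mult_left_mono) (auto simp: abs_square_le_1)
  then show ?thesis
    by (simp only: poisson_def times_divide_eq_right mult_1_right mult.commute[of 4])
qed

text \<open>One factor of the cubed denominator is frozen at its boundary size \<open>d\<close>, the
  other two keep their dependence on \<open>t\<close>. Radial integration of
  \<open>1 / (d + (1 - t))^2\<close> returns at most \<open>1 / d\<close>, so that
  \<open>(1 - |a|^2) / d^2\<close> appears, which is the Poisson kernel again.\<close>

lemma norm_phi_deriv2_radial:
  fixes a :: complex and \<theta> :: real
  assumes "norm a < 1" "0 \<le> t" "t \<le> 1"
  defines "d \<equiv> norm (1 - cnj a * cis \<theta>)"
  shows "norm (phi_deriv2 a (of_real (sqrt t) * cis \<theta>)) \<le> 64 * (1 - (norm a)\<^sup>2) / d * (1 / (d + (1 - t))\<^sup>2)"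
proof -
  let ?r = "norm (1 - cnj a * (of_real (sqrt t) * cis \<theta>))"
  have d: "0 < d" "d / 2 \<le> ?r" "(d + (1 - t)) / 4 \<le> ?r"
    using radial_denominator[OF assms(1-3), of \<theta>] by (auto simp: d_def)
  have p: "0 \<le> 1 - (norm a)\<^sup>2"
    using assms by (auto simp: abs_square_le_1)
  have e: "0 < d + (1 - t)"
    using d(1) assms(3) by linarith
  have "(d / 2) * ((d + (1 - t)) / 4)\<^sup>2 \<le> ?r * ?r\<^sup>2"
    using d e by (intro mult_mono power_mono) auto
  then have r: "d * (d + (1 - t))\<^sup>2 / 32 \<le> ?r ^ 3"
    by (simp add: power2_eq_square power3_eq_cube)
  have "norm (phi_deriv2 a (of_real (sqrt t) * cis \<theta>)) = 2 * norm a * (1 - (norm a)\<^sup>2) / ?r ^ 3"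
    unfolding phi_deriv2_def norm_divide norm_mult norm_power norm_of_real using p by simp
  also have "\<dots> \<le> 2 * 1 * (1 - (norm a)\<^sup>2) / (d * (d + (1 - t))\<^sup>2 / 32)"
  proof (rule frac_le[OF _ _ _ r])
    show "2 * norm a * (1 - (norm a)\<^sup>2) \<le> 2 * 1 * (1 - (norm a)\<^sup>2)"
      using p assms(1) by (intro mult_right_mono mult_left_mono) auto
  qed (use p d e in auto)
  also have "\<dots> = 64 * (1 - (norm a)\<^sup>2) / d * (1 / (d + (1 - t))\<^sup>2)"
    using d e by (simp add: field_simps)
  finally show ?thesis .
qed

text \<open>\<open>circle_average\<close> at \<open>x = a\<close> for
  \<open>z \<mapsto> (1 - |a|^2) / (1 - cnj a * z)\<close>, a function with value 1 at
  \<open>a\<close>; on the circle the two denominators are conjugate to each other.\<close>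

lemma poisson_has_integral:
  assumes "norm a < 1"
  shows "((\<lambda>\<theta>. poisson a (cis \<theta>)) has_integral 2 * pi) {0..2*pi}"
proof -
  obtain R where R: "R > 1" "\<And>j z. j \<in> {1..1::nat} \<Longrightarrow> norm z < R \<Longrightarrow> 1 - cnj a * z \<noteq> 0"
    by (rule exists_radius_gt_1[of 1 "\<lambda>_. a"]) (use assms in blast)+
  have "((\<lambda>\<theta>. of_real (1 - (norm a)\<^sup>2) / (1 - cnj a * (of_real 1 * cis \<theta>)) / (1 - a * cis (- \<theta>) / of_real 1)) has_integral
     2 * of_real pi * (of_real (1 - (norm a)\<^sup>2) / (1 - cnj a * a))) {0..2*pi}"
    using R(2)[of 1]
    by (intro circle_average[where R = R] holomorphic_intros) (use R(1) assms in auto)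
  also have "of_real (1 - (norm a)\<^sup>2) / (1 - cnj a * a) = 1"
  proof -
    have "1 - cnj a * a \<noteq> 0"
      using one_minus_cnj_mult_nz[of a a] assms by simp
    then show ?thesis
      using complex_norm_square[of a] by (simp add: mult.commute)
  qed
  also have "(\<lambda>\<theta>. of_real (1 - (norm a)\<^sup>2) / (1 - cnj a * (of_real 1 * cis \<theta>)) / (1 - a * cis (- \<theta>) / of_real 1)) =
      (\<lambda>\<theta>. complex_of_real (poisson a (cis \<theta>)))"
  proof
    fix \<theta>
    have "(1 - cnj a * cis \<theta>) * (1 - a * cis (- \<theta>)) = of_real ((norm (1 - cnj a * cis \<theta>))\<^sup>2)"
      using complex_norm_square[of "1 - cnj a * cis \<theta>"] by (simp add: cis_cnj)
    then show "of_real (1 - (norm a)\<^sup>2) / (1 - cnj a * (of_real 1 * cis \<theta>)) / (1 - a * cis (- \<theta>) / of_real 1) =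
        complex_of_real (poisson a (cis \<theta>))"
      unfolding poisson_def of_real_divide by simp
  qed
  finally have "((\<lambda>\<theta>. complex_of_real (poisson a (cis \<theta>))) has_integral complex_of_real (2 * pi)) {0..2*pi}"
    by simp
  from has_integral_Re[OF this] show ?thesis by simp
qed

text \<open>The two bounds cross near \<open>e = 1 / S\<close>. A single multiple of
  \<open>1 / (1 / S + e)^2\<close> dominates their minimum, so the radial integral need not be
  split, and \<open>integral_inverse_square_le\<close> with \<open>d = 1 / S\<close> bounds it by
  \<open>128 * S\<close>.\<close>

lemma min_square_le:
  fixes S e X :: real
  assumes "S > 0" "e \<ge> 0" "X \<le> 16 * S\<^sup>2" "e > 0 \<Longrightarrow> X \<le> 32 / e\<^sup>2"
  shows "X \<le> 128 * (1 / (1 / S + e)\<^sup>2)"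
proof (cases "e \<le> 1 / S")
  have pos: "0 < 1 / S + e"
    using assms by (intro add_pos_nonneg) auto
  case True
  then have "(1 / S + e)\<^sup>2 \<le> (2 / S)\<^sup>2"
    using assms by (intro power_mono) auto
  then have "1 / (2 / S)\<^sup>2 \<le> 1 / (1 / S + e)\<^sup>2"
    using pos by (intro frac_le) auto
  then have "S\<^sup>2 / 4 \<le> 1 / (1 / S + e)\<^sup>2"
    by (simp add: power_divide)
  then show ?thesis
    using assms(3) zero_le_power2[of S] by linarith
next
  have pos: "0 < 1 / S + e"
    using assms by (intro add_pos_nonneg) auto
  case False
  moreover have "1 / S > 0" using assms by simp
  ultimately have e: "e > 0" by linarith
  have "(1 / S + e)\<^sup>2 \<le> (2 * e)\<^sup>2"
    using False assms by (intro power_mono) auto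
  then have "1 / (2 * e)\<^sup>2 \<le> 1 / (1 / S + e)\<^sup>2"
    using pos by (intro frac_le) auto
  then have "1 / e\<^sup>2 \<le> 4 * (1 / (1 / S + e)\<^sup>2)"
    by (simp add: power_mult_distrib)
  then show ?thesis
    using assms(4)[OF e] by simp
qed

text \<open>The order of integration is exchanged because the gain comes from the radial integral:
  it leaves \<open>192 * S\<close>, with 64 from the terms with a twice differentiated factor and
  128 from the rest. Then \<open>11 * 192 * 2 * pi = 4224 * pi\<close>.\<close>

proposition atomic_blaschke:
  assumes n: "n \<ge> 1" and c: "norm c = 1" and \<alpha>: "\<And>j. j \<in> {1..n} \<Longrightarrow> norm (\<alpha> j) < 1"
  shows "atomic phi_atoms ((70 + 4224 * pi) * real n) (\<lambda>z. c * (\<Prod>j=1..n. phi (\<alpha> j) z))"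
proof -
  define f where "f z = c * (\<Prod>j=1..n. phi (\<alpha> j) z)" for z
  obtain R where R: "R > 1" and nz: "\<And>j z. j \<in> {1..n} \<Longrightarrow> norm z < R \<Longrightarrow> 1 - cnj (\<alpha> j) * z \<noteq> 0"
    using exists_radius_gt_1[of n \<alpha>] \<alpha> by blast
  have d1: "(f has_field_derivative c * bprod_deriv \<alpha> n z) (at z)"
    and d2: "((\<lambda>z. c * bprod_deriv \<alpha> n z) has_field_derivative c * bprod_deriv2 \<alpha> n z) (at z)" if "z \<in> ball 0 R" for z
    unfolding f_def using that nz
    by (intro DERIV_cmult bprod_has_field_derivative; simp)+
  have f: "f holomorphic_on ball 0 R"
    unfolding holomorphic_on_open[OF open_ball] using d1 by blast
  have f1: "norm (f z) \<le> 1" if "z \<in> unit_disc" for z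
    unfolding f_def norm_mult using norm_bprod_le_1[of n \<alpha> z] \<alpha> that c by simp
  have df: "deriv f z = c * bprod_deriv \<alpha> n z" if "z \<in> ball 0 R" for z
    by (rule DERIV_imp_deriv[OF d1[OF that]])
  have ddf: "deriv (deriv f) z = c * bprod_deriv2 \<alpha> n z" if "z \<in> ball 0 R" for z
  proof -
    have "(deriv f has_field_derivative c * bprod_deriv2 \<alpha> n z) (at z)"
      by (rule has_field_derivative_transform_within_open[OF d2[OF that] open_ball that]) (simp add: df)
    then show ?thesis by (rule DERIV_imp_deriv)
  qed
  define g where "g t \<theta> = norm (deriv (deriv f) (of_real (sqrt t) * cis \<theta>))" for t \<theta>
  define S where "S \<theta> = (\<Sum>j=1..n. poisson (\<alpha> j) (cis \<theta>))" for \<theta>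
  have S0: "S \<theta> > 0" for \<theta>
    unfolding S_def using n \<alpha> by (intro sum_pos poisson_pos) auto
  have hol2: "deriv (deriv f) holomorphic_on ball 0 R"
    by (intro holomorphic_deriv f open_ball)
  have inR: "of_real (sqrt t) * cis \<theta> \<in> ball 0 R" if "t \<le> 1" "0 \<le> t" for t \<theta>
  proof -
    have "sqrt t \<le> 1" using that by simp
    then have "sqrt t < R" by (rule le_less_trans) (rule R)
    then show ?thesis using that by (simp add: norm_mult)
  qed
  have contg: "continuous_on ({1/4..1} \<times> {0..2*pi}) (\<lambda>(t, \<theta>). g t \<theta>)"
    unfolding g_def case_prod_beta
    by (intro continuous_intros continuous_on_compose2[OF holomorphic_on_imp_continuous_on[OF hol2]])
       (use inR in auto)
  define h where "h \<theta> t = (\<Sum>j=1..n. 64 * (1 - (norm (\<alpha> j))\<^sup>2) / norm (1 - cnj (\<alpha> j) * cis \<theta>) *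
      (1 / (norm (1 - cnj (\<alpha> j) * cis \<theta>) + (1 - t))\<^sup>2)) + 128 * (1 / (1 / S \<theta> + (1 - t))\<^sup>2)" for t \<theta>
  have dpos: "norm (1 - cnj (\<alpha> j) * cis \<theta>) > 0" if "j \<in> {1..n}" for j \<theta>
    using radial_denominator(1)[OF \<alpha>[OF that], of 0] by simp
  have gh: "g t \<theta> \<le> h \<theta> t" if t: "t \<in> {1/4..1}" for t \<theta>
  proof -
    let ?z = "of_real (sqrt t) * cis \<theta>"
    let ?A = "\<Sum>j=1..n. norm (phi_deriv2 (\<alpha> j) ?z)"
    have A: "?A \<le> (\<Sum>j=1..n. 64 * (1 - (norm (\<alpha> j))\<^sup>2) / norm (1 - cnj (\<alpha> j) * cis \<theta>) *
      (1 / (norm (1 - cnj (\<alpha> j) * cis \<theta>) + (1 - t))\<^sup>2))"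
      using t by (intro sum_mono norm_phi_deriv2_radial \<alpha>) auto
    have A0: "?A \<ge> 0" by (intro sum_nonneg) auto
    have gb: "g t \<theta> = norm (bprod_deriv2 \<alpha> n ?z)"
      unfolding g_def using ddf[OF inR, of t \<theta>] t c by (simp add: norm_mult)
    \<comment> \<open>what the terms with a twice differentiated factor do not account for\<close>
    define X where "X = g t \<theta> - ?A"
    have "X \<le> 128 * (1 / (1 / S \<theta> + (1 - t))\<^sup>2)"
    proof (rule min_square_le)
      show "X \<le> 16 * (S \<theta>)\<^sup>2"
      proof -
        have le: "g t \<theta> \<le> ?A + (\<Sum>j=1..n. poisson (\<alpha> j) ?z)\<^sup>2"
          unfolding gb using t by (intro norm_bprod_deriv_le \<alpha>) (auto simp: norm_mult)
        have "(\<Sum>j=1..n. poisson (\<alpha> j) ?z) \<le> (\<Sum>j=1..n. 4 * poisson (\<alpha> j) (cis \<theta>))"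
          using t by (intro sum_mono poisson_radial \<alpha>) auto
        also have "\<dots> = 4 * S \<theta>"
          by (simp add: S_def sum_distrib_left)
        finally have "(\<Sum>j=1..n. poisson (\<alpha> j) ?z)\<^sup>2 \<le> (4 * S \<theta>)\<^sup>2"
          by (intro power_mono sum_nonneg poisson_nonneg) (use \<alpha> in \<open>auto intro: less_imp_le\<close>)
        then show ?thesis
          using le by (simp add: X_def power_mult_distrib)
      qed
      show "X \<le> 32 / (1 - t)\<^sup>2" if "1 - t > 0"
      proof -
        define s where "s = sqrt t"
        have s: "0 \<le> s" "s < 1" "s * s = t"
          using t that by (auto simp: s_def)
        \<comment> \<open>Half the distance to the circle. Cauchy's estimate gives
          \<open>2 * 4 / (1 - s)^2\<close>, and \<open>1 - t \<le> 2 * (1 - s)\<close> turns this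
          into \<open>32 / (1 - t)^2\<close>.\<close>
        let ?q = "(1 - s) / 2"
        have sub: "cball ?z ?q \<subseteq> unit_disc"
        proof
          fix v assume "v \<in> cball ?z ?q"
          then have "norm (v - ?z) \<le> ?q" by (simp add: dist_norm norm_minus_commute)
          moreover have "norm v \<le> norm ?z + norm (v - ?z)"
            using norm_triangle_ineq[of ?z "v - ?z"] by simp
          moreover have "norm ?z = s"
            using s by (simp add: norm_mult s_def)
          ultimately have "norm v \<le> s + ?q" by linarith
          moreover have "s + ?q < 1"
            using s(2) by (simp add: field_simps)
          ultimately have "norm v < 1"
            by (rule le_less_trans)
          then show "v \<in> unit_disc"
            by simp
        qed
        have "unit_disc \<subseteq> ball 0 R" using R by auto
        then have hol: "f holomorphic_on cball ?z ?q"
          using f sub holomorphic_on_subset by blast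
        have "norm ((deriv ^^ 2) f ?z) \<le> fact 2 * 1 / ?q ^ 2"
        proof (rule Cauchy_inequality)
          show "f holomorphic_on ball ?z ?q" "continuous_on (cball ?z ?q) f"
            using hol by (auto intro: holomorphic_on_imp_continuous_on elim: holomorphic_on_subset)
          show "norm (f x) \<le> 1" if "norm (?z - x) = ?q" for x
            using sub that by (intro f1) (auto simp: subset_iff dist_norm)
        qed (use s in auto)
        then have "g t \<theta> \<le> 8 / (1 - s)\<^sup>2"
          by (simp add: g_def numeral_2_eq_2 power_divide)
        also have "\<dots> \<le> 8 / ((1 - t) / 2)\<^sup>2"
        proof -
          have "(1 - s) * (1 + s) \<le> (1 - s) * 2"
            using s by (intro mult_left_mono) auto
          then have "1 - t \<le> 2 * (1 - s)"
            using s(3) by (simp add: algebra_simps)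
          then have "(1 - t) / 2 \<le> 1 - s"
            by simp
          then show ?thesis
            using that s by (intro divide_left_mono power_mono) (auto intro!: mult_pos_pos)
        qed
        finally show ?thesis
          using A0 by (simp add: X_def power_divide)
      qed
    qed (use S0 t in auto)
    then show ?thesis
      using A by (simp add: X_def h_def)
  qed
  have inth: "(h \<theta>) integrable_on {1/4..1}" "integral {1/4..1} (h \<theta>) \<le> 192 * S \<theta>" for \<theta>
  proof -
    have s: "1 / S \<theta> > 0" using S0 by simp
    have 1: "(\<lambda>t. 64 * (1 - (norm (\<alpha> j))\<^sup>2) / norm (1 - cnj (\<alpha> j) * cis \<theta>) *
      (1 / (norm (1 - cnj (\<alpha> j) * cis \<theta>) + (1 - t))\<^sup>2)) integrable_on {1/4..1}" if "j \<in> {1..n}" for j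
      by (intro integrable_on_mult_right integral_inverse_square_le dpos that)
    have 2: "(\<lambda>t. 128 * (1 / (1 / S \<theta> + (1 - t))\<^sup>2)) integrable_on {1/4..1}"
      by (intro integrable_on_mult_right integral_inverse_square_le s)
    have cpos: "0 \<le> 64 * (1 - (norm (\<alpha> j))\<^sup>2) / norm (1 - cnj (\<alpha> j) * cis \<theta>)" if "j \<in> {1..n}" for j
      using \<alpha>[OF that] by (intro divide_nonneg_nonneg mult_nonneg_nonneg) (auto simp: abs_square_le_1)
    show "(h \<theta>) integrable_on {1/4..1}"
      unfolding h_def by (intro integrable_add integrable_sum 1 2) auto
    have "integral {1/4..1} (h \<theta>) = (\<Sum>j=1..n. 64 * (1 - (norm (\<alpha> j))\<^sup>2) / norm (1 - cnj (\<alpha> j) * cis \<theta>) *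
       integral {1/4..1} (\<lambda>t. 1 / (norm (1 - cnj (\<alpha> j) * cis \<theta>) + (1 - t))\<^sup>2)) +
       128 * integral {1/4..1} (\<lambda>t. 1 / (1 / S \<theta> + (1 - t))\<^sup>2)"
      unfolding h_def using 1 2
      by (simp only: Henstock_Kurzweil_Integration.integral_add integrable_sum finite_atLeastAtMost
          Henstock_Kurzweil_Integration.integral_sum integral_mult_right cong: sum.cong)
    also have "\<dots> \<le> (\<Sum>j=1..n. 64 * (1 - (norm (\<alpha> j))\<^sup>2) / norm (1 - cnj (\<alpha> j) * cis \<theta>) *
       (1 / norm (1 - cnj (\<alpha> j) * cis \<theta>))) + 128 * (1 / (1 / S \<theta>))"
      by (intro add_mono sum_mono mult_left_mono integral_inverse_square_le dpos s cpos) auto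
    also have "\<dots> = 64 * S \<theta> + 128 * S \<theta>"
      unfolding S_def by (simp add: poisson_def power2_eq_square sum_distrib_left)
    finally show "integral {1/4..1} (h \<theta>) \<le> 192 * S \<theta>" by simp
  qed
  have contg1: "continuous_on {1/4..1} (\<lambda>t. g t \<theta>)" for \<theta>
    unfolding g_def
    by (intro continuous_intros continuous_on_compose2[OF holomorphic_on_imp_continuous_on[OF hol2]])
       (use inR in auto)
  have Sint: "(S has_integral (real n * (2 * pi))) {0..2*pi}"
  proof -
    have "(S has_integral (\<Sum>j=1..n. 2 * pi)) {0..2*pi}"
      unfolding S_def by (intro has_integral_sum poisson_has_integral \<alpha>) auto
    then show ?thesis by simp
  qed
  have contg2: "continuous_on {0..2*pi} (\<lambda>\<theta>. integral {1/4..1} (\<lambda>t. g t \<theta>))"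
  proof -
    have "continuous_on ({0..2*pi} \<times> {1/4..1}) (\<lambda>(\<theta>, t). g t \<theta>)"
      unfolding g_def case_prod_beta
      by (intro continuous_intros continuous_on_compose2[OF holomorphic_on_imp_continuous_on[OF hol2]])
         (use inR in auto)
    then show ?thesis
      using integral_continuous_on_param[of "{0..2*pi}" "1/4" 1 "\<lambda>\<theta> t. g t \<theta>"] by simp
  qed
  have "integral {1/4..1} (\<lambda>t. integral {0..2*pi} (g t)) = integral {0..2*pi} (\<lambda>\<theta>. integral {1/4..1} (\<lambda>t. g t \<theta>))"
    using integral_swap_continuous[of "1/4" 0 1 "2*pi" g] contg by (simp add: cbox_Pair_eq)
  also have "\<dots> \<le> integral {0..2*pi} (\<lambda>\<theta>. 192 * S \<theta>)"
  proof (rule integral_le)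
    show "(\<lambda>\<theta>. 192 * S \<theta>) integrable_on {0..2*pi}"
      using Sint by (intro integrable_on_mult_right) auto
    fix \<theta> :: real
    have "integral {1/4..1} (\<lambda>t. g t \<theta>) \<le> integral {1/4..1} (h \<theta>)"
      by (intro integral_le integrable_continuous_real contg1 inth gh)
    then show "integral {1/4..1} (\<lambda>t. g t \<theta>) \<le> 192 * S \<theta>"
      using inth(2)[of \<theta>] by linarith
  qed (intro integrable_continuous_real contg2)
  also have "\<dots> = 192 * (real n * (2 * pi))"
    using Sint by (simp add: integral_unique)
  finally have "atomic phi_atoms (70 + 11 * (192 * (real n * (2 * pi)))) f"
    unfolding g_def by (intro atomic_if_integral_second_deriv_le[OF R f f1]) auto
  then have "atomic phi_atoms ((70 + 4224 * pi) * real n) f"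
    by (rule atomic_mono) (use n in \<open>simp add: algebra_simps\<close>)
  then show ?thesis
    by (simp add: f_def[abs_def])
qed

section \<open>Composition with a Blaschke product\<close>

text \<open>The identity behind the Schwarz-Pick lemma, cleared of denominators. It holds for all
  \<open>a\<close> and \<open>z\<close>, so the sign of the right side compares numerator and
  denominator of \<open>phi a\<close> inside, on and outside the circle.\<close>

lemma norm_phi_identity:
  "(norm (1 - cnj a * z))\<^sup>2 - (norm (a - z))\<^sup>2 = (1 - (norm a)\<^sup>2) * (1 - (norm z)\<^sup>2)"
proof -
  have "((1 - (a * x + b * y))\<^sup>2 + (b * x - a * y)\<^sup>2) - ((a - x)\<^sup>2 + (b - y)\<^sup>2) = (1 - (a\<^sup>2 + b\<^sup>2)) * (1 - (x\<^sup>2 + y\<^sup>2))"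
    for a b x y :: real
    by (simp add: power2_eq_square algebra_simps)
  from this[of "Re a" "Re z" "Im a" "Im z"] show ?thesis
    by (simp add: cmod_power2)
qed

lemma norm_phi_factors:
  assumes "norm a < 1"
  shows "norm z < 1 \<Longrightarrow> norm (a - z) < norm (1 - cnj a * z)"
    and "norm z = 1 \<Longrightarrow> norm (a - z) = norm (1 - cnj a * z)"
    and "norm z > 1 \<Longrightarrow> norm (1 - cnj a * z) < norm (a - z)"
proof -
  have p: "0 < 1 - (norm a)\<^sup>2"
    using assms by (simp add: abs_square_less_1)
  show "norm (a - z) < norm (1 - cnj a * z)" if "norm z < 1"
  proof (rule power2_less_imp_less)
    have "0 < (1 - (norm a)\<^sup>2) * (1 - (norm z)\<^sup>2)"
      using p that by (intro mult_pos_pos) (auto simp: abs_square_less_1)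
    then show "(norm (a - z))\<^sup>2 < (norm (1 - cnj a * z))\<^sup>2"
      using norm_phi_identity[of a z] by linarith
  qed simp
  show "norm (a - z) = norm (1 - cnj a * z)" if "norm z = 1"
    using norm_phi_identity[of a z] that by (simp add: power2_eq_iff_nonneg)
  show "norm (1 - cnj a * z) < norm (a - z)" if "norm z > 1"
  proof (rule power2_less_imp_less)
    have "(1 - (norm a)\<^sup>2) * (1 - (norm z)\<^sup>2) < 0"
      using p that one_less_power[of "norm z" 2] by (intro mult_pos_neg) auto
    then show "(norm (1 - cnj a * z))\<^sup>2 < (norm (a - z))\<^sup>2"
      using norm_phi_identity[of a z] by linarith
  qed simp
qed

section \<open>Numerator and denominator polynomials of a Blaschke product\<close>

lemma degree_prod_linear_le:
  fixes a b :: "nat \<Rightarrow> 'a::idom"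
  shows "degree (\<Prod>j=1..n. [:a j, b j:]) \<le> n"
proof -
  have "degree (\<Prod>j=1..n. [:a j, b j:]) \<le> (\<Sum>j=1..n. degree [:a j, b j:])"
    using degree_prod_sum_le[of "{1..n}" "\<lambda>j. [:a j, b j:]"] by (simp add: o_def)
  also have "\<dots> \<le> (\<Sum>j=1..n. 1)"
    by (intro sum_mono) simp
  finally show ?thesis by simp
qed

lemma coeff_prod_linear:
  fixes a b :: "nat \<Rightarrow> 'a::idom"
  shows "coeff (\<Prod>j=1..n. [:a j, b j:]) n = (\<Prod>j=1..n. b j)"
proof (induction n)
  case (Suc n)
  have "coeff (\<Prod>j=1..n. [:a j, b j:]) (Suc n) = 0"
    using degree_prod_linear_le[of a b n] by (intro coeff_eq_0) simp
  with Suc show ?case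
    by (simp add: mult.commute)
qed simp

locale blaschke_data =
  fixes n :: nat and c :: complex and \<alpha> :: "nat \<Rightarrow> complex"
  assumes n: "n \<ge> 1" and c: "norm c = 1" and \<alpha>: "\<And>j. j \<in> {1..n} \<Longrightarrow> norm (\<alpha> j) < 1"
begin

definition P :: "complex poly" where "P = (\<Prod>j=1..n. [:\<alpha> j, -1:])"
definition Q :: "complex poly" where "Q = (\<Prod>j=1..n. [:1, - cnj (\<alpha> j):])"
definition b :: "complex \<Rightarrow> complex" where "b z = c * (\<Prod>j=1..n. phi (\<alpha> j) z)"

lemma poly_P: "poly P z = (\<Prod>j=1..n. \<alpha> j - z)" and poly_Q: "poly Q z = (\<Prod>j=1..n. 1 - cnj (\<alpha> j) * z)"
  by (simp_all add: P_def Q_def poly_prod mult.commute)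

lemma b_eq: "b z = c * poly P z / poly Q z"
  by (simp add: b_def phi_def poly_P poly_Q prod_dividef)

lemma norm_P_Q:
  shows "norm z < 1 \<Longrightarrow> norm (poly P z) < norm (poly Q z)"
    and "norm z = 1 \<Longrightarrow> norm (poly P z) = norm (poly Q z)"
    and "norm z > 1 \<Longrightarrow> norm (poly Q z) < norm (poly P z)"
proof -
  show "norm (poly P z) < norm (poly Q z)" if "norm z < 1"
    unfolding poly_P poly_Q prod_norm[symmetric]
    by (rule prod_mono_strict[of n])
       (use n norm_phi_factors(1)[OF \<alpha> that] le_less_trans[OF norm_ge_zero norm_phi_factors(1)[OF \<alpha> that]]
         in \<open>auto intro: less_imp_le\<close>)
  show "norm (poly P z) = norm (poly Q z)" if "norm z = 1"
    unfolding poly_P poly_Q prod_norm[symmetric] using norm_phi_factors(2)[OF \<alpha> that] by simp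
  show "norm (poly Q z) < norm (poly P z)" if "norm z > 1"
    unfolding poly_P poly_Q prod_norm[symmetric]
    by (rule prod_mono_strict[of n])
       (use n norm_phi_factors(3)[OF \<alpha> that] le_less_trans[OF norm_ge_zero norm_phi_factors(3)[OF \<alpha> that]]
         in \<open>auto intro: less_imp_le\<close>)
qed

lemma Q_nz: "norm z \<le> 1 \<Longrightarrow> poly Q z \<noteq> 0"
  using \<alpha> one_minus_cnj_mult_nz[of "cnj z" "cnj (\<alpha> _)"] by (auto simp: poly_Q mult.commute)

lemma norm_b_less_1: "norm z < 1 \<Longrightarrow> norm (b z) < 1"
  using norm_P_Q(1)[of z] Q_nz[of z] c by (simp add: b_eq norm_mult norm_divide)

text \<open>Up to sign and conjugation the product is \<open>b 0 / c\<close>, and \<open>b\<close>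
  maps the disc into itself.\<close>

lemma norm_prod_less_1: "norm (\<Prod>j=1..n. - cnj (\<alpha> j)) < 1"
proof -
  have "norm (b 0) < 1"
    by (rule norm_b_less_1) simp
  then show ?thesis
    using c by (simp add: b_def phi_def norm_mult prod_norm[symmetric])
qed

text \<open>The polynomial is the numerator of \<open>\<beta> - b\<close>. No degree is lost,
  because the top coefficients coming from \<open>Q\<close> and \<open>P\<close> have different
  moduli. Interior \<open>\<beta>\<close> occur in the composition with an atom, and
  \<open>\<beta> = 1\<close> in the count of the solutions of \<open>b = 1\<close>.\<close>

lemma coeff_num_nz:
  assumes "norm \<beta> \<le> 1"
  shows "coeff (smult \<beta> Q - smult c P) n \<noteq> 0" and "degree (smult \<beta> Q - smult c P) = n"
proof -
  have "norm (\<beta> * (\<Prod>j=1..n. - cnj (\<alpha> j))) < norm (c * (\<Prod>j=1..n. - 1))"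
    using norm_prod_less_1 assms c mult_right_mono[OF assms, of "norm (\<Prod>j=1..n. - cnj (\<alpha> j))"]
    by (simp add: norm_mult norm_power)
  then show nz: "coeff (smult \<beta> Q - smult c P) n \<noteq> 0"
    unfolding P_def Q_def coeff_diff coeff_smult coeff_prod_linear by auto
  have "degree (smult \<beta> Q - smult c P) \<le> n"
    unfolding P_def Q_def
    by (intro degree_diff_le order_trans[OF degree_smult_le] degree_prod_linear_le)
  then show "degree (smult \<beta> Q - smult c P) = n"
    using le_degree[OF nz] by simp
qed

text \<open>The denominator of \<open>phi \<beta> \<circ> b\<close> is the reflection of the numerator across the circle, so both
  are determined by the zeros of the numerator.\<close>
lemma phi_b_blaschke:
  assumes \<beta>: "norm \<beta> < 1"
  obtains c' \<alpha>' where "norm c' = 1" "\<And>j. j \<in> {1..n} \<Longrightarrow> norm (\<alpha>' j) < 1"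
    "\<And>z. z \<in> unit_disc \<Longrightarrow> phi \<beta> (b z) = c' * (\<Prod>j=1..n. phi (\<alpha>' j) z)"
proof -
  define N where "N = smult \<beta> Q - smult c P"
  define L where "L = coeff N n"
  have L: "L \<noteq> 0" and dN: "degree N = n"
    using coeff_num_nz[of \<beta>] \<beta> by (auto simp: L_def N_def)
  obtain root where root: "smult (lead_coeff N) (\<Prod>i<degree N. [:- root i, 1:]) = N"
    by (rule complex_poly_decompose')
  have N: "poly N z = L * (\<Prod>i<n. z - root i)" for z
    by (subst root[symmetric]) (simp add: dN L_def poly_prod)
  \<comment> \<open>A root is a point where \<open>b\<close> would take the value
    \<open>\<beta>\<close>, while \<open>|b| \<ge> 1\<close> on and outside the circle. The argument
    compares \<open>P\<close> with \<open>Q\<close> directly, since \<open>Q\<close> may vanish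
    outside the disc.\<close>
  have r1: "norm (root i) < 1" if "i < n" for i
  proof (rule ccontr)
    assume "\<not> norm (root i) < 1"
    then have w: "norm (root i) \<ge> 1" by simp
    then have le: "norm (poly Q (root i)) \<le> norm (poly P (root i))"
      using norm_P_Q(2,3)[of "root i"] by (cases "norm (root i) = 1") auto
    have P0: "poly P (root i) \<noteq> 0"
      using \<alpha> w by (force simp: poly_P)
    have "poly N (root i) = 0"
      using that by (auto simp: N)
    then have "norm (\<beta> * poly Q (root i)) = norm (c * poly P (root i))"
      by (simp add: N_def)
    then have "norm (poly P (root i)) = norm \<beta> * norm (poly Q (root i))"
      using c by (simp add: norm_mult)
    also have "\<dots> \<le> norm \<beta> * norm (poly P (root i))"
      by (intro mult_left_mono le) auto
    also have "\<dots> < 1 * norm (poly P (root i))"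
      using \<beta> P0 by (intro mult_strict_right_mono) auto
    finally show False by simp
  qed
  \<comment> \<open>For \<open>z \<noteq> 0\<close>, evaluation at \<open>1 / cnj z\<close>,
    conjugation and multiplication by \<open>z ^ n\<close> exchange \<open>P\<close> and
    \<open>Q\<close> up to \<open>(-1) ^ n\<close>, and turn each factor \<open>z - root i\<close>
    into \<open>1 - cnj (root i) * z\<close>. The point 0 follows by continuity.\<close>
  have refl: "poly Q z - cnj \<beta> * c * poly P z = - ((-1) ^ n * c * cnj L) * (\<Prod>i<n. 1 - cnj (root i) * z)" for z
  proof -
    have nz: "poly Q z - cnj \<beta> * c * poly P z = - ((-1) ^ n * c * cnj L) * (\<Prod>i<n. 1 - cnj (root i) * z)" if z: "z \<noteq> 0" for z
    proof -
      have 1: "z ^ n * cnj (poly P (1 / cnj z)) = (-1) ^ n * poly Q z"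
      proof -
        have "z ^ n * cnj (poly P (1 / cnj z)) = (\<Prod>j=1..n. z * (cnj (\<alpha> j) - 1 / z))"
          by (simp add: poly_P prod.distrib)
        also have "\<dots> = (\<Prod>j=1..n. (-1) * (1 - cnj (\<alpha> j) * z))"
          using z by (intro prod.cong) (auto simp: field_simps)
        also have "\<dots> = (-1) ^ n * poly Q z"
          by (simp only: poly_Q prod.distrib) simp
        finally show ?thesis .
      qed
      have 2: "z ^ n * cnj (poly Q (1 / cnj z)) = (-1) ^ n * poly P z"
      proof -
        have "z ^ n * cnj (poly Q (1 / cnj z)) = (\<Prod>j=1..n. z * (1 - \<alpha> j * (1 / z)))"
          by (simp add: poly_Q prod.distrib)
        also have "\<dots> = (\<Prod>j=1..n. (-1) * (\<alpha> j - z))"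
          using z by (intro prod.cong) (auto simp: field_simps)
        also have "\<dots> = (-1) ^ n * poly P z"
          by (simp only: poly_P prod.distrib) simp
        finally show ?thesis .
      qed
      have 3: "z ^ n * cnj (poly N (1 / cnj z)) = cnj L * (\<Prod>i<n. 1 - cnj (root i) * z)"
      proof -
        have "z ^ n * cnj (poly N (1 / cnj z)) = cnj L * (\<Prod>i<n. z * (1 / z - cnj (root i)))"
          by (simp add: N prod.distrib)
        also have "(\<Prod>i<n. z * (1 / z - cnj (root i))) = (\<Prod>i<n. 1 - cnj (root i) * z)"
          using z by (intro prod.cong) (auto simp: field_simps)
        finally show ?thesis .
      qed
      have cc: "c * cnj c = 1"
        using complex_norm_square[of c] c by simp
      have "z ^ n * cnj (poly N (1 / cnj z)) = cnj \<beta> * (z ^ n * cnj (poly Q (1 / cnj z))) - cnj c * (z ^ n * cnj (poly P (1 / cnj z)))"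
        by (simp add: N_def algebra_simps)
      also have "\<dots> = (-1) ^ n * (cnj \<beta> * poly P z - cnj c * poly Q z)"
        unfolding 1 2 by (simp add: algebra_simps)
      finally have X: "cnj L * (\<Prod>i<n. 1 - cnj (root i) * z) = (-1) ^ n * (cnj \<beta> * poly P z - cnj c * poly Q z)"
        unfolding 3 .
      have "- (e * c) * X = Q' - B' * c * P'" if "X = e * (B' * P' - C' * Q')" "e * e = 1" "c * C' = 1" for e X Q' B' P' C'
        using that by algebra
      from this[OF X _ cc] show ?thesis
        by (simp add: mult.assoc flip: power_add)
    qed
    show ?thesis
    proof (cases "z = 0")
      case True
      have lim: "((\<lambda>z. poly Q z - cnj \<beta> * c * poly P z) \<longlongrightarrow> poly Q 0 - cnj \<beta> * c * poly P 0) (at 0)"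
        by (intro tendsto_intros isContD poly_isCont)
      have "((\<lambda>z. - ((-1) ^ n * c * cnj L) * (\<Prod>i<n. 1 - cnj (root i) * z)) \<longlongrightarrow>
          - ((-1) ^ n * c * cnj L) * (\<Prod>i<n. 1 - cnj (root i) * 0)) (at 0)"
        by (intro tendsto_intros)
      moreover have "\<forall>\<^sub>F z in at 0. poly Q z - cnj \<beta> * c * poly P z = - ((-1) ^ n * c * cnj L) * (\<Prod>i<n. 1 - cnj (root i) * z)"
        using nz by (auto simp: eventually_at_filter)
      ultimately have "((\<lambda>z. poly Q z - cnj \<beta> * c * poly P z) \<longlongrightarrow>
          - ((-1) ^ n * c * cnj L) * (\<Prod>i<n. 1 - cnj (root i) * 0)) (at 0)"
        by (subst tendsto_cong)
      with lim show ?thesis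
        unfolding True by (rule tendsto_unique[OF at_neq_bot])
    qed (rule nz)
  qed
  show ?thesis
  \<comment> \<open>The constant is unimodular because \<open>L\<close> and \<open>cnj L\<close>
    have equal modulus. The roots are numbered from 0, the factors of a Blaschke product from
    1.\<close>
  proof (rule that[of "- L / (c * cnj L)" "\<lambda>j. root (j - 1)"])
    show "norm (- L / (c * cnj L)) = 1"
      using L c by (simp add: norm_divide norm_mult)
    show "norm (root (j - 1)) < 1" if "j \<in> {1..n}" for j
      using that by (intro r1) auto
    fix z :: complex assume z: "z \<in> unit_disc"
    have Qz: "poly Q z \<noteq> 0" using Q_nz z by simp
    have shift: "(\<Prod>j=1..n. phi (root (j - 1)) z) = (\<Prod>i<n. phi (root i) z)"
      by (rule prod.reindex_bij_witness[of _ Suc "\<lambda>j. j - 1"]) auto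
    have "phi \<beta> (b z) = poly N z / (poly Q z - cnj \<beta> * c * poly P z)"
    proof -
      have "phi \<beta> (b z) = (\<beta> - c * poly P z / poly Q z) / (1 - cnj \<beta> * (c * poly P z / poly Q z))"
        by (simp add: phi_def b_eq)
      also have "\<dots> = ((\<beta> * poly Q z - c * poly P z) / poly Q z) / ((poly Q z - cnj \<beta> * c * poly P z) / poly Q z)"
        using Qz by (simp add: diff_divide_distrib mult.assoc)
      also have "\<dots> = poly N z / (poly Q z - cnj \<beta> * c * poly P z)"
        using Qz by (simp add: N_def)
      finally show ?thesis .
    qed
    also have "\<dots> = L * (\<Prod>i<n. (-1) * (root i - z)) / (- ((-1) ^ n * c * cnj L) * (\<Prod>i<n. 1 - cnj (root i) * z))"
      unfolding N refl by simp
    also have "\<dots> = - L / (c * cnj L) * ((\<Prod>i<n. root i - z) / (\<Prod>i<n. 1 - cnj (root i) * z))"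
      unfolding prod.distrib by simp
    also have "\<dots> = - L / (c * cnj L) * (\<Prod>j=1..n. phi (root (j - 1)) z)"
      by (simp only: shift) (simp only: phi_def prod_dividef)
    finally show "phi \<beta> (b z) = - L / (c * cnj L) * (\<Prod>j=1..n. phi (root (j - 1)) z)" .
  qed
qed

text \<open>An atom with \<open>|\<beta>| = 1\<close> is a constant, so only the interior
  \<open>\<beta>\<close> lead to Blaschke products.\<close>

lemma atomic_phi_b:
  assumes "u \<in> phi_atoms"
  shows "atomic phi_atoms ((70 + 4224 * pi) * real n) (\<lambda>z. u (b z))"
proof -
  obtain \<beta> where u: "u = phi \<beta>" "norm \<beta> \<le> 1"
    using assms by (auto simp: phi_atoms_def)
  show ?thesis
  proof (cases "norm \<beta> = 1")
    case True
    have "\<beta> = u (b z)" if "z \<in> unit_disc" for z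
    proof -
      have "1 - cnj \<beta> * b z \<noteq> 0"
        using that u norm_b_less_1 by (intro one_minus_cnj_mult_nz) auto
      moreover have "\<beta> * cnj \<beta> = 1"
        using complex_norm_square[of \<beta>] True by simp
      then have "\<beta> * (1 - cnj \<beta> * b z) = \<beta> - b z"
        by (simp add: right_diff_distrib flip: mult.assoc)
      ultimately show ?thesis
        by (simp add: u phi_def eq_divide_eq)
    qed
    moreover have "atomic phi_atoms ((70 + 4224 * pi) * real n) (\<lambda>_. \<beta>)"
    proof (rule atomic_mono[OF atomic_const])
      have "1 * 1 \<le> (70 + 4224 * pi) * real n"
        using n by (intro mult_mono) auto
      then show "norm \<beta> \<le> (70 + 4224 * pi) * real n"
        using True by simp
    qed
    ultimately show ?thesis
      by (auto elim!: atomic_cong)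
  next
    case False
    then have "norm \<beta> < 1" using u by simp
    then obtain c' \<alpha>' where "norm c' = 1" "\<And>j. j \<in> {1..n} \<Longrightarrow> norm (\<alpha>' j) < 1"
      "\<And>z. z \<in> unit_disc \<Longrightarrow> phi \<beta> (b z) = c' * (\<Prod>j=1..n. phi (\<alpha>' j) z)"
      using phi_b_blaschke by blast
    then show ?thesis
      using atomic_blaschke[OF n, of c' \<alpha>'] by (auto simp: u elim!: atomic_cong)
  qed
qed

lemma atomic_compose_b:
  assumes "atomic phi_atoms s f"
  shows "atomic phi_atoms ((70 + 4224 * pi) * real n * s) (\<lambda>z. f (b z))"
proof -
  have "atomic ((\<lambda>u z. u (b z)) ` phi_atoms) s (\<lambda>z. f (b z))"
  proof -
    obtain u l where u: "\<And>k. u k \<in> phi_atoms" and s: "summable (\<lambda>k. norm (l k))" "(\<Sum>k. norm (l k)) \<le> s"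
      and f: "\<And>z. z \<in> unit_disc \<Longrightarrow> (\<lambda>k. l k * u k z) sums f z"
      using assms unfolding atomic_def by blast
    show ?thesis
      unfolding atomic_def
      by (intro exI[of _ "\<lambda>k z. u k (b z)"] exI[of _ l]) (use u s f norm_b_less_1 in auto)
  qed
  then show ?thesis
    by (rule atomic_trans[OF disc_bounded_phi_atoms]) (use atomic_phi_b in auto)
qed

end

section \<open>The composition operator on the minimal space\<close>

lemma blaschke_productE:
  assumes "blaschke_product n B" "n \<ge> 1"
  obtains c \<alpha> where "blaschke_data n c \<alpha>" "\<And>z. z \<in> unit_disc \<Longrightarrow> B z = blaschke_data.b n c \<alpha> z"
proof -
  obtain c \<alpha> where *: "norm c = 1" "\<forall>j\<in>{1..n}. \<alpha> j \<in> unit_disc" "\<forall>z\<in>unit_disc. B z = c * (\<Prod>j=1..n. phi (\<alpha> j) z)"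
    using assms unfolding blaschke_product_def by blast
  then have "blaschke_data n c \<alpha>"
    using assms(2) by unfold_locales auto
  with * show ?thesis
    by (intro that) (auto simp: blaschke_data.b_def)
qed

lemma composition_operator_blaschke:
  assumes B: "blaschke_product n B" and n: "n \<ge> 1"
  shows "f \<in> minimal_space \<Longrightarrow> on_disc (f \<circ> B) \<in> minimal_space"
    and "z \<in> unit_disc \<Longrightarrow> fun_of (composition_operator B F) z = fun_of F (B z)"
    and "norm (composition_operator B F) \<le> (70 + 4224 * pi) * real n * norm F"
    and "bounded_linear (composition_operator B)"
    and "z \<in> unit_disc \<Longrightarrow> B z \<in> unit_disc"
proof -
  obtain c \<alpha> where data: "blaschke_data n c \<alpha>" and B_eq: "\<And>z. z \<in> unit_disc \<Longrightarrow> B z = blaschke_data.b n c \<alpha> z"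
    using blaschke_productE[OF B n] by blast
  interpret blaschke_data n c \<alpha> by (rule data)
  have at: "atomic phi_atoms ((70 + 4224 * pi) * real n * s) (f \<circ> B)" if "atomic phi_atoms s f" for f s
    by (rule atomic_cong[OF atomic_compose_b[OF that]]) (simp add: B_eq)
  show "on_disc (f \<circ> B) \<in> minimal_space" if "f \<in> minimal_space" for f
    using atomic_on_disc(1)[OF at[OF minimal_space_atomic[OF that, of "minimal_norm f + 1"]]] by simp
  show Bz: "B z \<in> unit_disc" if "z \<in> unit_disc" for z
    using norm_b_less_1[of z] that by (simp add: B_eq)
  have comp: "composition_operator B F = minimal_of (fun_of F \<circ> B)" for F
    by (simp add: composition_operator_def minimal_of_def)
  show ev: "fun_of (composition_operator B F) z = fun_of F (B z)" if "z \<in> unit_disc" for F z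
    unfolding comp fun_of_minimal_of[OF at[OF atomic_fun_of[of F "norm F + 1"], simplified]]
    using that by (simp add: on_disc_def)
  show bd: "norm (composition_operator B F) \<le> (70 + 4224 * pi) * real n * norm F" for F
  proof (rule field_le_epsilon)
    fix e :: real assume "e > 0"
    define K where "K = (70 + 4224 * pi) * real n"
    have K: "K > 0" using n by (auto simp: K_def intro!: mult_pos_pos add_pos_pos)
    \<comment> \<open>A representation of \<open>F\<close> may cost slightly more than
      \<open>norm F\<close>; the excess is chosen so that multiplication by \<open>K\<close> turns
      it into \<open>e\<close>.\<close>
    have "norm (composition_operator B F) \<le> K * (norm F + e / K)"
      unfolding comp K_def[symmetric]
      by (rule norm_minimal_of, unfold K_def, rule at, rule atomic_fun_of)
         (use \<open>e > 0\<close> K in \<open>simp add: K_def[symmetric]\<close>)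
    also have "\<dots> = K * norm F + e"
      using K by (simp add: algebra_simps)
    finally show "norm (composition_operator B F) \<le> (70 + 4224 * pi) * real n * norm F + e"
      by (simp add: K_def)
  qed
  show "bounded_linear (composition_operator B)"
  proof (rule bounded_linear_intro[where K = "(70 + 4224 * pi) * real n"])
    show "composition_operator B (F + G) = composition_operator B F + composition_operator B G" for F G
      by (rule minimal_eqI) (simp add: ev plus_minimal.rep_eq)
    show "composition_operator B (r *\<^sub>R F) = r *\<^sub>R composition_operator B F" for r F
      by (rule minimal_eqI) (simp add: ev scaleR_minimal.rep_eq)
    show "norm (composition_operator B F) \<le> norm F * ((70 + 4224 * pi) * real n)" for F
      using bd[of F] by (simp add: mult.commute)
  qed
qed

section \<open>Functionals concentrated at the boundary\<close>

lemma atomic_deriv_sums: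
  assumes bd: "disc_bounded A" and hol: "\<And>u. u \<in> A \<Longrightarrow> u holomorphic_on unit_disc"
    and u: "\<And>k. u k \<in> A" and l: "summable (\<lambda>k. norm (l k))"
    and f: "\<And>z. z \<in> unit_disc \<Longrightarrow> (\<lambda>k. l k * u k z) sums f z" and z: "z \<in> unit_disc"
  shows "(\<lambda>k. l k * deriv (u k) z) sums deriv f z"
proof -
  have ul: "uniform_limit unit_disc (\<lambda>n z. \<Sum>k<n. l k * u k z) f sequentially"
    by (rule atomic_uniform_limit[OF bd u l f])
  have "(\<lambda>n. (deriv ^^ 1) (\<lambda>z. \<Sum>k<n. l k * u k z) z) \<longlonglongrightarrow> (deriv ^^ 1) f z"
  proof (rule higher_deriv_complex_uniform_limit[OF ul])
    show "\<forall>\<^sub>F n in sequentially. (\<lambda>z. \<Sum>k<n. l k * u k z) holomorphic_on unit_disc"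
      by (intro always_eventually allI holomorphic_intros) (rule hol[OF u])
  qed (use z in auto)
  moreover have "deriv (\<lambda>z. \<Sum>k<n. l k * u k z) z = (\<Sum>k<n. l k * deriv (u k) z)" for n
    by (rule DERIV_imp_deriv, intro DERIV_sum DERIV_cmult holomorphic_derivI[OF hol[OF u] open_ball z])
  ultimately show ?thesis
    by (simp add: sums_def)
qed

lemma holomorphic_fun_of: "fun_of F holomorphic_on unit_disc"
  using fun_of[of F] by (simp add: minimal_space_def analytic_on_open)

lemma deriv_phi: "norm a \<le> 1 \<Longrightarrow> z \<in> unit_disc \<Longrightarrow> deriv (phi a) z = phi_deriv a z"
  by (rule DERIV_imp_deriv, rule phi_has_field_derivative, rule one_minus_cnj_mult_nz) auto

definition deriv_functional :: "'a set \<Rightarrow> ('a \<Rightarrow> complex) \<Rightarrow> ('a \<Rightarrow> complex) \<Rightarrow> minimal \<Rightarrow> complex" where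
  "deriv_functional Z w p F = (\<Sum>x\<in>Z. w x * deriv (fun_of F) (p x))"

lemma deriv_functional_sums:
  assumes p: "\<And>x. x \<in> Z \<Longrightarrow> p x \<in> unit_disc"
    and \<alpha>: "\<And>k. norm (\<alpha> k) \<le> 1" and l: "summable (\<lambda>k. norm (l k))"
    and F: "\<And>z. z \<in> unit_disc \<Longrightarrow> (\<lambda>k. l k * phi (\<alpha> k) z) sums fun_of F z"
  shows "(\<lambda>k. l k * (\<Sum>x\<in>Z. w x * phi_deriv (\<alpha> k) (p x))) sums deriv_functional Z w p F"
proof -
  have "(\<lambda>k. l k * deriv (phi (\<alpha> k)) (p x)) sums deriv (fun_of F) (p x)" if "x \<in> Z" for x
    by (rule atomic_deriv_sums[OF disc_bounded_phi_atoms _ _ l F p[OF that]])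
       (auto simp: phi_atoms_def intro!: holomorphic_phi \<alpha>)
  then have "(\<lambda>k. \<Sum>x\<in>Z. w x * (l k * deriv (phi (\<alpha> k)) (p x))) sums deriv_functional Z w p F"
    unfolding deriv_functional_def by (intro sums_sum sums_mult)
  also have "(\<lambda>k. \<Sum>x\<in>Z. w x * (l k * deriv (phi (\<alpha> k)) (p x))) = (\<lambda>k. l k * (\<Sum>x\<in>Z. w x * phi_deriv (\<alpha> k) (p x)))"
    using \<alpha> p by (simp add: deriv_phi sum_distrib_left mult_ac)
  finally show ?thesis .
qed

lemma fun_of_representation:
  assumes "norm F < s"
  obtains \<alpha> l where "\<And>k. norm (\<alpha> k) \<le> 1" "summable (\<lambda>k. norm (l k))" "(\<Sum>k. norm (l k)) \<le> s"
    "\<And>z. z \<in> unit_disc \<Longrightarrow> (\<lambda>k. l k * phi (\<alpha> k) z) sums fun_of F z"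
proof -
  obtain \<alpha> l where "represents (fun_of F) \<alpha> l" "(\<Sum>k. norm (l k)) \<le> s"
    using atomic_fun_of[OF assms] atomic_phi_atoms_iff by blast
  then show ?thesis
    by (intro that[of \<alpha> l]) (auto simp: represents_def)
qed

text \<open>Series of atoms may be differentiated term by term, so a functional has to be bounded on
  the atoms \<open>phi a\<close> only.\<close>

lemma norm_deriv_functional_le:
  assumes p: "\<And>x. x \<in> Z \<Longrightarrow> p x \<in> unit_disc"
    and M: "\<And>a. norm a \<le> 1 \<Longrightarrow> norm (\<Sum>x\<in>Z. w x * phi_deriv a (p x)) \<le> M"
  shows "norm (deriv_functional Z w p F) \<le> M * norm F"
proof -
  have M0: "M \<ge> 0"
    by (rule order_trans[OF norm_ge_zero M[of 0]]) simp
  have *: "norm (deriv_functional Z w p F) \<le> M * s" if F: "norm F < s" for s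
  proof -
    obtain \<alpha> l where rep: "\<And>k. norm (\<alpha> k) \<le> 1" "summable (\<lambda>k. norm (l k))" "(\<Sum>k. norm (l k)) \<le> s"
      "\<And>z. z \<in> unit_disc \<Longrightarrow> (\<lambda>k. l k * phi (\<alpha> k) z) sums fun_of F z"
      using fun_of_representation[OF F] by blast
    let ?t = "\<lambda>k. l k * (\<Sum>x\<in>Z. w x * phi_deriv (\<alpha> k) (p x))"
    have s: "?t sums deriv_functional Z w p F"
      by (rule deriv_functional_sums[OF p rep(1,2,4)])
    have le: "norm (?t k) \<le> norm (l k) * M" for k
      unfolding norm_mult by (intro mult_left_mono M rep) auto
    have sn: "summable (\<lambda>k. norm (?t k))"
      by (rule summable_comparison_test[OF _ summable_mult2[OF rep(2), of M]]) (use le in auto)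
    have "norm (deriv_functional Z w p F) \<le> (\<Sum>k. norm (?t k))"
      using summable_norm[OF sn] s by (simp add: sums_iff)
    also have "\<dots> \<le> (\<Sum>k. norm (l k) * M)"
      by (rule suminf_le[OF le sn summable_mult2[OF rep(2)]])
    also have "\<dots> \<le> M * s"
      using mult_left_mono[OF rep(3) M0] by (simp add: suminf_mult[OF rep(2)] mult.commute[of _ M])
    finally show ?thesis .
  qed
  show ?thesis
  proof (rule field_le_epsilon)
    fix e :: real assume e: "e > 0"
    \<comment> \<open>Dividing by \<open>M + 1\<close> instead of \<open>M\<close> covers the case
      \<open>M = 0\<close>.\<close>
    have "norm (deriv_functional Z w p F) \<le> M * (norm F + e / (M + 1))"
      by (rule *) (use e M0 in \<open>simp add: add_nonneg_pos\<close>)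
    also have "\<dots> = M * norm F + (M / (M + 1)) * e"
      by (simp add: algebra_simps)
    also have "(M / (M + 1)) * e \<le> 1 * e"
      using e M0 by (intro mult_right_mono) auto
    finally show "norm (deriv_functional Z w p F) \<le> M * norm F + e"
      by simp
  qed
qed

lemma deriv_functional_diff:
  assumes p: "\<And>x. x \<in> Z \<Longrightarrow> p x \<in> unit_disc"
  shows "deriv_functional Z w p (F - G) = deriv_functional Z w p F - deriv_functional Z w p G"
proof -
  have "deriv (fun_of (F - G)) (p x) = deriv (fun_of F) (p x) - deriv (fun_of G) (p x)" if "x \<in> Z" for x
  proof -
    have "fun_of (F - G) = (\<lambda>z. fun_of F z - fun_of G z)"
      by (simp add: fun_of_diff fun_eq_iff)
    then show ?thesis
      using DERIV_imp_deriv[OF DERIV_diff[OF holomorphic_derivI[OF holomorphic_fun_of open_ball p[OF that], of F]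
        holomorphic_derivI[OF holomorphic_fun_of open_ball p[OF that], of G]]] by simp
  qed
  then show ?thesis
    unfolding deriv_functional_def sum_subtractf[symmetric]
    by (intro sum.cong refl) (simp only: right_diff_distrib)
qed

text \<open>Convergence on each atom together with a bound common to all atoms and all
  \<open>k\<close> is enough: Tannery's theorem, dominated convergence for series, interchanges the
  limit with the sum over the representation.\<close>

lemma deriv_functional_tendsto_0:
  fixes w p :: "nat \<Rightarrow> 'a \<Rightarrow> complex"
  assumes p: "\<And>k x. x \<in> Z \<Longrightarrow> p k x \<in> unit_disc"
    and M: "\<And>k a. norm a \<le> 1 \<Longrightarrow> norm (\<Sum>x\<in>Z. w k x * phi_deriv a (p k x)) \<le> M"
    and lim: "\<And>a. norm a \<le> 1 \<Longrightarrow> (\<lambda>k. \<Sum>x\<in>Z. w k x * phi_deriv a (p k x)) \<longlonglongrightarrow> 0"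
  shows "(\<lambda>k. deriv_functional Z (w k) (p k) F) \<longlonglongrightarrow> 0"
proof -
  obtain \<alpha> l where rep: "\<And>k. norm (\<alpha> k) \<le> 1" "summable (\<lambda>k. norm (l k))"
    "\<And>z. z \<in> unit_disc \<Longrightarrow> (\<lambda>k. l k * phi (\<alpha> k) z) sums fun_of F z"
    by (rule fun_of_representation[of F "norm F + 1"]) (simp, blast)
  define a where "a j k = l j * (\<Sum>x\<in>Z. w k x * phi_deriv (\<alpha> j) (p k x))" for j k
  have "(\<lambda>k. suminf (\<lambda>j. a j k)) \<longlonglongrightarrow> suminf (\<lambda>_. 0)"
  proof (rule tannerys_theorem[where M = "\<lambda>j. norm (l j) * M", THEN conjunct2, THEN conjunct2])
    show "(\<lambda>k. a j k) \<longlonglongrightarrow> 0" for j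
      unfolding a_def using tendsto_mult_right_zero[OF lim[OF rep(1)]] by simp
    show "\<forall>\<^sub>F (j, k) in sequentially \<times>\<^sub>F sequentially. norm (a j k) \<le> norm (l j) * M"
      by (intro always_eventually) (auto simp: a_def norm_mult intro!: mult_left_mono M rep)
    show "summable (\<lambda>j. norm (l j) * M)"
      by (rule summable_mult2[OF rep(2)])
  qed simp
  moreover have "suminf (\<lambda>j. a j k) = deriv_functional Z (w k) (p k) F" for k
    using deriv_functional_sums[of Z "p k" \<alpha> l F "w k", OF p rep] by (simp add: a_def sums_iff)
  ultimately show ?thesis by simp
qed

text \<open>Schwarz-Pick for an atom: the left side is \<open>1 - |phi a z|^2\<close>.\<close>

lemma poisson_le_1:
  assumes "norm a \<le> 1" "norm z < 1"
  shows "(1 - (norm z)\<^sup>2) * poisson a z \<le> 1"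
proof -
  have "1 - cnj a * z \<noteq> 0"
    by (rule one_minus_cnj_mult_nz[OF assms])
  moreover have "(1 - (norm z)\<^sup>2) * (1 - (norm a)\<^sup>2) = (norm (1 - cnj a * z))\<^sup>2 - (norm (a - z))\<^sup>2"
    by (subst norm_phi_identity) (rule mult.commute)
  then have "(1 - (norm z)\<^sup>2) * (1 - (norm a)\<^sup>2) \<le> (norm (1 - cnj a * z))\<^sup>2"
    by simp
  ultimately show ?thesis
    by (simp add: poisson_def)
qed

lemma finite_separated:
  assumes "finite (Z :: 'a::metric_space set)"
  obtains \<delta> where "\<delta> > 0" "\<And>x y. x \<in> Z \<Longrightarrow> y \<in> Z \<Longrightarrow> x \<noteq> y \<Longrightarrow> \<delta> \<le> dist x y"
proof -
  \<comment> \<open>The element 1 keeps \<open>D\<close> nonempty when \<open>Z\<close> has at most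
    one point.\<close>
  define D where "D = insert 1 ((\<lambda>(x, y). dist x y) ` {(x, y). x \<in> Z \<and> y \<in> Z \<and> x \<noteq> y})"
  have "{(x, y). x \<in> Z \<and> y \<in> Z \<and> x \<noteq> y} \<subseteq> Z \<times> Z" by auto
  then have fin: "finite D"
    unfolding D_def using assms by (meson finite.insertI finite_SigmaI finite_imageI finite_subset)
  show ?thesis
  proof (rule that[of "Min D"])
    show "Min D > 0"
      using fin by (subst Min_gr_iff) (auto simp: D_def)
    show "Min D \<le> dist x y" if "x \<in> Z" "y \<in> Z" "x \<noteq> y" for x y
      using fin that by (intro Min_le) (auto simp: D_def)
  qed
qed

section \<open>Test functionals attached to the solutions of b = 1\<close>

context blaschke_data
begin

definition db :: "complex \<Rightarrow> complex" where "db z = c * bprod_deriv \<alpha> n z"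
text \<open>On the circle this is the modulus of \<open>b'\<close>, by \<open>circle_db\<close>; the
  form as a sum of Poisson kernels shows that it is positive.\<close>

definition rate :: "complex \<Rightarrow> real" where "rate z = (\<Sum>j=1..n. poisson (\<alpha> j) z)"
definition Z :: "complex set" where "Z = {z. norm z = 1 \<and> b z = 1}"

lemma nz_closed: "j \<in> {1..n} \<Longrightarrow> norm z \<le> 1 \<Longrightarrow> 1 - cnj (\<alpha> j) * z \<noteq> 0"
  using \<alpha>[of j] one_minus_cnj_mult_nz[of "cnj z" "cnj (\<alpha> j)"] by (simp add: mult.commute)

lemma b_has_field_derivative: "norm z \<le> 1 \<Longrightarrow> (b has_field_derivative db z) (at z)"
  unfolding b_def[abs_def] db_def by (intro DERIV_cmult bprod_has_field_derivative nz_closed)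

lemma db_isCont: "norm z \<le> 1 \<Longrightarrow> isCont db z"
  unfolding db_def[abs_def]
  by (rule DERIV_isCont, rule DERIV_cmult, rule bprod_has_field_derivative) (rule nz_closed)

lemma rate_pos: "norm z \<le> 1 \<Longrightarrow> rate z > 0"
  unfolding rate_def using n \<alpha> by (intro sum_pos poisson_pos) auto

text \<open>Logarithmic derivatives add up over products, and on the circle each of them, multiplied
  by \<open>z\<close>, is a positive Poisson kernel, so nothing cancels. The resulting
  \<open>circle_db\<close> makes the solutions of \<open>b = 1\<close> simple and determines
  \<open>b\<close> to first order along the radii.\<close>

lemma circle_phi_deriv:
  assumes a: "norm a < 1" and z: "norm z = 1"
  shows "z * phi_deriv a z = phi a z * of_real (poisson a z)"
proof -
  have zz: "z * cnj z = 1"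
    using complex_norm_square[of z] z by simp
  have nz: "1 - cnj a * z \<noteq> 0"
    using one_minus_cnj_mult_nz[of "cnj z" "cnj a"] a z by (simp add: mult.commute)
  then have nz': "1 - a * cnj z \<noteq> 0"
    by (metis complex_cnj_cnj complex_cnj_diff complex_cnj_mult complex_cnj_one complex_cnj_zero_iff)
  have "of_real ((norm (1 - cnj a * z))\<^sup>2) = (1 - cnj a * z) * (1 - a * cnj z)"
    using complex_norm_square[of "1 - cnj a * z"] by simp
  then have "phi a z * of_real (poisson a z) =
      (a - z) / (1 - cnj a * z) * (of_real (1 - (norm a)\<^sup>2) / ((1 - cnj a * z) * (1 - a * cnj z)))"
    by (simp only: poisson_def phi_def of_real_divide)
  also have "a - z = - z * (1 - a * cnj z)"
    using zz by (simp add: algebra_simps)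
  also have "- z * (1 - a * cnj z) / (1 - cnj a * z) * (of_real (1 - (norm a)\<^sup>2) / ((1 - cnj a * z) * (1 - a * cnj z))) =
      z * (- of_real (1 - (norm a)\<^sup>2) / (1 - cnj a * z)\<^sup>2)"
  proof -
    have "- z * y / x * (k / (x * y)) = z * (- k / x\<^sup>2)" if "x \<noteq> 0" "y \<noteq> 0" for x y k
      using that by (simp add: power2_eq_square)
    from this[OF nz nz'] show ?thesis .
  qed
  finally show ?thesis
    by (simp only: phi_deriv_def)
qed

lemma circle_bprod_deriv:
  assumes z: "norm z = 1" and m: "m \<le> n"
  shows "z * bprod_deriv \<alpha> m z = (\<Prod>j=1..m. phi (\<alpha> j) z) * of_real (\<Sum>j=1..m. poisson (\<alpha> j) z)"
  using m
proof (induction m)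
  case (Suc m)
  have "z * bprod_deriv \<alpha> (Suc m) z = (z * bprod_deriv \<alpha> m z) * phi (\<alpha> (Suc m)) z +
     (\<Prod>j=1..m. phi (\<alpha> j) z) * (z * phi_deriv (\<alpha> (Suc m)) z)"
    by (simp add: algebra_simps)
  also have "z * phi_deriv (\<alpha> (Suc m)) z = phi (\<alpha> (Suc m)) z * of_real (poisson (\<alpha> (Suc m)) z)"
    using Suc.prems by (intro circle_phi_deriv[OF _ z] \<alpha>) simp
  also have "z * bprod_deriv \<alpha> m z = (\<Prod>j=1..m. phi (\<alpha> j) z) * of_real (\<Sum>j=1..m. poisson (\<alpha> j) z)"
    using Suc by simp
  also have "(\<Prod>j=1..m. phi (\<alpha> j) z) * of_real (\<Sum>j=1..m. poisson (\<alpha> j) z) * phi (\<alpha> (Suc m)) z +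
     (\<Prod>j=1..m. phi (\<alpha> j) z) * (phi (\<alpha> (Suc m)) z * of_real (poisson (\<alpha> (Suc m)) z)) =
     (\<Prod>j=1..Suc m. phi (\<alpha> j) z) * of_real (\<Sum>j=1..Suc m. poisson (\<alpha> j) z)"
    by (simp add: algebra_simps)
  finally show ?case .
qed simp

lemma circle_db: "norm z = 1 \<Longrightarrow> z * db z = b z * of_real (rate z)"
  using circle_bprod_deriv[of z n] by (simp add: db_def b_def rate_def)

text \<open>The solutions are the roots of \<open>Q - c * P\<close>, which has degree
  \<open>n\<close>. Comparing \<open>|P|\<close> with \<open>|Q|\<close> forces the roots onto the
  circle, and there \<open>b'\<close> is nonzero, so all of them are simple.\<close>

lemma finite_Z: "finite Z" and card_Z: "card Z = n"
proof -
  define p where "p = smult 1 Q - smult c P"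
  have deg: "degree p = n" and p0: "p \<noteq> 0"
    using coeff_num_nz[of 1] n by (auto simp: p_def)
  have roots: "poly p z = 0 \<longleftrightarrow> z \<in> Z" for z
  proof
    assume "poly p z = 0"
    then have eq: "poly Q z = c * poly P z"
      by (simp add: p_def)
    then have "norm (poly Q z) = norm (poly P z)"
      using c by (simp add: norm_mult)
    then have 1: "norm z = 1"
      using norm_P_Q(1,3)[of z] by (metis less_irrefl linorder_less_linear)
    then show "z \<in> Z"
      using eq Q_nz[of z] by (simp add: Z_def b_eq)
  next
    assume "z \<in> Z"
    then show "poly p z = 0"
      using Q_nz[of z] by (simp add: Z_def b_eq p_def field_simps)
  qed
  show fin: "finite Z"
    using poly_roots_finite[OF p0] by (simp add: roots)
  have "rsquarefree p"
  proof (subst rsquarefree_roots, intro allI notI)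
    fix z assume "poly p z = 0 \<and> poly (pderiv p) z = 0"
    then have z: "z \<in> Z" and d0: "poly (pderiv p) z = 0"
      by (auto simp: roots)
    then have 1: "norm z = 1" "b z = 1"
      by (auto simp: Z_def)
    have "((\<lambda>w. poly Q w * (1 - b w)) has_field_derivative poly (pderiv Q) z * (1 - b z) + (0 - db z) * poly Q z) (at z)"
      using 1 by (intro DERIV_mult DERIV_diff DERIV_const poly_DERIV b_has_field_derivative) auto
    moreover have "\<forall>\<^sub>F w in nhds z. poly Q w * (1 - b w) = poly p w"
    proof -
      have "\<forall>\<^sub>F w in nhds z. poly Q w \<noteq> 0"
        unfolding eventually_nhds_conv_at
        using Q_nz[of z] 1 tendsto_imp_eventually_ne[OF isContD[OF poly_isCont], of Q z 0] by simp
      then show ?thesis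
        by eventually_elim (simp add: b_eq p_def field_simps)
    qed
    ultimately have "(poly p has_field_derivative poly (pderiv Q) z * (1 - b z) + (0 - db z) * poly Q z) (at z)"
      by (subst (asm) DERIV_cong_ev[OF refl _ refl])
    from DERIV_unique[OF this poly_DERIV] have "db z * poly Q z = 0"
      using d0 1 by simp
    then have "db z = 0"
      using Q_nz[of z] 1 by simp
    then show False
      using circle_db[OF 1(1)] rate_pos[of z] 1 by simp
  qed
  from complex_poly_decompose_rsquarefree[OF this]
  have "degree p = degree (smult (lead_coeff p) (\<Prod>z\<in>Z. [:- z, 1:]))"
    by (simp add: roots)
  also have "\<dots> = card Z"
    using p0 by (simp add: degree_prod_sum_eq)
  finally show "card Z = n"
    using deg by simp
qed

text \<open>The points \<open>pt \<epsilon> z\<close> are chosen such that \<open>b (pt \<epsilon> z) = 1 - \<epsilon> + o(\<epsilon>)\<close> for all \<open>z \<in> Z\<close> simultaneously.\<close>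
definition pt :: "real \<Rightarrow> complex \<Rightarrow> complex" where
  "pt \<epsilon> z = of_real (1 - \<epsilon> / rate z) * z"

text \<open>The modulus \<open>1 - |pt \<epsilon> z|^2\<close> is the weight of the Schwarz-Pick
  bound \<open>poisson_le_1\<close>. The phase \<open>z\<close> makes \<open>z * db z\<close>
  positive for every \<open>z \<in> Z\<close>, so the \<open>n\<close> contributions add up instead
  of cancelling.\<close>

definition wt :: "real \<Rightarrow> complex \<Rightarrow> complex" where
  "wt \<epsilon> z = z * of_real (1 - (norm (pt \<epsilon> z))\<^sup>2)"

lemma Z_D: "z \<in> Z \<Longrightarrow> norm z = 1" "z \<in> Z \<Longrightarrow> b z = 1" "z \<in> Z \<Longrightarrow> rate z > 0"
  "z \<in> Z \<Longrightarrow> z * db z = of_real (rate z)"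
  using rate_pos[of z] circle_db[of z] by (auto simp: Z_def)

lemma norm_pt_sq: "z \<in> Z \<Longrightarrow> 1 - (norm (pt \<epsilon> z))\<^sup>2 = (\<epsilon> / rate z) * (2 - \<epsilon> / rate z)"
  unfolding pt_def norm_mult norm_of_real by (simp add: Z_D(1) power2_eq_square algebra_simps)

lemma pt_tendsto:
  assumes e: "e \<longlonglongrightarrow> (0::real)" and z: "z \<in> Z"
  shows "(\<lambda>k. pt (e k) z) \<longlonglongrightarrow> z"
proof -
  have "(\<lambda>k. of_real (1 - e k / rate z) * z) \<longlonglongrightarrow> of_real (1 - 0 / rate z) * z"
    by (intro tendsto_intros e) (use Z_D(3)[OF z] in auto)
  then show ?thesis by (simp add: pt_def)
qed

text \<open>Write \<open>b (pt e z) = 1 + e * q\<close> with \<open>q \<rightarrow> -1\<close>. For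
  \<open>a = 1 - e\<close> the denominator \<open>1 - a * b\<close> is
  \<open>e * (1 - q + e * q)\<close>, about \<open>2 * e\<close>. So the derivative of
  \<open>phi a\<close> is about \<open>-1 / (2 * e)\<close>, the weight about
  \<open>2 * e * z / rate z\<close>, and the product tends to
  \<open>- z * db z / rate z = -1\<close>.\<close>

lemma test_term_tendsto:
  assumes e: "e \<longlonglongrightarrow> (0::real)" "\<And>k. e k \<noteq> 0" and z: "z \<in> Z"
  shows "(\<lambda>k. wt (e k) z * (phi_deriv (of_real (1 - e k)) (b (pt (e k) z)) * db (pt (e k) z))) \<longlonglongrightarrow> -1"
proof -
  have r: "rate z > 0" using Z_D[OF z] by simp
  define q where "q k = (b (pt (e k) z) - 1) / of_real (e k)" for k
  define h where "h x = b ((1 - x / of_real (rate z)) * z)" for x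
  have "((\<lambda>x. (1 - x / of_real (rate z)) * z) has_field_derivative - (z / of_real (rate z))) (at 0)"
    using r by (auto intro!: derivative_eq_intros)
  moreover have "(b has_field_derivative db z) (at ((1 - 0 / of_real (rate z)) * z))"
    using b_has_field_derivative[of z] Z_D[OF z] by simp
  ultimately have "(h has_field_derivative db z * - (z / of_real (rate z))) (at 0)"
    unfolding h_def by (intro DERIV_chain2)
  also have "db z * - (z / of_real (rate z)) = -1"
    using Z_D(4)[OF z] r by (simp add: mult.commute)
  finally have "((\<lambda>x. (h (0 + x) - h 0) / x) \<longlongrightarrow> -1) (at 0)"
    by (simp add: DERIV_def)
  moreover have "filterlim (\<lambda>k. complex_of_real (e k)) (at 0) sequentially"
    unfolding filterlim_at using e tendsto_of_real[OF e(1), where 'a = complex] by auto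
  ultimately have "(\<lambda>k. (h (0 + of_real (e k)) - h 0) / of_real (e k)) \<longlonglongrightarrow> -1"
    by (rule filterlim_compose)
  then have q: "q \<longlonglongrightarrow> -1"
    unfolding q_def h_def pt_def using Z_D(2)[OF z] by simp
  have dbt: "(\<lambda>k. db (pt (e k) z)) \<longlonglongrightarrow> db z"
    using isCont_tendsto_compose[OF db_isCont pt_tendsto[OF e(1) z]] Z_D[OF z] by simp
  have ec: "(\<lambda>k. complex_of_real (e k)) \<longlonglongrightarrow> 0"
    using tendsto_of_real[OF e(1), where 'a = complex] by simp
  \<comment> \<open>The same product after the powers of \<open>e k\<close> have been cancelled, a
    form in which the limit can be taken factor by factor.\<close>
  have "(\<lambda>k. - (z * (2 - of_real (e k) / of_real (rate z)) * (2 - of_real (e k)) /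
      (of_real (rate z) * (1 - q k + of_real (e k) * q k)\<^sup>2)) * db (pt (e k) z)) \<longlonglongrightarrow>
      - (z * (2 - 0 / of_real (rate z)) * (2 - 0) / (of_real (rate z) * (1 - (-1) + 0 * (-1))\<^sup>2)) * db z"
    by (intro tendsto_intros q dbt ec) (use r in auto)
  also have "- (z * (2 - 0 / of_real (rate z)) * (2 - 0) / (of_real (rate z) * (1 - (-1) + 0 * (-1))\<^sup>2)) * db z =
      - (z * db z / of_real (rate z))"
    by (simp add: power2_eq_square)
  also have "\<dots> = -1"
    unfolding Z_D(4)[OF z] using r by simp
  also have "(\<lambda>k. - (z * (2 - of_real (e k) / of_real (rate z)) * (2 - of_real (e k)) /
      (of_real (rate z) * (1 - q k + of_real (e k) * q k)\<^sup>2)) * db (pt (e k) z)) =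
      (\<lambda>k. wt (e k) z * (phi_deriv (of_real (1 - e k)) (b (pt (e k) z)) * db (pt (e k) z)))"
  proof
    fix k
    define E where "E = complex_of_real (e k)"
    define R where "R = complex_of_real (rate z)"
    have E: "E \<noteq> 0" and R: "R \<noteq> 0"
      using e r by (auto simp: E_def R_def)
    have bq: "b (pt (e k) z) = 1 + E * q k"
      using e by (simp add: q_def E_def)
    have w: "wt (e k) z = z * ((E / R) * (2 - E / R))"
      unfolding wt_def norm_pt_sq[OF z] by (simp add: E_def R_def)
    have "of_real (1 - (norm (complex_of_real (1 - e k)))\<^sup>2) = E * (2 - E)"
      unfolding norm_of_real power2_abs by (simp add: E_def power2_eq_square algebra_simps)
    moreover have "1 - cnj (of_real (1 - e k)) * b (pt (e k) z) = E * (1 - q k + E * q k)"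
      unfolding bq by (simp add: E_def algebra_simps)
    ultimately have d: "phi_deriv (of_real (1 - e k)) (b (pt (e k) z)) = - (E * (2 - E)) / (E * (1 - q k + E * q k))\<^sup>2"
      by (simp only: phi_deriv_def)
    have "- (z * (2 - E / R) * (2 - E) / (R * X\<^sup>2)) = z * ((E / R) * (2 - E / R)) * (- (E * (2 - E)) / (E * X)\<^sup>2)" for X
    proof -
      have "z * ((E / R) * (2 - E / R)) * (- (E * (2 - E)) / (E * X)\<^sup>2) =
         - (z * (2 - E / R) * (2 - E) / R) * ((E * E) / (E * X)\<^sup>2)"
        by (simp add: mult_ac)
      also have "(E * E) / (E * X)\<^sup>2 = 1 / X\<^sup>2"
        using E by (simp add: power2_eq_square)
      finally show ?thesis by simp
    qed
    then show "- (z * (2 - of_real (e k) / of_real (rate z)) * (2 - of_real (e k)) /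
      (of_real (rate z) * (1 - q k + of_real (e k) * q k)\<^sup>2)) * db (pt (e k) z) =
      wt (e k) z * (phi_deriv (of_real (1 - e k)) (b (pt (e k) z)) * db (pt (e k) z))"
      unfolding w d E_def[symmetric] R_def[symmetric] by (simp only: mult.assoc)
  qed
  finally show ?thesis .
qed

text \<open>The conditions on \<open>\<epsilon> / rate z\<close> put \<open>pt \<epsilon> z\<close>
  into the disc, keep it within \<open>\<delta> / 4\<close> of \<open>z\<close>, and make every
  summand whose \<open>z\<close> is at distance at least \<open>\<delta> / 2\<close> from the
  parameter of the atom at most \<open>1 / n\<close>. The factor 32 is \<open>2 * 4^2\<close>, from
  the weight and from the square of \<open>\<delta> / 4\<close>.\<close>

definition good :: "real \<Rightarrow> real \<Rightarrow> bool" where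
  "good \<delta> \<epsilon> \<longleftrightarrow> 0 < \<epsilon> \<and> \<epsilon> < 1 \<and> (\<forall>z\<in>Z. \<epsilon> / rate z < 1 \<and> \<epsilon> / rate z \<le> \<delta> / 4 \<and> 32 * (\<epsilon> / rate z) / \<delta>\<^sup>2 \<le> 1 / real n)"

lemma eventually_good:
  assumes "\<delta> > 0"
  shows "\<forall>\<^sub>F k in sequentially. good \<delta> (inverse (real (Suc k)))"
proof -
  have lim: "(\<lambda>k. inverse (real (Suc k))) \<longlonglongrightarrow> 0"
    by (rule LIMSEQ_inverse_real_of_nat)
  have "\<forall>\<^sub>F k in sequentially. \<forall>z\<in>Z. inverse (real (Suc k)) / rate z < 1 \<and> inverse (real (Suc k)) / rate z \<le> \<delta> / 4 \<and>
      32 * (inverse (real (Suc k)) / rate z) / \<delta>\<^sup>2 \<le> 1 / real n"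
  proof (intro eventually_ball_finite finite_Z ballI)
    fix z assume z: "z \<in> Z"
    have l: "(\<lambda>k. inverse (real (Suc k)) / rate z) \<longlonglongrightarrow> 0 / rate z"
      "(\<lambda>k. 32 * (inverse (real (Suc k)) / rate z) / \<delta>\<^sup>2) \<longlonglongrightarrow> 32 * (0 / rate z) / \<delta>\<^sup>2"
      by (intro tendsto_intros lim; use Z_D(3)[OF z] assms in simp)+
    have "\<forall>\<^sub>F k in sequentially. inverse (real (Suc k)) / rate z < min 1 (\<delta> / 4)"
      by (rule order_tendstoD(2)[OF l(1)]) (use assms in auto)
    moreover have "\<forall>\<^sub>F k in sequentially. 32 * (inverse (real (Suc k)) / rate z) / \<delta>\<^sup>2 < 1 / real n"
      by (rule order_tendstoD(2)[OF l(2)]) (use n in auto)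
    ultimately show "\<forall>\<^sub>F k in sequentially. inverse (real (Suc k)) / rate z < 1 \<and> inverse (real (Suc k)) / rate z \<le> \<delta> / 4 \<and>
      32 * (inverse (real (Suc k)) / rate z) / \<delta>\<^sup>2 \<le> 1 / real n"
      by eventually_elim auto
  qed
  moreover have "\<forall>\<^sub>F k in sequentially. inverse (real (Suc k)) < 1"
    by (rule order_tendstoD(2)[OF lim]) simp
  ultimately show ?thesis
    unfolding good_def by eventually_elim auto
qed

lemma pt_in_disc:
  assumes "good \<delta> \<epsilon>" "z \<in> Z"
  shows "pt \<epsilon> z \<in> unit_disc" "norm (wt \<epsilon> z) = 1 - (norm (pt \<epsilon> z))\<^sup>2" "1 - (norm (pt \<epsilon> z))\<^sup>2 \<le> 2 * (\<epsilon> / rate z)"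
    "norm (z - pt \<epsilon> z) = \<epsilon> / rate z"
proof -
  define t where "t = \<epsilon> / rate z"
  have t: "0 < t" "t < 1"
    using assms Z_D(3)[OF assms(2)] by (auto simp: good_def t_def)
  have z: "norm z = 1" using Z_D assms by auto
  have np: "norm (pt \<epsilon> z) = 1 - t"
    unfolding pt_def t_def[symmetric] norm_mult norm_of_real using t z by simp
  show 1: "pt \<epsilon> z \<in> unit_disc"
    using np t by simp
  then show "norm (wt \<epsilon> z) = 1 - (norm (pt \<epsilon> z))\<^sup>2"
    unfolding wt_def norm_mult norm_of_real using z by (simp add: abs_square_le_1)
  show "1 - (norm (pt \<epsilon> z))\<^sup>2 \<le> 2 * (\<epsilon> / rate z)"
    unfolding np t_def[symmetric] by (simp add: power2_eq_square algebra_simps)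
  have "z - pt \<epsilon> z = of_real t * z"
    unfolding pt_def t_def[symmetric] by (simp add: algebra_simps)
  then show "norm (z - pt \<epsilon> z) = \<epsilon> / rate z"
    using t z by (simp add: norm_mult t_def[symmetric])
qed

text \<open>A point of the disc is close to at most one of the separated boundary points, so only one
  summand can be of size 1.\<close>
lemma norm_test_functional_le_2:
  assumes \<delta>: "\<delta> > 0" "\<And>x y. x \<in> Z \<Longrightarrow> y \<in> Z \<Longrightarrow> x \<noteq> y \<Longrightarrow> \<delta> \<le> dist x y"
    and good: "good \<delta> \<epsilon>" and a: "norm a \<le> 1"
  shows "norm (\<Sum>z\<in>Z. wt \<epsilon> z * phi_deriv a (pt \<epsilon> z)) \<le> 2"
proof -
  define T where "T z = (1 - (norm (pt \<epsilon> z))\<^sup>2) * poisson a (pt \<epsilon> z)" for z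
  have T1: "T z \<le> 1" if "z \<in> Z" for z
    unfolding T_def using pt_in_disc(1)[OF good that] a by (intro poisson_le_1) auto
  \<comment> \<open>On the circle \<open>|1 - cnj a * z| = |z - a|\<close>, which is at least
    \<open>\<delta> / 2\<close>; passing to \<open>pt \<epsilon> z\<close> loses at most
    \<open>\<delta> / 4\<close>.\<close>
  have far: "T z \<le> 1 / real n" if z: "z \<in> Z" and "\<delta> / 2 \<le> norm (z - a)" for z
  proof -
    have zz: "cnj z * z = 1"
      using complex_norm_square[of z] Z_D(1)[OF z] by (simp add: mult.commute)
    have "cnj (z - a) * z = 1 - cnj a * z"
      using zz by (simp add: algebra_simps)
    then have n1: "norm (1 - cnj a * z) = norm (z - a)"
      using Z_D(1)[OF z] by (metis complex_mod_cnj mult.right_neutral norm_mult)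
    have "norm (1 - cnj a * z) \<le> norm (1 - cnj a * pt \<epsilon> z) + norm (cnj a * (z - pt \<epsilon> z))"
    proof -
      have "1 - cnj a * z = (1 - cnj a * pt \<epsilon> z) - cnj a * (z - pt \<epsilon> z)"
        by (simp add: algebra_simps)
      then show ?thesis
        by (metis norm_triangle_ineq4)
    qed
    moreover have "norm (cnj a * (z - pt \<epsilon> z)) \<le> 1 * (\<delta> / 4)"
      unfolding norm_mult using a good z pt_in_disc(4)[OF good z] Z_D(3)[OF z]
      by (intro mult_mono) (auto simp: good_def)
    ultimately have d: "\<delta> / 4 \<le> norm (1 - cnj a * pt \<epsilon> z)"
      using n1 that(2) by linarith
    have "poisson a (pt \<epsilon> z) \<le> 1 / (\<delta> / 4)\<^sup>2"
      unfolding poisson_def using d \<delta>(1) by (intro frac_le power_mono) auto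
    moreover have "0 \<le> 2 * (\<epsilon> / rate z)"
      using good Z_D(3)[OF z] by (simp add: good_def)
    ultimately have "T z \<le> 2 * (\<epsilon> / rate z) * (1 / (\<delta> / 4)\<^sup>2)"
      unfolding T_def by (intro mult_mono poisson_nonneg pt_in_disc(3)[OF good z] a)
    also have "\<dots> = 32 * (\<epsilon> / rate z) / \<delta>\<^sup>2"
      by (simp add: power_divide)
    also have "\<dots> \<le> 1 / real n"
      using good z by (auto simp: good_def)
    finally show ?thesis .
  qed
  have "(\<Sum>z\<in>Z. T z) \<le> 2"
  proof (cases "\<exists>z0\<in>Z. norm (z0 - a) < \<delta> / 2")
    case True
    then obtain z0 where z0: "z0 \<in> Z" "norm (z0 - a) < \<delta> / 2" by blast
    have "T z \<le> 1 / real n" if "z \<in> Z - {z0}" for z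
    proof (rule far)
      have "\<delta> \<le> norm (z - z0)"
        using \<delta>(2)[of z z0] that z0 by (simp add: dist_norm)
      moreover have "norm (z - z0) \<le> norm (z - a) + norm (z0 - a)"
        using norm_triangle_ineq4[of "z - a" "z0 - a"] by simp
      ultimately show "\<delta> / 2 \<le> norm (z - a)"
        using z0 by linarith
    qed (use that in auto)
    then have "(\<Sum>z\<in>Z - {z0}. T z) \<le> real (card (Z - {z0})) * (1 / real n)"
      by (rule sum_bounded_above)
    also have "\<dots> \<le> real n * (1 / real n)"
      using card_Diff1_le[of Z z0] card_Z by (intro mult_right_mono) auto
    finally have "(\<Sum>z\<in>Z - {z0}. T z) \<le> 1"
      using n by simp
    then show ?thesis
      using T1[OF z0(1)] sum.remove[OF finite_Z z0(1), of T] by simp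
  next
    case False
    then have "(\<Sum>z\<in>Z. T z) \<le> real (card Z) * (1 / real n)"
      by (intro sum_bounded_above far) (auto simp: not_less)
    then show ?thesis
      using card_Z n by simp
  qed
  moreover have "norm (\<Sum>z\<in>Z. wt \<epsilon> z * phi_deriv a (pt \<epsilon> z)) \<le> (\<Sum>z\<in>Z. T z)"
    using pt_in_disc(2)[OF good] a
    by (intro sum_norm_le) (auto simp: T_def norm_mult norm_phi_deriv)
  ultimately show ?thesis by linarith
qed

text \<open>For \<open>|a| = 1\<close> the atom is constant and its derivative vanishes. For
  \<open>|a| < 1\<close> the derivative stays continuous up to the circle while the weights tend to
  0.\<close>

lemma test_functional_phi_tendsto_0:
  assumes e: "e \<longlonglongrightarrow> (0::real)" and a: "norm a \<le> 1"
  shows "(\<lambda>k. \<Sum>z\<in>Z. wt (e k) z * phi_deriv a (pt (e k) z)) \<longlonglongrightarrow> 0"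
proof (cases "norm a = 1")
  case True
  then show ?thesis by (simp add: phi_deriv_def)
next
  case False
  have "(\<lambda>k. \<Sum>z\<in>Z. wt (e k) z * phi_deriv a (pt (e k) z)) \<longlonglongrightarrow> (\<Sum>z\<in>Z. 0)"
  proof (rule tendsto_sum)
    fix z assume z: "z \<in> Z"
    have "1 - cnj a * z \<noteq> 0"
      using one_minus_cnj_mult_nz[of "cnj z" "cnj a"] a False Z_D(1)[OF z] by (simp add: mult.commute)
    then have "(\<lambda>k. phi_deriv a (pt (e k) z)) \<longlonglongrightarrow> phi_deriv a z"
      by (intro isCont_tendsto_compose[OF DERIV_isCont[OF phi_deriv_has_field_derivative]] pt_tendsto e z)
    moreover have "(\<lambda>k. wt (e k) z) \<longlonglongrightarrow> z * of_real (1 - (norm z)\<^sup>2)"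
      unfolding wt_def by (intro tendsto_intros pt_tendsto e z)
    ultimately have "(\<lambda>k. wt (e k) z * phi_deriv a (pt (e k) z)) \<longlonglongrightarrow> z * of_real (1 - (norm z)\<^sup>2) * phi_deriv a z"
      by (rule tendsto_mult[rotated])
    then show "(\<lambda>k. wt (e k) z * phi_deriv a (pt (e k) z)) \<longlonglongrightarrow> 0"
      using Z_D(1)[OF z] by simp
  qed
  then show ?thesis by simp
qed

section \<open>Distance from the compact operators\<close>

lemma bounded_linear_compact_operator:
  assumes "compact_operator K"
  shows "bounded_linear K"
proof -
  have lin: "Vector_Spaces.linear scaleC scaleC K" and cpt: "compact (closure (K ` cball 0 1))"
    using assms by (auto simp: compact_operator_def)
  interpret Vector_Spaces.linear scaleC scaleC K by (rule lin)
  have "bounded (K ` cball 0 1)"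
    by (rule bounded_subset[OF compact_imp_bounded[OF cpt] closure_subset])
  then obtain M where "\<forall>x\<in>K ` cball 0 1. norm x \<le> M"
    unfolding bounded_iff by blast
  then have M: "norm (K F) \<le> M" if "norm F \<le> 1" for F
    using that by simp
  have sc: "K (r *\<^sub>R F) = r *\<^sub>R K F" for r F
    using scale[of "of_real r" F] by (simp add: scaleC_of_real)
  show ?thesis
  proof (rule bounded_linear_intro[where K = M])
    show "K (F + G) = K F + K G" for F G by (rule add)
    show "norm (K F) \<le> norm F * M" for F
    proof (cases "F = 0")
      case True
      then show ?thesis by (simp add: zero)
    next
      case False
      have "norm (K (inverse (norm F) *\<^sub>R F)) \<le> M"
        by (rule M) (use False in simp)
      then show ?thesis
        using False by (simp add: sc field_simps)
    qed
  qed (rule sc)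
qed

proposition onorm_composition_minus_compact_ge:
  assumes n': "blaschke_product n B" and B: "\<And>z. z \<in> unit_disc \<Longrightarrow> B z = b z" and K: "compact_operator K"
  shows "real n / 2 \<le> onorm (\<lambda>F. composition_operator B F - K F)"
proof -
  define T where "T = composition_operator B"
  have T: "bounded_linear T" and Tev: "\<And>z F. z \<in> unit_disc \<Longrightarrow> fun_of (T F) z = fun_of F (b z)"
    using composition_operator_blaschke[OF n' n] B by (auto simp: T_def)
  have Kb: "bounded_linear K"
    by (rule bounded_linear_compact_operator[OF K])
  have TK: "bounded_linear (\<lambda>F. T F - K F)"
    by (intro bounded_linear_sub T Kb)
  obtain \<delta> where \<delta>: "\<delta> > 0" "\<And>x y. x \<in> Z \<Longrightarrow> y \<in> Z \<Longrightarrow> x \<noteq> y \<Longrightarrow> \<delta> \<le> dist x y"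
    using finite_separated[OF finite_Z] by blast
  obtain N where N: "\<And>k. k \<ge> N \<Longrightarrow> good \<delta> (inverse (real (Suc k)))"
    using eventually_good[OF \<delta>(1)] by (auto simp: eventually_sequentially)
  \<comment> \<open>The shift by \<open>N\<close> makes every index good, so the bound 2 holds for
    all \<open>k\<close> and not only eventually.\<close>
  define e where "e k = inverse (real (Suc (k + N)))" for k
  have good: "good \<delta> (e k)" for k
    unfolding e_def by (rule N) simp
  have e: "e \<longlonglongrightarrow> 0"
    unfolding e_def using LIMSEQ_ignore_initial_segment[OF LIMSEQ_inverse_real_of_nat] .
  have e0: "e k \<noteq> 0" "0 < e k" "e k < 1" for k
    using good[of k] by (auto simp: good_def)
  define L where "L k = deriv_functional Z (wt (e k)) (pt (e k))" for k
  define F where "F k = minimal_of (phi (of_real (1 - e k)))" for k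
  have inD: "pt (e k) z \<in> unit_disc" if "z \<in> Z" for k z
    by (rule pt_in_disc(1)[OF good that])
  have L2: "norm (L k G) \<le> 2 * norm G" for k G
    unfolding L_def by (rule norm_deriv_functional_le[OF inD norm_test_functional_le_2[OF \<delta> good]])
  have Ldiff: "L k (G - H) = L k G - L k H" for k G H
    unfolding L_def by (rule deriv_functional_diff[OF inD])
  have L0: "(\<lambda>k. L k G) \<longlonglongrightarrow> 0" for G
    unfolding L_def
    by (rule deriv_functional_tendsto_0[OF inD norm_test_functional_le_2[OF \<delta> good] test_functional_phi_tendsto_0[OF e]])
  have na: "norm (complex_of_real (1 - e k)) \<le> 1" for k
    unfolding norm_of_real using e0[of k] by simp
  have Fat: "atomic phi_atoms 1 (phi (of_real (1 - e k)))" for k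
    by (intro atomic_atom phi_in_phi_atoms na)
  have F1: "norm (F k) \<le> 1" for k
    unfolding F_def by (rule norm_minimal_of[OF Fat])
  have LT: "L k (T (F k)) = (\<Sum>z\<in>Z. wt (e k) z * (phi_deriv (of_real (1 - e k)) (b (pt (e k) z)) * db (pt (e k) z)))" for k
    unfolding L_def deriv_functional_def
  proof (intro sum.cong refl arg_cong[where f = "\<lambda>x. _ * x"] DERIV_imp_deriv)
    fix z assume z: "z \<in> Z"
    let ?a = "of_real (1 - e k) :: complex"
    have p: "norm (pt (e k) z) < 1" using inD[OF z, of k] by simp
    have "(phi ?a has_field_derivative phi_deriv ?a (b (pt (e k) z))) (at (b (pt (e k) z)))"
      using norm_b_less_1[OF p] na[of k] by (intro phi_has_field_derivative one_minus_cnj_mult_nz)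
    from DERIV_chain2[OF this b_has_field_derivative] p
    have d: "((\<lambda>w. phi ?a (b w)) has_field_derivative phi_deriv ?a (b (pt (e k) z)) * db (pt (e k) z)) (at (pt (e k) z))"
      by simp
    show "(fun_of (T (F k)) has_field_derivative phi_deriv ?a (b (pt (e k) z)) * db (pt (e k) z)) (at (pt (e k) z))"
    proof (rule has_field_derivative_transform_within_open[OF d open_ball inD[OF z]])
      fix w assume w: "w \<in> unit_disc"
      then have "b w \<in> unit_disc"
        using norm_b_less_1[of w] by simp
      then show "phi ?a (b w) = fun_of (T (F k)) w"
        unfolding Tev[OF w] F_def fun_of_minimal_of[OF Fat] on_disc_def by (simp only: if_True)
    qed
  qed
  have LTlim: "(\<lambda>k. L k (T (F k))) \<longlonglongrightarrow> - of_nat n"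
  proof -
    have "(\<lambda>k. L k (T (F k))) \<longlonglongrightarrow> (\<Sum>z\<in>Z. - 1)"
      unfolding LT by (intro tendsto_sum test_term_tendsto e e0)
    then show ?thesis by (simp add: card_Z)
  qed
  have "compact (closure (K ` cball 0 1))"
    using K by (simp add: compact_operator_def)
  moreover have "\<forall>k. K (F k) \<in> closure (K ` cball 0 1)"
    using F1 closure_subset by (intro allI subsetD[OF closure_subset] imageI) simp
  ultimately obtain G r where r: "strict_mono (r :: nat \<Rightarrow> nat)" and G: "((\<lambda>k. K (F k)) \<circ> r) \<longlonglongrightarrow> G"
    unfolding compact_eq_seq_compact_metric seq_compact_def by metis
  \<comment> \<open>The functionals tend to 0 only at a fixed argument. The moving argument
    \<open>K (F (r k))\<close> is therefore compared with its limit \<open>G\<close>, and the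
    uniform bound 2 controls the difference.\<close>
  have LK: "(\<lambda>k. L (r k) (K (F (r k)))) \<longlonglongrightarrow> 0"
  proof (rule Lim_null_comparison)
    have "(\<lambda>k. norm (K (F (r k)) - G)) \<longlonglongrightarrow> 0"
      using G by (simp add: o_def tendsto_norm_zero LIM_zero)
    moreover have "(\<lambda>k. norm (L (r k) G)) \<longlonglongrightarrow> 0"
      using LIMSEQ_subseq_LIMSEQ[OF L0[of G] r] by (simp add: o_def tendsto_norm_zero)
    ultimately show "(\<lambda>k. 2 * norm (K (F (r k)) - G) + norm (L (r k) G)) \<longlonglongrightarrow> 0"
      by (intro tendsto_add_zero tendsto_mult_right_zero)
    show "\<forall>\<^sub>F k in sequentially. norm (L (r k) (K (F (r k)))) \<le> 2 * norm (K (F (r k)) - G) + norm (L (r k) G)"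
    proof (intro always_eventually allI)
      fix k
      have "L (r k) (K (F (r k))) = L (r k) (K (F (r k)) - G) + L (r k) G"
        by (simp add: Ldiff)
      then have "norm (L (r k) (K (F (r k)))) \<le> norm (L (r k) (K (F (r k)) - G)) + norm (L (r k) G)"
        by (metis norm_triangle_ineq)
      then show "norm (L (r k) (K (F (r k)))) \<le> 2 * norm (K (F (r k)) - G) + norm (L (r k) G)"
        using L2[of "r k" "K (F (r k)) - G"] by linarith
    qed
  qed
  have "(\<lambda>k. norm (L (r k) (T (F (r k))) - L (r k) (K (F (r k))))) \<longlonglongrightarrow> norm (- of_nat n - 0 :: complex)"
    using LIMSEQ_subseq_LIMSEQ[OF LTlim r] by (intro tendsto_intros LK) (simp add: o_def)
  moreover have "norm (L (r k) (T (F (r k))) - L (r k) (K (F (r k)))) \<le> 2 * onorm (\<lambda>F. T F - K F)" for k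
  proof -
    have "norm (L (r k) (T (F (r k))) - L (r k) (K (F (r k)))) \<le> 2 * norm (T (F (r k)) - K (F (r k)))"
      unfolding Ldiff[symmetric] by (rule L2)
    also have "\<dots> \<le> 2 * (onorm (\<lambda>F. T F - K F) * norm (F (r k)))"
      using onorm[OF TK] by simp
    also have "\<dots> \<le> 2 * (onorm (\<lambda>F. T F - K F) * 1)"
      by (intro mult_left_mono F1 onorm_pos_le TK) simp
    finally show ?thesis by simp
  qed
  ultimately have "norm (- of_nat n - 0 :: complex) \<le> 2 * onorm (\<lambda>F. T F - K F)"
    by (intro LIMSEQ_le_const2) auto
  then show ?thesis
    by (simp add: T_def)
qed

end

lemma compact_operator_zero: "compact_operator (\<lambda>_. 0)"
proof -
  interpret vector_space scaleC by (rule vector_space_scaleC)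
  interpret vector_space_pair scaleC scaleC by unfold_locales
  have "(\<lambda>_::minimal. 0::minimal) ` cball 0 1 = {0}"
    by (auto intro!: image_eqI[where x = 0])
  then show ?thesis
    unfolding compact_operator_def using linear_zero by simp
qed

theorem theorem2:
  "\<exists>C::real. C > 0 \<and>
     (\<forall>n::nat. n \<ge> 1 \<longrightarrow> (\<forall>B. blaschke_product n B \<longrightarrow>
        (\<forall>f\<in>minimal_space. on_disc (f \<circ> B) \<in> minimal_space) \<and>
        bounded_linear (composition_operator B) \<and>
        inverse C * real n \<le> essential_norm (composition_operator B) \<and>
        essential_norm (composition_operator B) \<le> C * real n \<and>
        inverse C * real n \<le> onorm (composition_operator B) \<and>
        onorm (composition_operator B) \<le> C * real n))"
proof (intro exI[of _ "70 + 4224 * pi"] conjI allI impI)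
  show "70 + 4224 * pi > 0"
    by (intro add_pos_pos) auto
  fix n :: nat and B assume n: "n \<ge> 1" and B: "blaschke_product n B"
  let ?T = "composition_operator B"
  obtain c \<alpha> where "blaschke_data n c \<alpha>" and b: "\<And>z. z \<in> unit_disc \<Longrightarrow> B z = blaschke_data.b n c \<alpha> z"
    using blaschke_productE[OF B n] by blast
  then interpret blaschke_data n c \<alpha> by simp
  show "\<forall>f\<in>minimal_space. on_disc (f \<circ> B) \<in> minimal_space"
    using composition_operator_blaschke(1)[OF B n] by blast
  show T: "bounded_linear ?T"
    by (rule composition_operator_blaschke(4)[OF B n])
  have low: "real n / 2 \<le> onorm (\<lambda>F. ?T F - K F)" if "compact_operator K" for K
    by (rule onorm_composition_minus_compact_ge[OF B b that])
  have up: "onorm ?T \<le> (70 + 4224 * pi) * real n"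
    using composition_operator_blaschke(3)[OF B n] by (intro onorm_bound) auto
  then show "onorm ?T \<le> (70 + 4224 * pi) * real n" .
  have "inverse (70 + 4224 * pi) \<le> inverse 2"
    by (intro le_imp_inverse_le) (auto intro: add_increasing2)
  then have "inverse (70 + 4224 * pi) * real n \<le> inverse 2 * real n"
    by (intro mult_right_mono) auto
  then have inv: "inverse (70 + 4224 * pi) * real n \<le> real n / 2"
    by simp
  \<comment> \<open>The zero operator is compact, so the operator norm itself is among the
    quantities bounded below by \<open>low\<close>.\<close>
  show "inverse (70 + 4224 * pi) * real n \<le> onorm ?T"
    using inv low[OF compact_operator_zero] by simp
  have "real n / 2 \<le> essential_norm ?T"
    unfolding essential_norm_def by (rule cInf_greatest) (use low compact_operator_zero in auto)
  then show "inverse (70 + 4224 * pi) * real n \<le> essential_norm ?T"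
    using inv by linarith
  have "essential_norm ?T \<le> onorm (\<lambda>F. ?T F - 0)"
    unfolding essential_norm_def
  proof (rule cInf_lower)
    show "onorm (\<lambda>F. ?T F - 0) \<in> {onorm (\<lambda>f. ?T f - K f) |K. compact_operator K}"
      using compact_operator_zero by (intro CollectI exI[of _ "\<lambda>_. 0"] conjI refl)
    show "bdd_below {onorm (\<lambda>f. ?T f - K f) |K. compact_operator K}"
      by (rule bdd_belowI[of _ "real n / 2"]) (use low in auto)
  qed
  then show "essential_norm ?T \<le> (70 + 4224 * pi) * real n"
    using up by simp
qed

end
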